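(* Let $\mathfrak{o}$ be a compact discrete valuation ring of characteristic $0$ with finite residue field of characteristic $2$ and ramification index $e$, and let $\mathfrak{o}'$ be a compact discrete valuation ring of characteristic $2$ (with finite residue field), with maximal ideals $\mathfrak{p},\mathfrak{p}'$ respectively, such that $\mathfrak{o}/\mathfrak{p}\cong\mathfrak{o}'/\mathfrak{p}'$. Then for every integer $r>e$ the group algebras $\mathbb{C}[\mathrm{SL}_2(\mathfrak{o}/\mathfrak{p}^{2r})]$ and $\mathbb{C}[\mathrm{SL}_2(\mathfrak{o}'/\mathfrak{p}'^{2r})]$ are not isomorphic.
   Context: The ramification index $e$ of $\mathfrak{o}$ is defined by $2\mathfrak{o}=\mathfrak{p}^{e}$. Isomorphism means isomorphism of $\mathbb{C}$-algebras. *)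

theory Defs
  imports "HOL-Analysis.Abstract_Topology" "HOL-Algebra.Algebra"
begin

text \<open>The characteristic is the nonnegative generator of the kernel of the map from the
  integers, i.e. the additive order of \<open>\<one>\<close>, where \<^const>\<open>group.ord\<close> is 0 for infinite order.\<close>

definition ring_char :: "('a, 'm) ring_scheme \<Rightarrow> nat" where
  "ring_char R = group.ord (add_monoid R) \<one>\<^bsub>R\<^esub>"

lemma (in ring) ring_char_dvd_iff:
  "ring_char R dvd n \<longleftrightarrow> add_pow R n \<one> = \<zero>"
  unfolding ring_char_def using add.pow_eq_id[of \<one> n] by (simp add: add_pow_def)

abbreviation ideal_power :: "('a, 'm) ring_scheme \<Rightarrow> 'a set \<Rightarrow> nat \<Rightarrow> 'a set" where
  "ideal_power R I n \<equiv> I [^]\<^bsub>ideals_set R\<^esub> n"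

text \<open>The topology in which the cosets \<open>x + I\<^sup>n\<close> form a neighbourhood basis at \<open>x\<close>;
  for a discrete valuation ring and its maximal ideal, this is the topology of the valuation.\<close>

definition adic_topology :: "('a, 'm) ring_scheme \<Rightarrow> 'a set \<Rightarrow> 'a topology" where
  "adic_topology R I = topology (\<lambda>U. U \<subseteq> carrier R \<and>
     (\<forall>x\<in>U. \<exists>n::nat. ideal_power R I n +>\<^bsub>R\<^esub> x \<subseteq> U))"

lemma (in ring) ideal_power_ideal:
  assumes "ideal I R"
  shows "ideal (ideal_power R I n) R"
proof (induction n)
  case 0
  then show ?case by (simp add: ideals_set_def oneideal)
next
  case (Suc n)
  then show ?case using ideal_prod_is_ideal[OF Suc assms] by (simp add: ideals_set_def nat_pow_def)
qed

lemma (in ring) ideal_power_decreasing: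
  assumes "ideal I R" "m \<le> n"
  shows "ideal_power R I n \<subseteq> ideal_power R I m"
  using assms(2)
proof (induction n rule: dec_induct)
  case (step n)
  have "ideal_power R I (Suc n) \<subseteq> ideal_power R I n"
    using ideal_prod_inter[OF ideal_power_ideal[OF assms(1)] assms(1), of n]
    by (simp add: ideals_set_def nat_pow_def)
  with step show ?case by blast
qed simp

lemma (in ring) openin_adic_topology:
  assumes "ideal I R"
  shows "openin (adic_topology R I) U \<longleftrightarrow>
    U \<subseteq> carrier R \<and> (\<forall>x\<in>U. \<exists>n::nat. ideal_power R I n +> x \<subseteq> U)"
proof -
  let ?P = "\<lambda>U. U \<subseteq> carrier R \<and> (\<forall>x\<in>U. \<exists>n::nat. ideal_power R I n +> x \<subseteq> U)"
  have mono: "ideal_power R I n +> x \<subseteq> ideal_power R I m +> x" if "m \<le> n" for m n :: nat and x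
    using ideal_power_decreasing[OF assms that] by (auto simp: a_r_coset_def')
  have "istopology ?P"
    unfolding istopology_def
  proof (intro conjI allI impI)
    fix S T assume S: "?P S" and T: "?P T"
    show "S \<inter> T \<subseteq> carrier R" using S by blast
    show "\<forall>x\<in>S \<inter> T. \<exists>n::nat. ideal_power R I n +> x \<subseteq> S \<inter> T"
    proof
      fix x assume "x \<in> S \<inter> T"
      then obtain m n :: nat where "ideal_power R I m +> x \<subseteq> S" "ideal_power R I n +> x \<subseteq> T"
        using S T by blast
      then have "ideal_power R I (max m n) +> x \<subseteq> S \<inter> T"
        using mono[of m "max m n" x] mono[of n "max m n" x] by auto
      then show "\<exists>n::nat. ideal_power R I n +> x \<subseteq> S \<inter> T" ..
    qed
  next
    fix \<K> assume K: "\<forall>K\<in>\<K>. ?P K"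
    show "\<Union>\<K> \<subseteq> carrier R" using K by blast
    show "\<forall>x\<in>\<Union>\<K>. \<exists>n::nat. ideal_power R I n +> x \<subseteq> \<Union>\<K>"
    proof
      fix x assume "x \<in> \<Union>\<K>"
      then obtain K where "K \<in> \<K>" "x \<in> K" by blast
      moreover from this K obtain n :: nat where "ideal_power R I n +> x \<subseteq> K" by blast
      ultimately have "ideal_power R I n +> x \<subseteq> \<Union>\<K>" by blast
      then show "\<exists>n::nat. ideal_power R I n +> x \<subseteq> \<Union>\<K>" ..
    qed
  qed
  then show ?thesis
    by (simp add: adic_topology_def topology_inverse')
qed

lemma (in ring) topspace_adic_topology:
  assumes "ideal I R"
  shows "topspace (adic_topology R I) = carrier R"
proof -
  have "ideal_power R I n +> x \<subseteq> carrier R" if "x \<in> carrier R" for x and n :: nat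
    using ideal.Icarr[OF ideal_power_ideal[OF assms]] that by (auto simp: a_r_coset_def')
  then have "openin (adic_topology R I) (carrier R)"
    by (auto simp: openin_adic_topology[OF assms])
  moreover have "topspace (adic_topology R I) \<subseteq> carrier R"
    using openin_topspace[of "adic_topology R I"]
    unfolding openin_adic_topology[OF assms] by (rule conjunct1)
  ultimately show ?thesis
    using openin_subset by (intro subset_antisym)
qed

text \<open>A discrete valuation ring is a local principal ideal domain that is not a field.\<close>

locale discrete_valuation_ring = principal_domain R + maximalideal \<pp> R
  for R (structure) and \<pp> +
  assumes maximalideal_unique: "maximalideal J R \<Longrightarrow> J = \<pp>"
    and maximalideal_nonzero: "\<pp> \<noteq> {\<zero>}"

locale compact_discrete_valuation_ring = discrete_valuation_ring +
  assumes compact: "compact_space (adic_topology R \<pp>)"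

text \<open>The quadruple \<open>(a, b, c, d)\<close> stands for the matrix with rows \<open>(a, b)\<close> and \<open>(c, d)\<close>.\<close>

definition SL2 :: "('a, 'm) ring_scheme \<Rightarrow> ('a \<times> 'a \<times> 'a \<times> 'a) monoid" where
  "SL2 R = \<lparr>
     carrier = {(a, b, c, d). a \<in> carrier R \<and> b \<in> carrier R \<and> c \<in> carrier R \<and> d \<in> carrier R \<and>
       a \<otimes>\<^bsub>R\<^esub> d \<ominus>\<^bsub>R\<^esub> b \<otimes>\<^bsub>R\<^esub> c = \<one>\<^bsub>R\<^esub>},
     monoid.mult = (\<lambda>(a, b, c, d) (a', b', c', d').
       (a \<otimes>\<^bsub>R\<^esub> a' \<oplus>\<^bsub>R\<^esub> b \<otimes>\<^bsub>R\<^esub> c', a \<otimes>\<^bsub>R\<^esub> b' \<oplus>\<^bsub>R\<^esub> b \<otimes>\<^bsub>R\<^esub> d',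
        c \<otimes>\<^bsub>R\<^esub> a' \<oplus>\<^bsub>R\<^esub> d \<otimes>\<^bsub>R\<^esub> c', c \<otimes>\<^bsub>R\<^esub> b' \<oplus>\<^bsub>R\<^esub> d \<otimes>\<^bsub>R\<^esub> d')),
     one = (\<one>\<^bsub>R\<^esub>, \<zero>\<^bsub>R\<^esub>, \<zero>\<^bsub>R\<^esub>, \<one>\<^bsub>R\<^esub>)\<rparr>"

lemma (in cring) SL2_group: "group (SL2 R)"
proof (rule groupI, goal_cases)
  case (1 x y)
  obtain a b c d a' b' c' d' where xy: "x = (a, b, c, d)" "y = (a', b', c', d')"
    by (metis prod_cases4)
  have carr: "a \<in> carrier R" "b \<in> carrier R" "c \<in> carrier R" "d \<in> carrier R"
      "a' \<in> carrier R" "b' \<in> carrier R" "c' \<in> carrier R" "d' \<in> carrier R"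
    and det: "a \<otimes> d \<ominus> b \<otimes> c = \<one>" "a' \<otimes> d' \<ominus> b' \<otimes> c' = \<one>"
    using 1 by (auto simp: SL2_def xy)
  have "(a \<otimes> a' \<oplus> b \<otimes> c') \<otimes> (c \<otimes> b' \<oplus> d \<otimes> d') \<ominus> (a \<otimes> b' \<oplus> b \<otimes> d') \<otimes> (c \<otimes> a' \<oplus> d \<otimes> c')
      = (a \<otimes> d \<ominus> b \<otimes> c) \<otimes> (a' \<otimes> d' \<ominus> b' \<otimes> c')"
    using carr by algebra
  then show ?case using carr det by (simp add: SL2_def xy)
next
  case 2
  then show ?case by (simp add: SL2_def minus_eq)
next
  case (3 x y z)
  have assoc: "(p \<otimes> q \<oplus> r \<otimes> s) \<otimes> t \<oplus> (p \<otimes> u \<oplus> r \<otimes> v) \<otimes> w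
      = p \<otimes> (q \<otimes> t \<oplus> u \<otimes> w) \<oplus> r \<otimes> (s \<otimes> t \<oplus> v \<otimes> w)"
    if "p \<in> carrier R" "q \<in> carrier R" "r \<in> carrier R" "s \<in> carrier R" "t \<in> carrier R"
      "u \<in> carrier R" "v \<in> carrier R" "w \<in> carrier R" for p q r s t u v w
    using that by algebra
  from 3 show ?case
    by (auto simp: SL2_def assoc)
next
  case (4 x)
  then show ?case by (auto simp: SL2_def)
next
  case (5 x)
  then obtain a b c d where x: "x = (a, b, c, d)"
    and carr: "a \<in> carrier R" "b \<in> carrier R" "c \<in> carrier R" "d \<in> carrier R"
    and det: "a \<otimes> d \<ominus> b \<otimes> c = \<one>"
    by (auto simp: SL2_def)
  have "d \<otimes> a \<ominus> (\<ominus> b) \<otimes> (\<ominus> c) = \<one>" "d \<otimes> a \<oplus> (\<ominus> b) \<otimes> c = \<one>" "d \<otimes> b \<oplus> (\<ominus> b) \<otimes> d = \<zero>"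
    "(\<ominus> c) \<otimes> a \<oplus> a \<otimes> c = \<zero>" "(\<ominus> c) \<otimes> b \<oplus> a \<otimes> d = \<one>"
    unfolding det[symmetric] using carr by algebra+
  then show ?case using x carr
    by (intro bexI[of _ "(d, \<ominus> b, \<ominus> c, a)"]) (auto simp: SL2_def)
qed

text \<open>Elements of \<open>\<complex>[G]\<close> are the finitely supported functions on \<open>G\<close>, extended by 0 outside
  the carrier; the product is convolution.\<close>

definition group_algebra :: "('g, 'm) monoid_scheme \<Rightarrow> (complex, 'g \<Rightarrow> complex) module" where
  "group_algebra G = \<lparr>
     carrier = {f. finite {x. f x \<noteq> 0} \<and> {x. f x \<noteq> 0} \<subseteq> carrier G},
     monoid.mult = (\<lambda>f g x. \<Sum>(y, z) \<in> {(y, z). f y \<noteq> 0 \<and> g z \<noteq> 0 \<and> y \<otimes>\<^bsub>G\<^esub> z = x}. f y * g z),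
     one = (\<lambda>x. if x = \<one>\<^bsub>G\<^esub> then 1 else 0),
     ring.zero = (\<lambda>x. 0),
     ring.add = (\<lambda>f g x. f x + g x),
     smult = (\<lambda>c f x. c * f x)\<rparr>"

lemma group_algebra_mult_delta:
  fixes a b :: complex
  shows "(\<lambda>x. if x = g then a else 0) \<otimes>\<^bsub>group_algebra G\<^esub> (\<lambda>x. if x = h then b else 0)
    = (\<lambda>x. if x = g \<otimes>\<^bsub>G\<^esub> h then a * b else 0)"
proof
  fix x
  let ?S = "{(y, z). (if y = g then a else 0) \<noteq> 0 \<and> (if z = h then b else 0) \<noteq> 0 \<and> y \<otimes>\<^bsub>G\<^esub> z = x}"
  have "((\<lambda>x. if x = g then a else 0) \<otimes>\<^bsub>group_algebra G\<^esub> (\<lambda>x. if x = h then b else 0)) x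
      = (\<Sum>(y, z) \<in> ?S. (if y = g then a else 0) * (if z = h then b else 0))"
    by (simp only: group_algebra_def monoid.simps ring.simps)
  also have "?S = (if a \<noteq> 0 \<and> b \<noteq> 0 \<and> x = g \<otimes>\<^bsub>G\<^esub> h then {(g, h)} else {})"
    by (auto split: if_splits)
  also have "(\<Sum>(y, z) \<in> \<dots>. (if y = g then a else 0) * (if z = h then b else 0))
      = (if x = g \<otimes>\<^bsub>G\<^esub> h then a * b else 0)"
    by simp
  finally show "((\<lambda>x. if x = g then a else 0) \<otimes>\<^bsub>group_algebra G\<^esub> (\<lambda>x. if x = h then b else 0)) x
      = (if x = g \<otimes>\<^bsub>G\<^esub> h then a * b else 0)" .
qed

definition complex_algebras_isomorphic ::
    "(complex, 'a) module \<Rightarrow> (complex, 'b) module \<Rightarrow> bool" where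
  "complex_algebras_isomorphic A B \<longleftrightarrow>
     (\<exists>h \<in> ring_iso A B. \<forall>c. \<forall>x \<in> carrier A. h (c \<odot>\<^bsub>A\<^esub> x) = c \<odot>\<^bsub>B\<^esub> h x)"

end

theory Submission
  imports Defs "HOL-Library.Function_Algebras"
begin

text \<open>With \<open>S = \<oo>/\<pp>\<^sup>n\<close>, \<open>n = 2r\<close>, and \<open>E\<close> the unramified quadratic extension of \<open>S\<close>, the group \<open>SL\<^sub>2(S)\<close>
  is realised as a unitary group of pairs \<open>(x, z)\<close> over \<open>E\<close>, in which the norm one group \<open>T\<close> of \<open>E\<close>
  is the diagonal torus. A character \<open>\<theta>\<close> of \<open>T\<close> extends to \<open>B = {(x, z). z \<in> \<pi>\<^sup>r E}\<close> and is then induced;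
  it is primitive if it is nontrivial on \<open>H = T \<inter> (1 + \<pi>\<^bsup>n-1\<^esup> E)\<close>. The induced modules have dimension
  \<open>d = q\<^bsup>2r-1\<^esup>(q - 1)\<close>, those of \<open>\<theta>\<close> and \<open>\<theta>\<^sup>-\<^sup>1\<close> being isomorphic, and the two rings have equally many
  primitive characters.

  In characteristic 0 with \<open>r > e\<close>, every element of \<open>H\<close> is a square in \<open>T\<close>, so no primitive \<open>\<theta>\<close> is
  its own inverse; the modules of primitive characters are irreducible, and isomorphic only for
  inverse characters. In characteristic 2 every irreducible module of dimension \<open>d\<close> is induced from
  a primitive \<open>\<theta>\<close> with \<open>\<theta> \<noteq> \<theta>\<^sup>-\<^sup>1\<close>, and some primitive \<open>\<theta>\<close> is its own inverse. Hence there are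
  strictly fewer irreducible modules of dimension \<open>d\<close> in characteristic 2.

  Irreducible modules are represented by minimal idempotents \<open>f\<close> of the group algebra; the
  dimension is \<open>|G| f(1)\<close>.\<close>

section \<open>Characters of finite abelian groups\<close>

text \<open>Only one dimension is compared, so a lower bound for the number of irreducible modules
  in characteristic 0 and an upper bound in characteristic 2 suffice. An algebra isomorphism forgets
  the group, but it preserves minimal idempotents, their linkage and the trace
  \<open>|G| f(1)\<close>. The exponent is even because elements of \<open>\<pi>^r E\<close> then
  multiply to 0: on \<open>B\<close> the map \<open>(x, z) \<mapsto> x\<close> is multiplicative,
  and a character of \<open>T\<close> extends by ignoring \<open>z\<close>. A unitary form is used
  because it makes the nonsplit torus diagonal, with \<open>\<sigma>\<close> as inversion. The
  parity of \<open>n\<close> matters once more: in characteristic 2 squaring is additive, and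
  \<open>1 + \<pi>^(n-1)\<close> is not a square because \<open>n - 1\<close> is odd; a character
  trivial on squares but not on this element is primitive and self-inverse. The delicate point is
  that a module of dimension \<open>d\<close> must contain a character of \<open>B\<close> trivial
  on \<open>N = {(1, z)}\<close>. If it had no \<open>N\<close>-invariants, a torus element of odd
  prime order \<open>l\<close> dividing \<open>q + 1\<close> would have trace 0, together with its
  nontrivial powers, and \<open>l\<close> would divide \<open>d\<close>, which is
  impossible.\<close>

definition characters_on :: "('a, 'm) monoid_scheme \<Rightarrow> 'a set \<Rightarrow> ('a \<Rightarrow> complex) set" where
  "characters_on G H = {\<chi>. (\<forall>x\<in>H. \<forall>y\<in>H. \<chi> (x \<otimes>\<^bsub>G\<^esub> y) = \<chi> x * \<chi> y) \<and>
     (\<forall>x\<in>H. \<chi> x \<noteq> 0) \<and> (\<forall>x. x \<notin> H \<longrightarrow> \<chi> x = 0)}"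

lemma characters_onD:
  assumes "\<chi> \<in> characters_on G H"
  shows "x \<in> H \<Longrightarrow> y \<in> H \<Longrightarrow> \<chi> (x \<otimes>\<^bsub>G\<^esub> y) = \<chi> x * \<chi> y"
    and "x \<in> H \<Longrightarrow> \<chi> x \<noteq> 0" and "x \<notin> H \<Longrightarrow> \<chi> x = 0"
  using assms by (auto simp: characters_on_def)

lemma (in group) character_one:
  assumes "\<chi> \<in> characters_on G H" "subgroup H G"
  shows "\<chi> \<one> = 1"
proof -
  have 1: "\<one> \<in> H" using assms(2) by (simp add: subgroup.one_closed)
  have "\<chi> \<one> * \<chi> \<one> = \<chi> \<one>" using characters_onD(1)[OF assms(1) 1 1] by simp
  then show ?thesis using characters_onD(2)[OF assms(1) 1] by simp
qed

lemma (in group) character_inv: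
  assumes "\<chi> \<in> characters_on G H" "subgroup H G" "x \<in> H"
  shows "\<chi> (inv x) = inverse (\<chi> x)"
proof -
  have x: "x \<in> carrier G" "inv x \<in> H"
    using assms(2,3) subgroup.mem_carrier subgroup.m_inv_closed by metis+
  have "\<chi> (inv x) * \<chi> x = 1"
    using characters_onD(1)[OF assms(1) x(2) assms(3)] character_one[OF assms(1,2)] x by simp
  then show ?thesis using characters_onD(2)[OF assms(1,3)] by (simp add: field_simps)
qed

lemma (in group) character_pow:
  assumes "\<chi> \<in> characters_on G H" "subgroup H G" "x \<in> H"
  shows "\<chi> (x [^] (n::nat)) = \<chi> x ^ n"
proof (induction n)
  case 0
  then show ?case using character_one[OF assms(1,2)] by simp
next
  case (Suc n)
  have "x [^] n \<in> H" using subgroup_int_pow_closed[OF assms(2,3), of "int n"] by (simp add: int_pow_int)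
  then show ?case using characters_onD(1)[OF assms(1) _ assms(3)] Suc by simp
qed

text \<open>An extension of \<open>\<chi>\<close> to the group \<open>K\<close> generated by
  \<open>H\<close> and \<open>x\<close> is determined by its value \<open>z\<close> at
  \<open>x\<close>, and every solution of \<open>z ^ m = \<chi> (x [^] m)\<close> occurs, where
  \<open>m\<close> is the order of \<open>x\<close> modulo \<open>H\<close>. There are
  \<open>m\<close> solutions, and \<open>m\<close> is also the index of \<open>H\<close> in
  \<open>K\<close>.\<close>

lemma (in comm_group) adjoin_element:
  assumes H: "subgroup H G" and x: "x \<in> carrier G" "x \<notin> H" and fin: "finite (carrier G)"
  obtains K where "subgroup K G" "H \<subseteq> K" "x \<in> K"
    "\<And>\<chi>. \<chi> \<in> characters_on G H \<Longrightarrow>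
      finite {\<psi> \<in> characters_on G K. \<forall>h\<in>H. \<psi> h = \<chi> h} \<and>
      card {\<psi> \<in> characters_on G K. \<forall>h\<in>H. \<psi> h = \<chi> h} * card H = card K"
proof -
  note Hc = subgroup.mem_carrier[OF H]
  note Hm = subgroup.m_closed[OF H]
  note Hi = subgroup.m_inv_closed[OF H]
  note H1 = subgroup.one_closed[OF H]
  have xp: "x [^] (i::nat) \<in> carrier G" for i using x by simp
  define m where "m = (LEAST m::nat. 0 < m \<and> x [^] m \<in> H)"
  have "0 < order G \<and> x [^] order G \<in> H"
    using fin pow_order_eq_1[OF x(1)] H1 by (simp add: order_gt_0_iff_finite)
  then have m: "0 < m" "x [^] m \<in> H" unfolding m_def
    using LeastI[of "\<lambda>m. 0 < m \<and> x [^] m \<in> H" "order G"] by auto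
  have mmin: "k = 0" if "k < m" "x [^] k \<in> H" for k :: nat
    using that not_less_Least[of k "\<lambda>m. 0 < m \<and> x [^] m \<in> H"] unfolding m_def by auto
  have pmt: "x [^] (m * t) \<in> H" for t :: nat
  proof (induction t)
    case (Suc t)
    have "x [^] (m * Suc t) = x [^] m \<otimes> x [^] (m * t)"
      using nat_pow_mult[OF x(1), of m "m*t"] by (simp add: add.commute)
    then show ?case using Suc Hm[OF m(2)] by simp
  qed (simp add: H1)
  have mdvd: "m dvd k" if "x [^] k \<in> H" for k :: nat
  proof -
    have "x [^] k = x [^] (m * (k div m)) \<otimes> x [^] (k mod m)"
      using nat_pow_mult[OF x(1), of "m * (k div m)" "k mod m"] by simp
    then have "x [^] (k mod m) = inv (x [^] (m * (k div m))) \<otimes> x [^] k"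
      using xp by (simp add: m_assoc[symmetric])
    then have "x [^] (k mod m) \<in> H" using Hm Hi pmt that by simp
    then have "k mod m = 0" using mmin m(1) by simp
    then show ?thesis by auto
  qed
  \<comment> \<open>Natural exponents are enough: the inverse of \<open>x [^] i\<close> is an
    element of \<open>H\<close> times \<open>x [^] (m * i - i)\<close>.\<close>
  define K where "K = {h \<otimes> x [^] (i::nat) | h i. h \<in> H}"
  have hxh: "(h \<otimes> x [^] i) \<otimes> (h' \<otimes> x [^] j) = (h \<otimes> h') \<otimes> x [^] (i + j)"
    if "h \<in> H" "h' \<in> H" for h h' and i j :: nat
  proof -
    have "(h \<otimes> x [^] i) \<otimes> (h' \<otimes> x [^] j) = (h \<otimes> h') \<otimes> (x [^] i \<otimes> x [^] j)"
      using that Hc xp by (simp add: m_ac)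
    then show ?thesis using x by (simp add: nat_pow_mult)
  qed
  have KI: "h \<otimes> x [^] i \<in> K" if "h \<in> H" for h and i :: nat using that unfolding K_def by blast
  have HK: "H \<subseteq> K"
  proof
    fix h assume "h \<in> H" then show "h \<in> K" using KI[of h 0] Hc by simp
  qed
  have xK: "x \<in> K" using KI[OF H1, of 1] x by simp
  have Kc: "K \<subseteq> carrier G" unfolding K_def using Hc xp by auto
  have subK: "subgroup K G"
  proof (rule subgroupI)
    show "K \<subseteq> carrier G" by (rule Kc)
    show "K \<noteq> {}" using xK by blast
    show "a \<otimes> b \<in> K" if ab: "a \<in> K" "b \<in> K" for a b
    proof -
      obtain h i h' j where "h \<in> H" "h' \<in> H" "a = h \<otimes> x [^] (i::nat)" "b = h' \<otimes> x [^] (j::nat)"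
        using ab unfolding K_def by blast
      then show ?thesis using hxh KI Hm by simp
    qed
    show "inv a \<in> K" if a: "a \<in> K" for a
    proof -
      obtain h and i :: nat where h: "h \<in> H" "a = h \<otimes> x [^] i" using a unfolding K_def by blast
      have "m * i - i + i = m * i" using m(1) by (cases m) auto
      have "inv h \<otimes> inv (x [^] (m * i)) \<otimes> x [^] (m * i - i) \<otimes> (h \<otimes> x [^] i)
        = inv h \<otimes> inv (x [^] (m * i)) \<otimes> h \<otimes> x [^] (m * i - i + i)"
        using hxh[of "inv h \<otimes> inv (x [^] (m * i))" h "m*i-i" i] Hm Hi pmt h(1) by (simp add: m_assoc)
      also have "\<dots> = \<one>" unfolding \<open>m * i - i + i = m * i\<close>
        using h(1) Hc xp by (simp add: m_ac)
      finally have "inv a = inv h \<otimes> inv (x [^] (m * i)) \<otimes> x [^] (m * i - i)"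
        using h Hc xp by (intro inv_equality) auto
      then show ?thesis using KI Hm Hi pmt h(1) by simp
    qed
  qed
  have Kred: "\<exists>h\<in>H. \<exists>i<m. k = h \<otimes> x [^] i" if k: "k \<in> K" for k
  proof -
    obtain h and i :: nat where h: "h \<in> H" "k = h \<otimes> x [^] i" using k unfolding K_def by blast
    have "x [^] i = x [^] (m * (i div m)) \<otimes> x [^] (i mod m)"
      using nat_pow_mult[OF x(1), of "m * (i div m)" "i mod m"] by simp
    then have "k = (h \<otimes> x [^] (m * (i div m))) \<otimes> x [^] (i mod m)"
      using h Hc xp by (simp add: m_assoc)
    moreover have "h \<otimes> x [^] (m * (i div m)) \<in> H" "i mod m < m"
      using Hm[OF h(1) pmt[of "i div m"]] m(1) by simp_all
    ultimately show ?thesis by blast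
  qed
  have inj: "inj_on (\<lambda>(h, i). h \<otimes> x [^] i) (H \<times> {..<m})"
  proof -
    have *: "i = j \<and> h = h'" if "h \<in> H" "h' \<in> H" "i < m" "j < m" "i \<le> j" "h \<otimes> x [^] i = h' \<otimes> x [^] j"
      for h h' and i j :: nat
    proof -
      have "x [^] j = x [^] (j - i) \<otimes> x [^] i" using that x nat_pow_mult[of x "j-i" i] by simp
      then have "h \<otimes> x [^] i = (h' \<otimes> x [^] (j - i)) \<otimes> x [^] i"
        using that Hc xp by (simp add: m_assoc)
      then have "h = h' \<otimes> x [^] (j - i)"
        using that Hc xp by simp
      then have "x [^] (j - i) = inv h' \<otimes> h" using that Hc xp by (simp add: m_assoc[symmetric])
      then have "x [^] (j - i) \<in> H" using that Hm Hi by simp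
      then have "j - i = 0" using mmin[of "j - i"] that by simp
      then have "i = j" using that by simp
      then show ?thesis using \<open>h = h' \<otimes> x [^] (j - i)\<close> that Hc by simp
    qed
    show ?thesis
    proof (rule inj_onI, clarify)
      fix h i h' j
      assume a: "h \<in> H" "i < m" "h' \<in> H" "j < m" "h \<otimes> x [^] i = h' \<otimes> x [^] j"
      show "h = h' \<and> i = j"
        using *[of h h' i j] *[of h' h j i] a by (cases "i \<le> j") auto
    qed
  qed
  have "K = (\<lambda>(h, i). h \<otimes> x [^] i) ` (H \<times> {..<m})"
  proof (intro equalityI subsetI)
    fix k assume "k \<in> K"
    then obtain h i where "h \<in> H" "i < m" "k = h \<otimes> x [^] i" using Kred by blast
    then show "k \<in> (\<lambda>(h, i). h \<otimes> x [^] i) ` (H \<times> {..<m})" by (intro image_eqI[of _ _ "(h, i)"]) auto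
  qed (use KI in auto)
  then have cardK: "card K = card H * m"
    using card_image[OF inj] by (simp add: card_cartesian_product)
  have ext: "finite {\<psi> \<in> characters_on G K. \<forall>h\<in>H. \<psi> h = \<chi> h} \<and>
      card {\<psi> \<in> characters_on G K. \<forall>h\<in>H. \<psi> h = \<chi> h} * card H = card K"
    if \<chi>: "\<chi> \<in> characters_on G H" for \<chi>
  proof -
    let ?E = "{\<psi> \<in> characters_on G K. \<forall>h\<in>H. \<psi> h = \<chi> h}"
    let ?Z = "{z. z ^ m = \<chi> (x [^] m)}"
    have val: "\<psi> (h \<otimes> x [^] i) = \<chi> h * \<psi> x ^ i" if "\<psi> \<in> ?E" "h \<in> H" for \<psi> h and i :: nat
    proof -
      have p: "\<psi> \<in> characters_on G K" using that by simp
      have "x [^] i \<in> K" using KI[OF H1, of i] xp by simp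
      then show ?thesis
        using characters_onD(1)[OF p, of h "x [^] i"] character_pow[OF p subK xK, of i] that HK by auto
    qed
    have "bij_betw (\<lambda>\<psi>. \<psi> x) ?E ?Z"
    proof (rule bij_betw_imageI)
      show "inj_on (\<lambda>\<psi>. \<psi> x) ?E"
      proof (rule inj_onI)
        fix \<psi> \<psi>' assume a: "\<psi> \<in> ?E" "\<psi>' \<in> ?E" "\<psi> x = \<psi>' x"
        show "\<psi> = \<psi>'"
        proof
          fix k show "\<psi> k = \<psi>' k"
          proof (cases "k \<in> K")
            case True
            then show ?thesis using val[OF a(1)] val[OF a(2)] a(3) unfolding K_def by auto
          next
            case False
            then show ?thesis using a characters_onD(3)[of \<psi> G K k] characters_onD(3)[of \<psi>' G K k] by simp
          qed
        qed
      qed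
      show "(\<lambda>\<psi>. \<psi> x) ` ?E = ?Z"
      proof (intro equalityI subsetI)
        fix z assume "z \<in> (\<lambda>\<psi>. \<psi> x) ` ?E"
        then obtain \<psi> where p: "\<psi> \<in> ?E" "z = \<psi> x" by blast
        have "\<psi> (x [^] m) = \<psi> x ^ m" using character_pow[of \<psi> K x m] p subK xK by simp
        then show "z \<in> ?Z" using p m(2) by simp
      next
        fix z assume z: "z \<in> ?Z"
        have zmt: "\<chi> (x [^] (m * t)) = z ^ (m * t)" for t :: nat
        proof -
          have "\<chi> ((x [^] m) [^] t) = (\<chi> (x [^] m)) ^ t" using character_pow[OF \<chi> H m(2)] .
          then show ?thesis using z x by (simp add: nat_pow_pow power_mult)
        qed
        have wd1: "\<chi> h * z ^ i = \<chi> h' * z ^ j"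
          if "h \<in> H" "h' \<in> H" "i \<le> j" "h \<otimes> x [^] i = h' \<otimes> x [^] j" for h h' and i j :: nat
        proof -
          have "x [^] j = x [^] (j - i) \<otimes> x [^] i" using that x nat_pow_mult[of x "j-i" i] by simp
          then have "h \<otimes> x [^] i = (h' \<otimes> x [^] (j - i)) \<otimes> x [^] i"
            using that Hc xp by (simp add: m_assoc)
          then have h: "h = h' \<otimes> x [^] (j - i)"
            using that Hc xp by simp
          then have "x [^] (j - i) = inv h' \<otimes> h" using that Hc xp by (simp add: m_assoc[symmetric])
          then have xH: "x [^] (j - i) \<in> H" using that Hm Hi by simp
          then obtain t where "j - i = m * t" using mdvd by blast
          then have "\<chi> (x [^] (j - i)) = z ^ (j - i)" using zmt by simp
          then have "\<chi> h = \<chi> h' * z ^ (j - i)"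
            using h characters_onD(1)[OF \<chi> that(2) xH] by simp
          then show ?thesis using that(3) by (simp add: power_add[symmetric])
        qed
        have wd: "\<chi> h * z ^ i = \<chi> h' * z ^ j"
          if "h \<in> H" "h' \<in> H" "h \<otimes> x [^] i = h' \<otimes> x [^] j" for h h' and i j :: nat
          using wd1[of h h' i j] wd1[of h' h j i] that by (cases "i \<le> j") auto
        \<comment> \<open>The value is read off from any representation
          \<open>k = h \<otimes> x [^] i\<close>; \<open>wd\<close> makes it independent of the
          choice.\<close>
        define \<psi> where "\<psi> k = (if k \<in> K then
           (THE c. \<exists>h\<in>H. \<exists>i::nat. k = h \<otimes> x [^] i \<and> c = \<chi> h * z ^ i) else 0)" for k
        have v: "\<psi> (h \<otimes> x [^] i) = \<chi> h * z ^ i" if "h \<in> H" for h and i :: nat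
        proof -
          have "(THE c. \<exists>h'\<in>H. \<exists>j::nat. h \<otimes> x [^] i = h' \<otimes> x [^] j \<and> c = \<chi> h' * z ^ j) = \<chi> h * z ^ i"
          proof (rule the_equality)
            fix c assume "\<exists>h'\<in>H. \<exists>j::nat. h \<otimes> x [^] i = h' \<otimes> x [^] j \<and> c = \<chi> h' * z ^ j"
            then obtain h' j where "h' \<in> H" "h \<otimes> x [^] i = h' \<otimes> x [^] (j::nat)" "c = \<chi> h' * z ^ j"
              by blast
            then show "c = \<chi> h * z ^ i" using wd[OF that] by simp
          qed (use that in blast)
          then show ?thesis using KI[OF that] by (simp add: \<psi>_def)
        qed
        have z0: "z \<noteq> 0" using z m characters_onD(2)[OF \<chi> m(2)] by (auto simp: power_0_left)
        have "\<psi> \<in> characters_on G K"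
          unfolding characters_on_def
        proof (intro CollectI conjI ballI allI impI)
          fix a b assume "a \<in> K" "b \<in> K"
          then obtain h i h' j where "h \<in> H" "h' \<in> H" "a = h \<otimes> x [^] (i::nat)" "b = h' \<otimes> x [^] (j::nat)"
            unfolding K_def by blast
          then show "\<psi> (a \<otimes> b) = \<psi> a * \<psi> b"
            using hxh v Hm characters_onD(1)[OF \<chi>] by (simp add: power_add)
        next
          fix a assume "a \<in> K"
          then show "\<psi> a \<noteq> 0" unfolding K_def using v characters_onD(2)[OF \<chi>] z0 by auto
        next
          fix a assume "a \<notin> K" then show "\<psi> a = 0" by (simp add: \<psi>_def)
        qed
        moreover have "\<psi> h = \<chi> h" if "h \<in> H" for h using v[OF that, of 0] Hc that by simp
        moreover have "\<psi> x = z" using v[OF H1, of 1] x character_one[OF \<chi> H] by simp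
        ultimately show "z \<in> (\<lambda>\<psi>. \<psi> x) ` ?E" by (intro image_eqI[of _ _ \<psi>]) auto
      qed
    qed
    moreover have "card ?Z = m" using card_nth_roots[OF characters_onD(2)[OF \<chi> m(2)] m(1)] .
    ultimately have E: "card ?E = m" by (simp add: bij_betw_same_card)
    then have "finite ?E" using m(1) by (intro card_ge_0_finite) simp
    then show ?thesis using cardK E by simp
  qed
  show thesis by (rule that[OF subK HK xK ext])
qed

text \<open>Extensions to \<open>G\<close> are sorted by their restriction to a group
  \<open>K\<close> one \<open>adjoin_element\<close> step above \<open>H\<close>; the counts for
  \<open>H \<subseteq> K\<close> and for \<open>K \<subseteq> G\<close> multiply.\<close>

lemma (in comm_group) card_character_extensions:
  assumes "finite (carrier G)" "subgroup H G" "\<chi> \<in> characters_on G H"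
  shows "finite {\<psi> \<in> characters_on G (carrier G). \<forall>h\<in>H. \<psi> h = \<chi> h} \<and>
    card {\<psi> \<in> characters_on G (carrier G). \<forall>h\<in>H. \<psi> h = \<chi> h} * card H = card (carrier G)"
  using assms(2,3)
proof (induction "card (carrier G) - card H" arbitrary: H \<chi> rule: less_induct)
  case less
  have Hsub: "H \<subseteq> carrier G" using subgroup.subset[OF less.prems(1)] .
  show ?case
  proof (cases "H = carrier G")
    case True
    have "{\<psi> \<in> characters_on G (carrier G). \<forall>h\<in>H. \<psi> h = \<chi> h} = {\<chi>}"
    proof (intro equalityI subsetI)
      fix \<psi> assume p: "\<psi> \<in> {\<psi> \<in> characters_on G (carrier G). \<forall>h\<in>H. \<psi> h = \<chi> h}"
      have "\<psi> k = \<chi> k" for k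
        using p True characters_onD(3)[OF less.prems(2), of k] characters_onD(3)[of \<psi> G "carrier G" k]
        by (cases "k \<in> H") auto
      then show "\<psi> \<in> {\<chi>}" by auto
    qed (use less.prems(2) True in auto)
    then show ?thesis using True by simp
  next
    case False
    then obtain x where x: "x \<in> carrier G" "x \<notin> H" using Hsub by blast
    obtain K where K: "subgroup K G" "H \<subseteq> K" "x \<in> K"
      "\<And>\<chi>. \<chi> \<in> characters_on G H \<Longrightarrow>
      finite {\<psi> \<in> characters_on G K. \<forall>h\<in>H. \<psi> h = \<chi> h} \<and>
      card {\<psi> \<in> characters_on G K. \<forall>h\<in>H. \<psi> h = \<chi> h} * card H = card K"
      by (rule adjoin_element[OF less.prems(1) x assms(1)]) (rule that)
    have Ksub: "K \<subseteq> carrier G" using subgroup.subset[OF K(1)] .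
    have finK: "finite K" using Ksub assms(1) finite_subset by blast
    have "card H < card K" using K(2,3) x(2) finK by (intro psubset_card_mono) auto
    moreover have "card K \<le> card (carrier G)" using Ksub assms(1) card_mono by blast
    ultimately have lt: "card (carrier G) - card K < card (carrier G) - card H" by simp
    let ?F = "\<lambda>\<phi>. {\<psi> \<in> characters_on G (carrier G). \<forall>h\<in>K. \<psi> h = \<phi> h}"
    let ?E = "{\<psi> \<in> characters_on G K. \<forall>h\<in>H. \<psi> h = \<chi> h}"
    have IH: "finite (?F \<phi>)" "card (?F \<phi>) * card K = card (carrier G)" if "\<phi> \<in> ?E" for \<phi>
      using less.hyps[OF lt K(1), of \<phi>] that by auto
    have E: "finite ?E" "card ?E * card H = card K" using K(4)[OF less.prems(2)] by auto
    have un: "{\<psi> \<in> characters_on G (carrier G). \<forall>h\<in>H. \<psi> h = \<chi> h} = (\<Union>\<phi>\<in>?E. ?F \<phi>)"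
    proof (intro equalityI subsetI)
      fix \<psi> assume p: "\<psi> \<in> {\<psi> \<in> characters_on G (carrier G). \<forall>h\<in>H. \<psi> h = \<chi> h}"
      \<comment> \<open>The restriction to \<open>K\<close> is cut off by 0 so that it is a member
        of \<open>characters_on G K\<close>.\<close>
      let ?\<phi> = "\<lambda>k. if k \<in> K then \<psi> k else 0"
      have "?\<phi> \<in> ?E" using p Ksub K(2) subgroup.m_closed[OF K(1)]
        by (auto simp: characters_on_def subset_iff)
      moreover have "\<psi> \<in> ?F ?\<phi>" using p by simp
      ultimately show "\<psi> \<in> (\<Union>\<phi>\<in>?E. ?F \<phi>)" by blast
    next
      fix \<psi> assume "\<psi> \<in> (\<Union>\<phi>\<in>?E. ?F \<phi>)"
      then show "\<psi> \<in> {\<psi> \<in> characters_on G (carrier G). \<forall>h\<in>H. \<psi> h = \<chi> h}" using K(2) by auto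
    qed
    have disj: "?F \<phi> \<inter> ?F \<phi>' = {}" if "\<phi> \<in> ?E" "\<phi>' \<in> ?E" "\<phi> \<noteq> \<phi>'" for \<phi> \<phi>'
    proof (rule ccontr)
      assume "?F \<phi> \<inter> ?F \<phi>' \<noteq> {}"
      then have "\<forall>k\<in>K. \<phi> k = \<phi>' k" by fastforce
      moreover have "\<forall>k. k \<notin> K \<longrightarrow> \<phi> k = \<phi>' k"
        using that characters_onD(3)[of \<phi> G K] characters_onD(3)[of \<phi>' G K] by simp
      ultimately show False using that(3) by (metis ext)
    qed
    have Kpos: "0 < card K" using finK K(3) by (auto simp: card_gt_0_iff)
    have "card (\<Union>\<phi>\<in>?E. ?F \<phi>) = (\<Sum>\<phi>\<in>?E. card (?F \<phi>))"
      using E(1) IH(1) disj by (intro card_UN_disjoint) blast+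
    then have "card (\<Union>\<phi>\<in>?E. ?F \<phi>) * card K = (\<Sum>\<phi>\<in>?E. card (?F \<phi>) * card K)"
      by (simp add: sum_distrib_right)
    also have "\<dots> = card ?E * card (carrier G)" using IH(2) by simp
    finally have "card (\<Union>\<phi>\<in>?E. ?F \<phi>) * card H * card K = card ?E * card H * card (carrier G)"
      by (simp add: mult_ac)
    then have "card (\<Union>\<phi>\<in>?E. ?F \<phi>) * card H = card (carrier G)" using E(2) Kpos by simp
    moreover have "finite (\<Union>\<phi>\<in>?E. ?F \<phi>)" using E(1) IH(1) by blast
    ultimately show ?thesis unfolding un by blast
  qed
qed

lemma (in comm_group) card_characters_trivial_on:
  assumes "finite (carrier G)" "subgroup H G"
  shows "finite {\<psi> \<in> characters_on G (carrier G). \<forall>h\<in>H. \<psi> h = 1}"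
    and "card {\<psi> \<in> characters_on G (carrier G). \<forall>h\<in>H. \<psi> h = 1} * card H = card (carrier G)"
proof -
  let ?\<chi> = "\<lambda>x. if x \<in> H then 1 else 0 :: complex"
  have "?\<chi> \<in> characters_on G H"
    using subgroup.m_closed[OF assms(2)] by (auto simp: characters_on_def)
  moreover have "{\<psi> \<in> characters_on G (carrier G). \<forall>h\<in>H. \<psi> h = ?\<chi> h}
    = {\<psi> \<in> characters_on G (carrier G). \<forall>h\<in>H. \<psi> h = 1}" by auto
  ultimately show "finite {\<psi> \<in> characters_on G (carrier G). \<forall>h\<in>H. \<psi> h = 1}"
    "card {\<psi> \<in> characters_on G (carrier G). \<forall>h\<in>H. \<psi> h = 1} * card H = card (carrier G)"
    using card_character_extensions[OF assms, of ?\<chi>] by auto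
qed

lemma (in comm_group) card_characters:
  assumes "finite (carrier G)"
  shows "finite (characters_on G (carrier G))" "card (characters_on G (carrier G)) = card (carrier G)"
proof -
  have "{\<psi> \<in> characters_on G (carrier G). \<forall>h\<in>{\<one>}. \<psi> h = 1} = characters_on G (carrier G)"
    using character_one[OF _ subgroup_self] by auto
  then show "finite (characters_on G (carrier G))" "card (characters_on G (carrier G)) = card (carrier G)"
    using card_characters_trivial_on[OF assms triv_subgroup] by simp_all
qed

text \<open>Otherwise the characters trivial on \<open>H\<close> would also be trivial on the larger
  group generated by \<open>H\<close> and \<open>x\<close>, and the two counts by index would
  contradict each other.\<close>

lemma (in comm_group) character_separates:
  assumes fin: "finite (carrier G)" and H: "subgroup H G" and x: "x \<in> carrier G" "x \<notin> H"
  obtains \<psi> where "\<psi> \<in> characters_on G (carrier G)" "\<forall>h\<in>H. \<psi> h = 1" "\<psi> x \<noteq> 1"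
proof (rule ccontr)
  assume nt: "\<not> thesis"
  have all: "\<psi> x = 1" if "\<psi> \<in> characters_on G (carrier G)" "\<forall>h\<in>H. \<psi> h = 1" for \<psi>
    using nt that(1,2) \<open>\<And>\<psi>. \<lbrakk>\<psi> \<in> characters_on G (carrier G); \<forall>h\<in>H. \<psi> h = 1; \<psi> x \<noteq> 1\<rbrakk> \<Longrightarrow> thesis\<close>
    by metis
  let ?K = "generate G (H \<union> {x})"
  have sub: "H \<union> {x} \<subseteq> carrier G" using subgroup.subset[OF H] x by blast
  have K: "subgroup ?K G" using generate_is_subgroup[OF sub] .
  have HK: "H \<union> {x} \<subseteq> ?K" by (auto intro: generate.incl)
  have finK: "finite ?K" using fin subgroup.subset[OF K] finite_subset by blast
  have "\<psi> k = 1" if p: "\<psi> \<in> characters_on G (carrier G)" "\<forall>h\<in>H. \<psi> h = 1" and "k \<in> ?K" for \<psi> k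
    using that(3)
  proof (induction rule: generate.induct)
    case one
    then show ?case using character_one[OF p(1) subgroup_self] .
  next
    case (incl h)
    then show ?case using p all[OF p] by auto
  next
    case (inv h)
    then have "\<psi> h = 1" "h \<in> carrier G" using p all[OF p] sub by auto
    then show ?case using character_inv[OF p(1) subgroup_self] by simp
  next
    case (eng a b)
    then show ?case using characters_onD(1)[OF p(1)] generate_in_carrier[OF sub] by simp
  qed
  then have "{\<psi> \<in> characters_on G (carrier G). \<forall>h\<in>?K. \<psi> h = 1}
    = {\<psi> \<in> characters_on G (carrier G). \<forall>h\<in>H. \<psi> h = 1}" using HK by blast
  then have "card {\<psi> \<in> characters_on G (carrier G). \<forall>h\<in>H. \<psi> h = 1} * card ?K
     = card {\<psi> \<in> characters_on G (carrier G). \<forall>h\<in>H. \<psi> h = 1} * card H"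
    using card_characters_trivial_on(2)[OF fin K] card_characters_trivial_on(2)[OF fin H] by simp
  moreover have "card {\<psi> \<in> characters_on G (carrier G). \<forall>h\<in>H. \<psi> h = 1} \<noteq> 0"
    using card_characters_trivial_on(2)[OF fin H] fin by (metis card_eq_0_iff mult_is_0 carrier_not_empty)
  moreover have "card H < card ?K" using HK x(2) finK by (intro psubset_card_mono) auto
  ultimately show False by simp
qed

text \<open>Orthogonality: multiplication by a character \<open>\<phi>\<close> with
  \<open>\<phi> x \<noteq> 1\<close> permutes the characters and scales the sum by
  \<open>\<phi> x\<close>.\<close>

lemma (in comm_group) sum_characters:
  assumes fin: "finite (carrier G)" and x: "x \<in> carrier G"
  shows "(\<Sum>\<psi>\<in>characters_on G (carrier G). \<psi> x)
    = (if x = \<one> then of_nat (card (carrier G)) else 0)"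
proof (cases "x = \<one>")
  case True
  then have "(\<Sum>\<psi>\<in>characters_on G (carrier G). \<psi> x) = (\<Sum>\<psi>\<in>characters_on G (carrier G). 1)"
    using character_one[OF _ subgroup_self] by (intro sum.cong) auto
  then show ?thesis using True card_characters(2)[OF fin] by simp
next
  case False
  obtain \<phi> where p: "\<phi> \<in> characters_on G (carrier G)" "\<phi> x \<noteq> 1"
    using character_separates[OF fin triv_subgroup x] False by auto
  let ?X = "characters_on G (carrier G)"
  have cl: "(\<lambda>y. \<alpha> y * \<beta> y) \<in> ?X" if "\<alpha> \<in> ?X" "\<beta> \<in> ?X" for \<alpha> \<beta>
    using that by (auto simp: characters_on_def)
  have "inj_on (\<lambda>\<psi> y. \<phi> y * \<psi> y) ?X"
  proof (rule inj_onI)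
    fix a b assume ab: "a \<in> ?X" "b \<in> ?X" "(\<lambda>y. \<phi> y * a y) = (\<lambda>y. \<phi> y * b y)"
    show "a = b"
    proof
      fix y show "a y = b y"
        using fun_cong[OF ab(3), of y] characters_onD(2)[OF p(1), of y]
          characters_onD(3)[OF ab(1), of y] characters_onD(3)[OF ab(2), of y]
        by (cases "y \<in> carrier G") auto
    qed
  qed
  moreover have "(\<lambda>\<psi> y. \<phi> y * \<psi> y) ` ?X \<subseteq> ?X" using cl[OF p(1)] by blast
  ultimately have "bij_betw (\<lambda>\<psi> y. \<phi> y * \<psi> y) ?X ?X"
    using card_characters(1)[OF fin] by (simp add: bij_betw_def endo_inj_surj)
  then have "(\<Sum>\<psi>\<in>?X. \<phi> x * \<psi> x) = (\<Sum>\<psi>\<in>?X. \<psi> x)"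
    using sum.reindex_bij_betw[of "\<lambda>\<psi> y. \<phi> y * \<psi> y" ?X ?X "\<lambda>\<psi>. \<psi> x"] by simp
  then have "\<phi> x * (\<Sum>\<psi>\<in>?X. \<psi> x) = (\<Sum>\<psi>\<in>?X. \<psi> x)" by (simp only: sum_distrib_left)
  then have "(\<phi> x - 1) * (\<Sum>\<psi>\<in>?X. \<psi> x) = 0" by (simp add: algebra_simps)
  then show ?thesis using p(2) False by simp
qed

section \<open>Group algebras of finite groups\<close>

lemma sum_fun_apply: "(\<Sum>i\<in>I. F i) x = (\<Sum>i\<in>I. F i x)"
  by (induction I rule: infinite_finite_induct) auto

text \<open>The trace of a projection is its rank: a basis \<open>B\<close> of the column space and
  the coordinates of the columns factor the matrix, and the two factors are dual to each other. Rank
  0 forces the zero matrix.\<close>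

lemma idempotent_matrix_trace:
  fixes p :: "'a \<Rightarrow> 'a \<Rightarrow> complex"
  assumes fin: "finite C"
    and idem: "\<And>i j. i \<in> C \<Longrightarrow> j \<in> C \<Longrightarrow> (\<Sum>k\<in>C. p i k * p k j) = p i j"
  obtains m :: nat where "(\<Sum>i\<in>C. p i i) = of_nat m"
    "m = 0 \<longrightarrow> (\<forall>i\<in>C. \<forall>j\<in>C. p i j = 0)"
proof -
  define scale where "scale = (\<lambda>(c::complex) (f::'a \<Rightarrow> complex) x. c * f x)"
  interpret V: vector_space scale
    by unfold_locales (auto simp: scale_def fun_eq_iff algebra_simps)
  define col where "col j = (\<lambda>i. if i \<in> C then p i j else 0)" for j
  obtain B where B: "B \<subseteq> col ` C" "V.independent B" "col ` C \<subseteq> V.span B"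
    by (rule V.maximal_independent_subset)
  have finB: "finite B" using B(1) fin by (meson finite_imageI finite_subset)
  define \<phi> where "\<phi> j = V.representation B (col j)" for j
  have colj: "col j = (\<Sum>b\<in>B. scale (\<phi> j b) b)" if "j \<in> C" for j
    using V.sum_representation_eq[OF B(2) _ finB subset_refl, of "col j"] that B(3) by (auto simp: \<phi>_def)
  \<comment> \<open>Idempotence says that every column is fixed by the matrix, so \<open>b\<close>
    is the combination of the columns with its own entries as coefficients.\<close>
  have b_eq: "b = (\<Sum>j\<in>C. scale (b j) (col j))" if b: "b \<in> B" for b
  proof -
    obtain j0 where j0: "j0 \<in> C" "b = col j0" using b B(1) by blast
    show ?thesis
    proof
      fix i
      show "b i = (\<Sum>j\<in>C. scale (b j) (col j)) i"
        using j0 idem[of i j0] by (auto simp: sum_fun_apply scale_def col_def mult.commute)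
    qed
  qed
  \<comment> \<open>Comparing coefficients in the independent set \<open>B\<close> shows that each
    basis vector contributes 1 to the trace.\<close>
  have dual: "(\<Sum>j\<in>C. b j * \<phi> j b) = 1" if b: "b \<in> B" for b
  proof -
    have "b = (\<Sum>j\<in>C. scale (b j) (\<Sum>b'\<in>B. scale (\<phi> j b') b'))"
      using b_eq[OF b] colj by simp
    also have "\<dots> = (\<Sum>b'\<in>B. scale (\<Sum>j\<in>C. b j * \<phi> j b') b')"
      by (rule ext) (simp add: sum_fun_apply scale_def sum_distrib_left sum_distrib_right mult.assoc
          sum.swap[of _ B C])
    finally have "(\<Sum>b'\<in>B. scale ((\<Sum>j\<in>C. b j * \<phi> j b') - (if b' = b then 1 else 0)) b') = 0"
    proof -
      assume e: "b = (\<Sum>b'\<in>B. scale (\<Sum>j\<in>C. b j * \<phi> j b') b')"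
      have "(\<Sum>b'\<in>B. scale (if b' = b then 1 else 0) b') = (\<Sum>b'\<in>B. if b' = b then b else 0)"
        by (intro sum.cong) (auto simp: scale_def fun_eq_iff)
      then have "(\<Sum>b'\<in>B. scale (if b' = b then 1 else 0) b') = b" using b finB by simp
      then show ?thesis using e by (simp add: V.scale_left_diff_distrib sum_subtractf)
    qed
    then have "(\<lambda>b'. (\<Sum>j\<in>C. b j * \<phi> j b') - (if b' = b then 1 else 0)) b = 0"
      by (rule V.independentD[OF B(2) finB subset_refl _ b])
    then show ?thesis by simp
  qed
  have "(\<Sum>i\<in>C. p i i) = (\<Sum>i\<in>C. col i i)" by (simp add: col_def)
  also have "\<dots> = (\<Sum>i\<in>C. \<Sum>b\<in>B. \<phi> i b * b i)"
  proof (intro sum.cong refl)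
    fix i assume "i \<in> C"
    then show "col i i = (\<Sum>b\<in>B. \<phi> i b * b i)"
      by (subst colj) (simp_all add: sum_fun_apply scale_def)
  qed
  also have "\<dots> = (\<Sum>b\<in>B. \<Sum>i\<in>C. b i * \<phi> i b)"
    by (subst sum.swap) (simp add: mult.commute)
  also have "\<dots> = of_nat (card B)" using dual by simp
  finally have tr: "(\<Sum>i\<in>C. p i i) = of_nat (card B)" .
  show thesis
  proof (rule that[OF tr], intro impI ballI)
    fix i j assume "card B = 0" "i \<in> C" "j \<in> C"
    then have "B = {}" using finB by simp
    then have "col j i = 0" using colj[OF \<open>j \<in> C\<close>] by simp
    then show "p i j = 0" using \<open>i \<in> C\<close> by (simp add: col_def)
  qed
qed

section \<open>Minimal idempotents of the group algebra\<close>

text \<open>By Schur's lemma, in a semisimple complex algebra the condition that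
  \<open>f A f\<close> consists of the multiples of \<open>f\<close> singles out the idempotents
  whose left ideal \<open>A f\<close> is irreducible.\<close>

definition minimal_idempotent :: "(complex, 'a) module \<Rightarrow> 'a \<Rightarrow> bool" where
  "minimal_idempotent A f \<longleftrightarrow> f \<in> carrier A \<and> f \<otimes>\<^bsub>A\<^esub> f = f \<and> f \<noteq> \<zero>\<^bsub>A\<^esub> \<and>
     (\<forall>a\<in>carrier A. \<exists>c. f \<otimes>\<^bsub>A\<^esub> a \<otimes>\<^bsub>A\<^esub> f = c \<odot>\<^bsub>A\<^esub> f)"

text \<open>For minimal idempotents, \<open>linked A f f'\<close> says that \<open>A f\<close> and \<open>A f'\<close> are isomorphic.\<close>

definition linked :: "(complex, 'a) module \<Rightarrow> 'a \<Rightarrow> 'a \<Rightarrow> bool" where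
  "linked A f f' \<longleftrightarrow> (\<exists>a\<in>carrier A. f \<otimes>\<^bsub>A\<^esub> a \<otimes>\<^bsub>A\<^esub> f' \<noteq> \<zero>\<^bsub>A\<^esub>)"

definition delta :: "'g \<Rightarrow> 'g \<Rightarrow> complex" where
  "delta g = (\<lambda>x. if x = g then 1 else 0)"

lemma (in group) inv_mult_cancel:
  assumes "x \<in> carrier G" "y \<in> carrier G"
  shows "inv x \<otimes> (x \<otimes> y) = y" "x \<otimes> (inv x \<otimes> y) = y"
  using assms by (simp_all add: m_assoc[symmetric])

locale finite_group = group G for G (structure) +
  assumes fin: "finite (carrier G)"
begin

text \<open>The product of \<open>group_algebra\<close> as a single sum over the finite carrier. It
  reads its arguments only on the carrier and is always supported there, so laws such as
  associativity hold for arbitrary functions.\<close>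

definition conv :: "('a \<Rightarrow> complex) \<Rightarrow> ('a \<Rightarrow> complex) \<Rightarrow> 'a \<Rightarrow> complex" (infixl "\<star>" 70) where
  "f \<star> h = (\<lambda>x. if x \<in> carrier G then \<Sum>y\<in>carrier G. f y * h (inv y \<otimes> x) else 0)"

definition alg :: "('a \<Rightarrow> complex) set" where
  "alg = {f. \<forall>x. x \<notin> carrier G \<longrightarrow> f x = 0}"

lemma group_algebra_carrier: "carrier (group_algebra G) = alg"
proof -
  have "finite {x. f x \<noteq> 0} \<and> {x. f x \<noteq> 0} \<subseteq> carrier G \<longleftrightarrow> (\<forall>x. x \<notin> carrier G \<longrightarrow> f x = 0)"
    for f :: "'a \<Rightarrow> complex"
    using fin finite_subset[of "{x. f x \<noteq> 0}" "carrier G"] by auto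
  then show ?thesis by (simp add: group_algebra_def alg_def)
qed

lemma group_algebra_mult:
  assumes f: "f \<in> alg" and h: "h \<in> alg"
  shows "f \<otimes>\<^bsub>group_algebra G\<^esub> h = f \<star> h"
proof
  fix x
  let ?S = "{(y, z). f y \<noteq> 0 \<and> h z \<noteq> 0 \<and> y \<otimes> z = x}"
  have supp: "y \<in> carrier G" "z \<in> carrier G" if "(y, z) \<in> ?S" for y z
    using that f h by (auto simp: alg_def)
  have "(f \<otimes>\<^bsub>group_algebra G\<^esub> h) x = (\<Sum>(y, z) \<in> ?S. f y * h z)"
    by (simp only: group_algebra_def monoid.simps ring.simps)
  also have "\<dots> = (f \<star> h) x"
  proof (cases "x \<in> carrier G")
    case False
    have "?S = {}"
    proof (rule equals0I)
      fix a assume a: "a \<in> ?S"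
      obtain y z where "a = (y, z)" by (cases a)
      then have "y \<in> carrier G" "z \<in> carrier G" "x = y \<otimes> z" using supp[of y z] a by auto
      then show False using False by simp
    qed
    then have "(\<Sum>(y, z) \<in> ?S. f y * h z) = 0" by (simp only: sum.empty)
    then show ?thesis using False by (simp add: conv_def)
  next
    case True
    let ?Y = "{y \<in> carrier G. f y * h (inv y \<otimes> x) \<noteq> 0}"
    have "(\<Sum>(y, z) \<in> ?S. f y * h z) = (\<Sum>y\<in>?Y. f y * h (inv y \<otimes> x))"
    proof (rule sum.reindex_bij_witness[of _ "\<lambda>y. (y, inv y \<otimes> x)" fst])
      fix a assume a: "a \<in> ?S"
      obtain y z where yz: "a = (y, z)" by (cases a)
      have c: "y \<in> carrier G" "z \<in> carrier G" using supp a yz by blast+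
      then have z: "inv y \<otimes> x = z" using a yz by (auto simp: m_assoc[symmetric])
      show "(fst a, inv (fst a) \<otimes> x) = a" using yz z by simp
      show "fst a \<in> ?Y" using yz z c a by auto
      show "f (fst a) * h (inv (fst a) \<otimes> x) = (case a of (y, z) \<Rightarrow> f y * h z)"
        using yz z by simp
    next
      fix y assume "y \<in> ?Y"
      then show "(y, inv y \<otimes> x) \<in> ?S" "fst (y, inv y \<otimes> x) = y"
        using True by (auto simp: m_assoc[symmetric])
    qed
    also have "\<dots> = (\<Sum>y\<in>carrier G. f y * h (inv y \<otimes> x))"
      using fin by (intro sum.mono_neutral_left) auto
    finally show ?thesis using True by (simp add: conv_def)
  qed
  finally show "(f \<otimes>\<^bsub>group_algebra G\<^esub> h) x = (f \<star> h) x" .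
qed

lemma group_algebra_zero: "\<zero>\<^bsub>group_algebra G\<^esub> = (\<lambda>x. 0)"
  and group_algebra_smult: "c \<odot>\<^bsub>group_algebra G\<^esub> f = (\<lambda>x. c * f x)"
  and group_algebra_add: "f \<oplus>\<^bsub>group_algebra G\<^esub> h = (\<lambda>x. f x + h x)"
  by (simp_all add: group_algebra_def)

lemma conv_closed [simp]: "f \<star> h \<in> alg"
  by (simp add: conv_def alg_def)

lemma delta_closed: "g \<in> carrier G \<Longrightarrow> delta g \<in> alg"
  by (auto simp: alg_def delta_def)

lemma minimal_idempotent_iff:
  "minimal_idempotent (group_algebra G) f \<longleftrightarrow> f \<in> alg \<and> f \<star> f = f \<and> f \<noteq> (\<lambda>x. 0) \<and>
     (\<forall>a\<in>alg. \<exists>c. f \<star> a \<star> f = (\<lambda>x. c * f x))"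
  by (auto simp: minimal_idempotent_def group_algebra_carrier group_algebra_mult group_algebra_zero
      group_algebra_smult)

lemma linked_iff:
  assumes "f \<in> alg" "f' \<in> alg"
  shows "linked (group_algebra G) f f' \<longleftrightarrow> (\<exists>a\<in>alg. f \<star> a \<star> f' \<noteq> (\<lambda>x. 0))"
  using assms by (auto simp: linked_def group_algebra_carrier group_algebra_mult group_algebra_zero)

lemma conv_sum_left: "(\<lambda>x. \<Sum>i\<in>I. c i * F i x) \<star> h = (\<lambda>x. \<Sum>i\<in>I. c i * (F i \<star> h) x)"
proof
  fix x
  have "(\<Sum>y\<in>carrier G. (\<Sum>i\<in>I. c i * F i y) * h (inv y \<otimes> x))
    = (\<Sum>y\<in>carrier G. \<Sum>i\<in>I. c i * (F i y * h (inv y \<otimes> x)))"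
    by (simp add: sum_distrib_right mult.assoc)
  also have "\<dots> = (\<Sum>i\<in>I. \<Sum>y\<in>carrier G. c i * (F i y * h (inv y \<otimes> x)))" by (rule sum.swap)
  finally show "((\<lambda>x. \<Sum>i\<in>I. c i * F i x) \<star> h) x = (\<Sum>i\<in>I. c i * (F i \<star> h) x)"
    by (simp add: conv_def sum_distrib_left)
qed

lemma conv_sum_right: "h \<star> (\<lambda>x. \<Sum>i\<in>I. c i * F i x) = (\<lambda>x. \<Sum>i\<in>I. c i * (h \<star> F i) x)"
proof
  fix x
  have "(\<Sum>y\<in>carrier G. h y * (\<Sum>i\<in>I. c i * F i (inv y \<otimes> x)))
    = (\<Sum>y\<in>carrier G. \<Sum>i\<in>I. c i * (h y * F i (inv y \<otimes> x)))"
    by (simp add: sum_distrib_left mult_ac)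
  also have "\<dots> = (\<Sum>i\<in>I. \<Sum>y\<in>carrier G. c i * (h y * F i (inv y \<otimes> x)))" by (rule sum.swap)
  finally show "(h \<star> (\<lambda>x. \<Sum>i\<in>I. c i * F i x)) x = (\<Sum>i\<in>I. c i * (h \<star> F i) x)"
    by (simp add: conv_def sum_distrib_left)
qed

lemma conv_scale_left: "(\<lambda>x. c * f x) \<star> h = (\<lambda>x. c * (f \<star> h) x)"
  and conv_scale_right: "f \<star> (\<lambda>x. c * h x) = (\<lambda>x. c * (f \<star> h) x)"
  by (auto simp: conv_def sum_distrib_left mult_ac)

lemma conv_diff_left: "(\<lambda>x. f x - f' x) \<star> h = (\<lambda>x. (f \<star> h) x - (f' \<star> h) x)"
  and conv_diff_right: "h \<star> (\<lambda>x. f x - f' x) = (\<lambda>x. (h \<star> f) x - (h \<star> f') x)"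
  by (auto simp: conv_def sum_subtractf algebra_simps)

lemma conv_zero_left [simp]: "(\<lambda>x. 0) \<star> h = (\<lambda>x. 0)"
  and conv_zero_right [simp]: "h \<star> (\<lambda>x. 0) = (\<lambda>x. 0)"
  by (auto simp: conv_def)

lemma delta_conv:
  assumes "g \<in> carrier G"
  shows "delta g \<star> h = (\<lambda>x. if x \<in> carrier G then h (inv g \<otimes> x) else 0)"
proof -
  have "(\<Sum>y\<in>carrier G. delta g y * h (inv y \<otimes> x)) = h (inv g \<otimes> x)" for x
  proof -
    have "(\<Sum>y\<in>carrier G. delta g y * h (inv y \<otimes> x))
      = (\<Sum>y\<in>carrier G. if y = g then h (inv g \<otimes> x) else 0)"
      by (intro sum.cong) (auto simp: delta_def)
    then show ?thesis using assms fin by simp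
  qed
  then show ?thesis by (auto simp: conv_def)
qed

lemma conv_delta:
  assumes "g \<in> carrier G"
  shows "h \<star> delta g = (\<lambda>x. if x \<in> carrier G then h (x \<otimes> inv g) else 0)"
proof -
  have "(\<Sum>y\<in>carrier G. h y * delta g (inv y \<otimes> x)) = h (x \<otimes> inv g)" if x: "x \<in> carrier G" for x
  proof -
    have "inv y \<otimes> x = g \<longleftrightarrow> y = x \<otimes> inv g" if "y \<in> carrier G" for y
      using that x assms by (metis inv_closed inv_inv inv_mult_group inv_solve_left m_closed)
    then have "(\<Sum>y\<in>carrier G. h y * delta g (inv y \<otimes> x))
      = (\<Sum>y\<in>carrier G. if y = x \<otimes> inv g then h (x \<otimes> inv g) else 0)"
      by (intro sum.cong) (auto simp: delta_def)
    then show ?thesis using assms fin x by simp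
  qed
  then show ?thesis by (auto simp: conv_def)
qed

lemma delta_conv_delta: "g \<in> carrier G \<Longrightarrow> h \<in> carrier G \<Longrightarrow> delta g \<star> delta h = delta (g \<otimes> h)"
proof
  fix x assume gh: "g \<in> carrier G" "h \<in> carrier G"
  have "x \<in> carrier G \<and> inv g \<otimes> x = h \<longleftrightarrow> x = g \<otimes> h"
    using gh by (auto simp: m_assoc[symmetric])
  then show "(delta g \<star> delta h) x = delta (g \<otimes> h) x"
    unfolding delta_conv[OF gh(1)] by (auto simp: delta_def)
qed

lemma delta_one_conv: "f \<in> alg \<Longrightarrow> delta \<one> \<star> f = f"
  and conv_delta_one: "f \<in> alg \<Longrightarrow> f \<star> delta \<one> = f"
  by (auto simp: delta_conv conv_delta alg_def fun_eq_iff)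

lemma alg_expand: "f \<in> alg \<Longrightarrow> f = (\<lambda>x. \<Sum>g\<in>carrier G. f g * delta g x)"
proof
  fix x assume f: "f \<in> alg"
  have "(\<Sum>g\<in>carrier G. f g * delta g x) = (\<Sum>g\<in>carrier G. if g = x then f x else 0)"
    by (intro sum.cong) (auto simp: delta_def)
  then show "f x = (\<Sum>g\<in>carrier G. f g * delta g x)" using f fin by (auto simp: alg_def)
qed

lemma delta_conv_assoc:
  "g \<in> carrier G \<Longrightarrow> delta g \<star> (f \<star> h) = (delta g \<star> f) \<star> h"
proof
  fix x assume g: "g \<in> carrier G"
  show "(delta g \<star> (f \<star> h)) x = ((delta g \<star> f) \<star> h) x"
  proof (cases "x \<in> carrier G")
    case True
    have "((delta g \<star> f) \<star> h) x = (\<Sum>y\<in>carrier G. f (inv g \<otimes> y) * h (inv y \<otimes> x))"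
      unfolding delta_conv[OF g] using True by (simp add: conv_def cong: sum.cong)
    also have "\<dots> = (\<Sum>y\<in>carrier G. f y * h (inv y \<otimes> (inv g \<otimes> x)))"
      by (rule sum.reindex_bij_witness[of _ "\<lambda>y. g \<otimes> y" "\<lambda>y. inv g \<otimes> y"])
        (use True g in \<open>auto simp: m_assoc inv_mult_cancel inv_mult_group\<close>)
    also have "\<dots> = (delta g \<star> (f \<star> h)) x"
      unfolding delta_conv[OF g] using True g by (simp add: conv_def)
    finally show ?thesis by simp
  qed (use g in \<open>simp add: conv_def\<close>)
qed

lemma conv_assoc: "(f \<star> k) \<star> h = f \<star> (k \<star> h)"
proof -
  \<comment> \<open>Truncation of \<open>f\<close> to the carrier does not change products with
    \<open>f\<close> on the left, and it makes \<open>f\<close> a combination of the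
    \<open>delta g\<close>, for which associativity is known.\<close>
  define f' where "f' = (\<lambda>x. if x \<in> carrier G then f x else 0)"
  have eq: "f \<star> k = f' \<star> k" for k
    unfolding conv_def f'_def by (intro ext if_cong sum.cong refl) simp
  have "f' \<in> alg" by (simp add: f'_def alg_def)
  then obtain c where f: "f' = (\<lambda>x. \<Sum>g\<in>carrier G. c g * delta g x)" using alg_expand by blast
  show ?thesis
    unfolding eq f conv_sum_left by (intro ext sum.cong refl) (simp add: delta_conv_assoc)
qed

text \<open>Substituting inverses in the sum; evaluation at \<open>\<one>\<close> is thus a trace
  function.\<close>

lemma conv_one_eq: "(f \<star> h) \<one> = (h \<star> f) \<one>"
proof -
  have "(\<Sum>y\<in>carrier G. f y * h (inv y \<otimes> \<one>)) = (\<Sum>y\<in>carrier G. h y * f (inv y \<otimes> \<one>))"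
    by (rule sum.reindex_bij_witness[of _ "\<lambda>y. inv y" "\<lambda>y. inv y"]) auto
  then show ?thesis by (simp add: conv_def)
qed

text \<open>The adjoint with respect to the standard Hermitian form, which is
  \<open>(f \<star> star h) \<one>\<close>.\<close>

definition star :: "('a \<Rightarrow> complex) \<Rightarrow> 'a \<Rightarrow> complex" where
  "star f = (\<lambda>x. if x \<in> carrier G then cnj (f (inv x)) else 0)"

lemma star_closed [simp]: "star f \<in> alg"
  by (simp add: star_def alg_def)

lemma star_star: "f \<in> alg \<Longrightarrow> star (star f) = f"
  by (auto simp: star_def alg_def fun_eq_iff)

lemma star_conv: "star (f \<star> h) = star h \<star> star f"
proof
  fix x
  show "star (f \<star> h) x = (star h \<star> star f) x"
  proof (cases "x \<in> carrier G")
    case True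
    have "(\<Sum>y\<in>carrier G. cnj (f y) * cnj (h (inv y \<otimes> inv x)))
      = (\<Sum>y\<in>carrier G. cnj (h (inv y)) * cnj (f (inv (inv y \<otimes> x))))"
      by (rule sum.reindex_bij_witness[of _ "\<lambda>y. inv (inv y \<otimes> x)" "\<lambda>y. x \<otimes> y"])
        (use True in \<open>auto simp: m_assoc inv_mult_cancel inv_mult_group\<close>)
    then show ?thesis using True by (simp add: star_def conv_def cong: sum.cong)
  qed (simp add: star_def conv_def)
qed

text \<open>The value at \<open>\<one>\<close> is the sum of the squared moduli of the values of
  \<open>y\<close>.\<close>

lemma conv_star_nonzero:
  assumes "y \<in> alg" "y \<noteq> (\<lambda>x. 0)"
  shows "y \<star> star y \<noteq> (\<lambda>x. 0)"
proof
  assume 0: "y \<star> star y = (\<lambda>x. 0)"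
  have "(y \<star> star y) \<one> = (\<Sum>g\<in>carrier G. y g * cnj (y g))"
    by (simp add: conv_def star_def cong: sum.cong)
  also have "\<dots> = of_real (\<Sum>g\<in>carrier G. (cmod (y g))\<^sup>2)"
    by (simp add: complex_norm_square[symmetric] del: of_real_power)
  finally have "(\<Sum>g\<in>carrier G. (cmod (y g))\<^sup>2) = 0" using 0 by (metis of_real_eq_0_iff)
  then have "y g = 0" if "g \<in> carrier G" for g
    using that fin by (simp add: sum_nonneg_eq_0_iff)
  then have "y = (\<lambda>x. 0)" using assms(1) by (auto simp: alg_def fun_eq_iff)
  then show False using assms(2) by simp
qed

text \<open>Positivity of the involution: it makes \<^const>\<open>linked\<close> symmetric and transitive without semisimplicity.\<close>

lemma conv_star_conv_nonzero:
  assumes "y \<in> alg" "y \<noteq> (\<lambda>x. 0)"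
  shows "y \<star> star y \<star> y \<noteq> (\<lambda>x. 0)"
proof
  assume 0: "y \<star> star y \<star> y = (\<lambda>x. 0)"
  let ?z = "y \<star> star y"
  have "star ?z = ?z" by (simp add: star_conv star_star assms)
  then have "?z \<star> ?z \<noteq> (\<lambda>x. 0)"
    using conv_star_nonzero[OF _ conv_star_nonzero[OF assms]] by simp
  moreover have "?z \<star> ?z = (?z \<star> y) \<star> star y" by (simp add: conv_assoc)
  ultimately show False using 0 by simp
qed


text \<open>For \<open>y = f' \<star> a \<star> f\<close> the choice \<open>b = star y\<close>
  works: the product lies in \<open>f A f\<close>, hence is \<open>c f\<close>, and multiplying by
  \<open>y\<close> from the left gives \<open>y \<star> star y \<star> y\<close>, which is nonzero
  and forces \<open>c \<noteq> 0\<close>.\<close>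

lemma minimal_idempotent_scalar:
  assumes f: "minimal_idempotent (group_algebra G) f" and f': "f' \<in> alg" "f' \<star> f' = f'"
    and a: "a \<in> alg" "f' \<star> a \<star> f \<noteq> (\<lambda>x. 0)"
  obtains b c where "b \<in> alg" "c \<noteq> 0"
    "(f \<star> b \<star> f') \<star> (f' \<star> a \<star> f) = (\<lambda>x. c * f x)"
proof -
  note F = f[unfolded minimal_idempotent_iff]
  let ?y = "f' \<star> a \<star> f"
  let ?b = "star ?y"
  have fa: "f \<in> alg" "f \<star> f = f" using F by auto
  have yf: "?y \<star> f = ?y" by (simp add: conv_assoc fa f' a)
  have fy: "f' \<star> ?y = ?y" by (simp add: conv_assoc[symmetric] fa f' a)
  have eq: "(f \<star> ?b \<star> f') \<star> ?y = f \<star> (?b \<star> f' \<star> a) \<star> f"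
    using f' fa a fy by (simp add: conv_assoc)
  obtain c where c: "f \<star> (?b \<star> f' \<star> a) \<star> f = (\<lambda>x. c * f x)" using F by (meson conv_closed)
  have "?y \<star> ((f \<star> ?b \<star> f') \<star> ?y) = (?y \<star> f) \<star> ?b \<star> (f' \<star> ?y)"
    by (simp only: conv_assoc)
  also have "\<dots> = ?y \<star> ?b \<star> ?y" unfolding yf fy ..
  finally have "?y \<star> (\<lambda>x. c * f x) \<noteq> (\<lambda>x. 0)"
    using conv_star_conv_nonzero[OF _ a(2)] unfolding eq c by simp
  then have "c \<noteq> 0" by auto
  then show thesis using that[of ?b c] eq c by simp
qed

lemma linked_sym:
  assumes "minimal_idempotent (group_algebra G) f" "f' \<in> alg" "f' \<star> f' = f'"
    "linked (group_algebra G) f' f"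
  shows "linked (group_algebra G) f f'"
proof -
  have fa: "f \<in> alg" "f \<noteq> (\<lambda>x. 0)" using assms(1) by (auto simp: minimal_idempotent_iff)
  obtain a where a: "a \<in> alg" "f' \<star> a \<star> f \<noteq> (\<lambda>x. 0)"
    using assms(4) by (auto simp: linked_iff fa assms(2))
  obtain b c where b: "b \<in> alg" "c \<noteq> 0" "(f \<star> b \<star> f') \<star> (f' \<star> a \<star> f) = (\<lambda>x. c * f x)"
    by (rule minimal_idempotent_scalar[OF assms(1-3) a])
  have "f \<star> b \<star> f' \<noteq> (\<lambda>x. 0)"
  proof
    assume "f \<star> b \<star> f' = (\<lambda>x. 0)"
    then have "(\<lambda>x. c * f x) = (\<lambda>x. 0)" using b(3) by simp
    then show False using b(2) fa(2) by (auto simp: fun_eq_iff)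
  qed
  then show ?thesis using b(1) by (auto simp: linked_iff fa assms(2))
qed

text \<open>The element \<open>f \<star> a \<star> f'\<close> has a left inverse up to a nonzero
  scalar, so its product with a nonzero \<open>f' \<star> a' \<star> f''\<close> cannot
  vanish.\<close>

lemma linked_trans:
  assumes f': "minimal_idempotent (group_algebra G) f'" and f: "f \<in> alg" "f \<star> f = f"
    and f'': "f'' \<in> alg"
    and l: "linked (group_algebra G) f f'" "linked (group_algebra G) f' f''"
  shows "linked (group_algebra G) f f''"
proof -
  have fa: "f' \<in> alg" "f' \<star> f' = f'" using f' by (auto simp: minimal_idempotent_iff)
  obtain a where a: "a \<in> alg" "f \<star> a \<star> f' \<noteq> (\<lambda>x. 0)"
    using l(1) by (auto simp: linked_iff fa f)
  obtain a' where a': "a' \<in> alg" "f' \<star> a' \<star> f'' \<noteq> (\<lambda>x. 0)"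
    using l(2) by (auto simp: linked_iff fa f'')
  obtain b c where b: "b \<in> alg" "c \<noteq> 0" "(f' \<star> b \<star> f) \<star> (f \<star> a \<star> f') = (\<lambda>x. c * f' x)"
    by (rule minimal_idempotent_scalar[OF f' f a])
  have "f \<star> (a \<star> f' \<star> a') \<star> f'' \<noteq> (\<lambda>x. 0)"
  proof
    assume 0: "f \<star> (a \<star> f' \<star> a') \<star> f'' = (\<lambda>x. 0)"
    have "(f \<star> a \<star> f') \<star> (f' \<star> a' \<star> f'') = f \<star> (a \<star> (f' \<star> f') \<star> a') \<star> f''"
      by (simp only: conv_assoc)
    also have "\<dots> = f \<star> (a \<star> f' \<star> a') \<star> f''" by (simp only: fa)
    finally have "(f \<star> a \<star> f') \<star> (f' \<star> a' \<star> f'') = f \<star> (a \<star> f' \<star> a') \<star> f''" .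
    then have "(f' \<star> b \<star> f) \<star> ((f \<star> a \<star> f') \<star> (f' \<star> a' \<star> f'')) = (\<lambda>x. 0)"
      using 0 fa by simp
    then have "(\<lambda>x. c * f' x) \<star> (f' \<star> a' \<star> f'') = (\<lambda>x. 0)"
      using b(3) by (simp add: conv_assoc[symmetric])
    moreover have "f' \<star> (f' \<star> a' \<star> f'') = f' \<star> a' \<star> f''"
      using fa by (simp add: conv_assoc[symmetric])
    ultimately have "(\<lambda>x. c * (f' \<star> a' \<star> f'') x) = (\<lambda>x. 0)" by (simp add: conv_scale_left)
    then show False using b(2) a'(2) by (auto simp: fun_eq_iff)
  qed
  then show ?thesis by (auto simp: linked_iff f f'')
qed

text \<open>The sum is the trace of the idempotent operator
  \<open>a \<mapsto> e \<star> a \<star> f\<close> in the basis of the \<open>delta g\<close>, so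
  \<open>m\<close> is the dimension of \<open>e A f\<close>.\<close>

lemma conv_delta_conv_trace:
  assumes e: "e \<in> alg" "e \<star> e = e" and f: "f \<in> alg" "f \<star> f = f"
  obtains m :: nat where "(\<Sum>g\<in>carrier G. (e \<star> delta g \<star> f) g) = of_nat m"
    "m = 0 \<longrightarrow> (\<forall>g\<in>carrier G. e \<star> delta g \<star> f = (\<lambda>x. 0))"
proof -
  let ?p = "\<lambda>i j. (e \<star> delta j \<star> f) i"
  have idem: "(\<Sum>k\<in>carrier G. ?p i k * ?p k j) = ?p i j" for i j
  proof -
    let ?u = "e \<star> delta j \<star> f"
    have "(\<Sum>k\<in>carrier G. ?p i k * ?p k j) = (e \<star> (\<lambda>x. \<Sum>k\<in>carrier G. ?u k * delta k x) \<star> f) i"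
      unfolding conv_sum_left conv_sum_right by (intro sum.cong refl) (simp add: mult.commute)
    also have "(\<lambda>x. \<Sum>k\<in>carrier G. ?u k * delta k x) = ?u"
      using alg_expand[of ?u] by simp
    also have "e \<star> ?u \<star> f = e \<star> e \<star> delta j \<star> (f \<star> f)"
      by (simp only: conv_assoc)
    finally show ?thesis using e f by simp
  qed
  obtain m where m: "(\<Sum>i\<in>carrier G. ?p i i) = of_nat m"
    "m = 0 \<longrightarrow> (\<forall>i\<in>carrier G. \<forall>j\<in>carrier G. ?p i j = 0)"
    by (rule idempotent_matrix_trace[OF fin idem])
  show thesis
  proof (rule that[OF m(1)], intro impI ballI ext)
    fix g x assume "m = 0" "g \<in> carrier G"
    then show "(e \<star> delta g \<star> f) x = 0"
      using m(2) by (cases "x \<in> carrier G") (auto simp: conv_def[of _ f])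
  qed
qed

lemma delta_conv_delta_conv:
  assumes "c \<in> carrier G" "g \<in> carrier G" "x \<in> carrier G"
  shows "(delta c \<star> delta g \<star> f) x = f (inv g \<otimes> inv c \<otimes> x)"
  unfolding delta_conv_delta[OF assms(1,2)] delta_conv[OF m_closed[OF assms(1,2)]]
  using assms by (simp add: inv_mult_group)

lemma sum_conv_delta_conv:
  assumes "f \<in> alg" "c \<in> carrier G"
  shows "(\<Sum>g\<in>carrier G. (delta c \<star> delta g \<star> f) g) = (\<Sum>g\<in>carrier G. f (inv g \<otimes> inv c \<otimes> g))"
  using assms by (intro sum.cong)
    (simp_all add: delta_conv_delta_conv)

text \<open>Right multiplication by \<open>u\<close> is a projection of trace
  \<open>|G| u(1)\<close>, so trace 0 means rank 0.\<close>

lemma idempotent_eq_zero: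
  assumes u: "u \<in> alg" "u \<star> u = u" "u \<one> = 0"
  shows "u = (\<lambda>x. 0)"
proof -
  have d: "delta \<one> \<in> alg" "delta \<one> \<star> delta \<one> = delta \<one>"
    by (simp_all add: delta_closed delta_one_conv)
  obtain m :: nat where m: "(\<Sum>g\<in>carrier G. (delta \<one> \<star> delta g \<star> u) g) = of_nat m"
    "m = 0 \<longrightarrow> (\<forall>g\<in>carrier G. delta \<one> \<star> delta g \<star> u = (\<lambda>x. 0))"
    by (rule conv_delta_conv_trace[OF d u(1,2)])
  have "(\<Sum>g\<in>carrier G. (delta \<one> \<star> delta g \<star> u) g) = 0"
    by (subst sum_conv_delta_conv) (auto simp: u)
  then have "m = 0" using m(1) by simp
  then have "delta \<one> \<star> delta \<one> \<star> u = (\<lambda>x. 0)" using m(2) by simp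
  then show ?thesis using u(1) by (simp add: delta_one_conv d)
qed

text \<open>With \<open>A = \<complex>[G]\<close>, the number \<open>|G| f(1)\<close> is the dimension of the left ideal \<open>A f\<close>;
  a module surjection \<open>A e \<rightarrow> A f\<close> between modules of equal dimension is bijective.\<close>

lemma minimal_idempotent_of_linked:
  assumes f: "minimal_idempotent (group_algebra G) f" and e: "e \<in> alg" "e \<star> e = e"
    and l: "linked (group_algebra G) e f" and eq: "e \<one> = f \<one>"
  shows "minimal_idempotent (group_algebra G) e"
proof -
  note F = f[unfolded minimal_idempotent_iff]
  have fa: "f \<in> alg" "f \<star> f = f" using F by auto
  obtain a where a: "a \<in> alg" "e \<star> a \<star> f \<noteq> (\<lambda>x. 0)" using l by (auto simp: linked_iff fa e)
  obtain b c where b: "b \<in> alg" "c \<noteq> 0" "(f \<star> b \<star> e) \<star> (e \<star> a \<star> f) = (\<lambda>x. c * f x)"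
    by (rule minimal_idempotent_scalar[OF f e a])
  define y where "y = e \<star> a \<star> f"
  define y' where "y' = (\<lambda>x. inverse c * (f \<star> b \<star> e) x)"
  have yy: "y' \<star> y = f" using b(2,3) by (simp add: y_def y'_def conv_scale_left mult.assoc[symmetric])
  have ey: "e \<star> y = y" using e by (simp add: y_def conv_assoc[symmetric])
  have yf: "y \<star> f = y" using fa e a by (simp add: y_def conv_assoc)
  have ye: "y' \<star> e = y'" using e fa b by (simp add: y'_def conv_scale_left conv_assoc)
  have fy: "f \<star> y' = y'" using fa by (simp add: y'_def conv_scale_right conv_assoc[symmetric])
  \<comment> \<open>\<open>p\<close> is the part of \<open>e\<close> that corresponds to
    \<open>f\<close>. It is an idempotent below \<open>e\<close> with the same value at
    \<open>\<one>\<close>, so the complementary idempotent \<open>e - p\<close> vanishes.\<close>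
  define p where "p = y \<star> y'"
  have pa: "p \<in> alg" by (simp add: p_def)
  have pp: "p \<star> p = p"
  proof -
    have "p \<star> p = y \<star> (y' \<star> y) \<star> y'" by (simp add: p_def conv_assoc)
    then show ?thesis by (simp add: yy yf p_def)
  qed
  have ep: "e \<star> p = p" using ey by (simp add: p_def conv_assoc[symmetric] e)
  have pe: "p \<star> e = p" using ye by (simp add: p_def conv_assoc)
  have p1: "p \<one> = f \<one>" using conv_one_eq[of y y'] yy by (simp add: p_def)
  have "(\<lambda>x. e x - p x) = (\<lambda>x. 0)"
  proof (rule idempotent_eq_zero)
    show "(\<lambda>x. e x - p x) \<in> alg" using e(1) pa by (simp add: alg_def)
    show "(\<lambda>x. e x - p x) \<star> (\<lambda>x. e x - p x) = (\<lambda>x. e x - p x)"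
      by (simp add: conv_diff_left conv_diff_right e pp ep pe)
    show "e \<one> - p \<one> = 0" using p1 eq by simp
  qed
  then have ep': "e = p" by (simp add: fun_eq_iff)
  have "\<exists>c. e \<star> a \<star> e = (\<lambda>x. c * e x)" if "a \<in> alg" for a
  proof -
    have "e \<star> a \<star> e = y \<star> (y' \<star> a \<star> y) \<star> y'"
      unfolding ep' p_def by (simp add: conv_assoc that)
    also have "y' \<star> a \<star> y = f \<star> (y' \<star> a \<star> y) \<star> f"
      using fy yf by (simp add: conv_assoc[symmetric] fa) (simp add: conv_assoc that)
    also obtain c where "f \<star> (y' \<star> a \<star> y) \<star> f = (\<lambda>x. c * f x)" using F by (meson conv_closed)
    also have "y \<star> (\<lambda>x. c * f x) \<star> y' = (\<lambda>x. c * e x)"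
      by (simp add: conv_scale_left conv_scale_right yf ep' p_def)
    finally show ?thesis by blast
  qed
  moreover have "e \<noteq> (\<lambda>x. 0)" using a(2) by auto
  ultimately show ?thesis using e by (simp add: minimal_idempotent_iff)
qed

text \<open>If \<open>D\<close> acts on \<open>N\<close> without fixed points, a module without \<open>N\<close>-invariants is free over \<open>\<complex>[D]\<close>:
  averaging over conjugates by \<open>N\<close> shows that the nontrivial elements of \<open>D\<close> have trace 0.\<close>

lemma card_dvd_dimension:
  assumes N: "subgroup N G" and D: "subgroup D G"
    and bij: "\<And>c. c \<in> D \<Longrightarrow> c \<noteq> \<one> \<Longrightarrow> bij_betw (\<lambda>n. n \<otimes> c \<otimes> inv n \<otimes> inv c) N N"
    and f: "f \<in> alg" "f \<star> f = f"
    and zero: "\<And>g. g \<in> carrier G \<Longrightarrow> (\<lambda>x. if x \<in> N then 1 else 0) \<star> delta g \<star> f = (\<lambda>x. 0)"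
  obtains m :: nat where "of_nat (card (carrier G)) * f \<one> = of_nat (card D * m)"
proof -
  have NG: "N \<subseteq> carrier G" and DG: "D \<subseteq> carrier G" using N D by (simp_all add: subgroup.subset)
  have finN: "finite N" and finD: "finite D" using NG DG fin finite_subset by blast+
  have N0: "card N > 0" and D0: "card D > 0"
    using N D finN finD subgroup.one_closed card_gt_0_iff by blast+
  \<comment> \<open>\<open>T c\<close> is the trace of left translation by \<open>c\<close> on the
    left ideal \<open>A f\<close>.\<close>
  define T where "T c = (\<Sum>g\<in>carrier G. f (inv g \<otimes> inv c \<otimes> g))" for c
  have Tconj: "T (n \<otimes> c \<otimes> inv n) = T c" if "n \<in> carrier G" "c \<in> carrier G" for n c
    unfolding T_def
    by (rule sum.reindex_bij_witness[of _ "\<lambda>g. n \<otimes> g" "\<lambda>g. inv n \<otimes> g"])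
      (use that in \<open>auto simp: m_assoc inv_mult_cancel inv_mult_group\<close>)
  have ind: "(\<lambda>x. if x \<in> S then 1 else 0) = (\<lambda>x. \<Sum>n\<in>S. 1 * delta n x)"
    if "finite S" for S :: "'a set"
    using that by (auto simp: delta_def fun_eq_iff)
  have T0: "T c = 0" if c: "c \<in> D" "c \<noteq> \<one>" for c
  proof -
    have cG: "c \<in> carrier G" using c DG by blast
    \<comment> \<open>The trace is averaged over the conjugates \<open>n c n^-1 = [n, c] c\<close>.
      By assumption \<open>[n, c]\<close> runs through all of \<open>N\<close>, so the average
      contains the sum over \<open>N\<close>, which kills the module.\<close>
    have "of_nat (card N) * T c = (\<Sum>n\<in>N. T (n \<otimes> c \<otimes> inv n))"
      using Tconj cG NG by (simp add: subset_iff)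
    also have "\<dots> = (\<Sum>n\<in>N. T ((n \<otimes> c \<otimes> inv n \<otimes> inv c) \<otimes> c))"
      using cG NG by (intro sum.cong) (auto simp: m_assoc subset_iff)
    also have "\<dots> = (\<Sum>n\<in>N. T (n \<otimes> c))"
      using sum.reindex_bij_betw[OF bij[OF c], of "\<lambda>n. T (n \<otimes> c)"] by simp
    also have "\<dots> = (\<Sum>g\<in>carrier G. \<Sum>n\<in>N. f (inv g \<otimes> inv (n \<otimes> c) \<otimes> g))"
      unfolding T_def by (rule sum.swap)
    also have "\<dots> = (\<Sum>g\<in>carrier G. ((\<lambda>x. if x \<in> N then 1 else 0) \<star> delta (c \<otimes> g) \<star> f) g)"
    proof (intro sum.cong refl)
      fix g assume g: "g \<in> carrier G"
      have "((\<lambda>x. if x \<in> N then 1 else 0) \<star> delta (c \<otimes> g) \<star> f) g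
        = (\<Sum>n\<in>N. (delta n \<star> delta (c \<otimes> g) \<star> f) g)"
        unfolding ind[OF finN] conv_sum_left by simp
      also have "\<dots> = (\<Sum>n\<in>N. f (inv g \<otimes> inv (n \<otimes> c) \<otimes> g))"
        using NG g cG by (intro sum.cong refl)
          (auto simp: delta_conv_delta_conv m_assoc inv_mult_group subset_iff)
      finally show "(\<Sum>n\<in>N. f (inv g \<otimes> inv (n \<otimes> c) \<otimes> g))
        = ((\<lambda>x. if x \<in> N then 1 else 0) \<star> delta (c \<otimes> g) \<star> f) g" by simp
    qed
    also have "\<dots> = 0" using zero cG by simp
    finally show ?thesis using N0 by simp
  qed
  \<comment> \<open>The projection onto \<open>D\<close>-invariants. Its trace \<open>m\<close> on
    the module is the mean of \<open>T\<close> over \<open>D\<close>, to which only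
    \<open>T \<one>\<close> contributes.\<close>
  define e where "e = (\<lambda>x. inverse (of_nat (card D)) * (if x \<in> D then 1 else 0 :: complex))"
  have ea: "e \<in> alg" using DG by (auto simp: e_def alg_def)
  have de: "delta c \<star> e = e" if "c \<in> D" for c
  proof -
    have "x \<in> carrier G \<and> inv c \<otimes> x \<in> D \<longleftrightarrow> x \<in> D" for x
      using that DG subgroup.m_closed[OF D] subgroup.m_inv_closed[OF D]
      by (metis (no_types, lifting) in_mono inv_mult_cancel(2) m_closed)
    moreover have "c \<in> carrier G" using that DG by blast
    ultimately show ?thesis unfolding delta_conv[OF \<open>c \<in> carrier G\<close>]
      by (auto simp: e_def fun_eq_iff)
  qed
  have ex: "e = (\<lambda>x. \<Sum>c\<in>D. inverse (of_nat (card D)) * delta c x)"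
    using finD by (auto simp: e_def delta_def fun_eq_iff sum_distrib_left[symmetric])
  have ek: "e \<star> k = (\<lambda>x. \<Sum>c\<in>D. inverse (of_nat (card D)) * (delta c \<star> k) x)" for k
    by (subst ex) (rule conv_sum_left)
  have ee: "e \<star> e = e"
    unfolding ek[of e] using D0 by (simp add: de field_simps cong: sum.cong)
  obtain m :: nat where m: "(\<Sum>g\<in>carrier G. (e \<star> delta g \<star> f) g) = of_nat m"
    by (rule conv_delta_conv_trace[OF ea ee f])
  have "(e \<star> delta g \<star> f) g = (\<Sum>c\<in>D. inverse (of_nat (card D)) * (delta c \<star> delta g \<star> f) g)" for g
    unfolding ek conv_sum_left ..
  then have "of_nat m = (\<Sum>c\<in>D. inverse (of_nat (card D)) * (\<Sum>g\<in>carrier G. (delta c \<star> delta g \<star> f) g))"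
    unfolding m[symmetric] by (simp add: sum_distrib_left sum.swap[of _ D])
  also have "\<dots> = (\<Sum>c\<in>D. inverse (of_nat (card D)) * T c)"
    using DG by (intro sum.cong refl) (auto simp: sum_conv_delta_conv f T_def subset_iff)
  also have "\<dots> = (\<Sum>c\<in>D. if c = \<one> then inverse (of_nat (card D)) * T \<one> else 0)"
    using T0 by (intro sum.cong) auto
  also have "\<dots> = inverse (of_nat (card D)) * T \<one>"
    using finD subgroup.one_closed[OF D] by simp
  also have "T \<one> = of_nat (card (carrier G)) * f \<one>" by (simp add: T_def)
  finally have "of_nat (card (carrier G)) * f \<one> = of_nat (card D * m)"
    using D0 by (simp add: field_simps)
  then show thesis by (rule that)
qed

end

section \<open>Induced linear characters and Mackey's criterion\<close>

text \<open>The idempotent whose left ideal is the module induced from \<open>\<chi>\<close>. Since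
  \<open>inverse 0 = 0\<close>, it vanishes outside \<open>B\<close> for \<open>\<chi>\<close> in
  \<open>characters_on G B\<close>.\<close>

definition character_idempotent :: "'a set \<Rightarrow> ('a \<Rightarrow> complex) \<Rightarrow> 'a \<Rightarrow> complex" where
  "character_idempotent B \<chi> = (\<lambda>x. inverse (of_nat (card B)) * inverse (\<chi> x))"

text \<open>Mackey's compatibility condition for the double coset of \<open>g\<close>: on the
  intersection of \<open>B\<close> with its conjugate by \<open>g\<close>, the character
  \<open>\<chi>\<close> equals the conjugate of \<open>\<chi>'\<close>.\<close>

definition intertwines ::
    "('a, 'm) monoid_scheme \<Rightarrow> 'a set \<Rightarrow> ('a \<Rightarrow> complex) \<Rightarrow> ('a \<Rightarrow> complex) \<Rightarrow> 'a \<Rightarrow> bool" where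
  "intertwines G B \<chi> \<chi>' g \<longleftrightarrow>
     (\<forall>b\<in>B. inv\<^bsub>G\<^esub> g \<otimes>\<^bsub>G\<^esub> b \<otimes>\<^bsub>G\<^esub> g \<in> B \<longrightarrow> \<chi> b = \<chi>' (inv\<^bsub>G\<^esub> g \<otimes>\<^bsub>G\<^esub> b \<otimes>\<^bsub>G\<^esub> g))"

context finite_group
begin

lemma conv_expand:
  assumes "a \<in> alg"
  shows "f \<star> a \<star> h = (\<lambda>x. \<Sum>g\<in>carrier G. a g * (f \<star> delta g \<star> h) x)"
proof -
  have "f \<star> (\<lambda>x. \<Sum>g\<in>carrier G. a g * delta g x) \<star> h = (\<lambda>x. \<Sum>g\<in>carrier G. a g * (f \<star> delta g \<star> h) x)"
    unfolding conv_sum_right conv_sum_left ..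
  then show ?thesis using alg_expand[OF assms] by simp
qed

context
  fixes B assumes B: "subgroup B G"
begin

lemma finite_subgroup: "finite B" and card_subgroup_pos: "card B > 0"
proof -
  show "finite B" using subgroup.subset[OF B] fin finite_subset by blast
  then show "card B > 0" using subgroup.one_closed[OF B] by (auto simp: card_gt_0_iff)
qed

lemma mult_mem_subgroup_iff:
  assumes "b \<in> B" "x \<in> carrier G"
  shows "inv b \<otimes> x \<in> B \<longleftrightarrow> x \<in> B" "x \<otimes> inv b \<in> B \<longleftrightarrow> x \<in> B"
proof -
  have b: "b \<in> carrier G" using subgroup.mem_carrier[OF B assms(1)] .
  have eq: "b \<otimes> (inv b \<otimes> x) = x" "(x \<otimes> inv b) \<otimes> b = x"
    using b assms(2) by (simp_all add: inv_mult_cancel m_assoc)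
  have ib: "inv b \<in> B" using subgroup.m_inv_closed[OF B assms(1)] .
  show "inv b \<otimes> x \<in> B \<longleftrightarrow> x \<in> B"
    using subgroup.m_closed[OF B assms(1), of "inv b \<otimes> x"] subgroup.m_closed[OF B ib, of x] eq(1) by auto
  show "x \<otimes> inv b \<in> B \<longleftrightarrow> x \<in> B"
    using subgroup.m_closed[OF B _ assms(1), of "x \<otimes> inv b"] subgroup.m_closed[OF B _ ib, of x] eq(2) by auto
qed

lemma character_idempotent_closed:
  assumes "\<chi> \<in> characters_on G B"
  shows "character_idempotent B \<chi> \<in> alg"
  using subgroup.subset[OF B] characters_onD(3)[OF assms]
  by (auto simp: alg_def character_idempotent_def)

lemma delta_conv_character_idempotent:
  assumes \<chi>: "\<chi> \<in> characters_on G B" and b: "b \<in> B"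
  shows "delta b \<star> character_idempotent B \<chi> = (\<lambda>x. \<chi> b * character_idempotent B \<chi> x)"
    and "character_idempotent B \<chi> \<star> delta b = (\<lambda>x. \<chi> b * character_idempotent B \<chi> x)"
proof -
  have bG: "b \<in> carrier G" using subgroup.mem_carrier[OF B b] .
  have out: "\<chi> x = 0" if "x \<notin> B" for x using characters_onD(3)[OF \<chi> that] .
  have ib: "inv b \<in> B" using subgroup.m_inv_closed[OF B b] .
  have sub: "x \<in> carrier G" if "x \<in> B" for x using subgroup.mem_carrier[OF B that] .
  have 1: "\<chi> (inv b \<otimes> x) = inverse (\<chi> b) * \<chi> x" "\<chi> (x \<otimes> inv b) = inverse (\<chi> b) * \<chi> x"
    if x: "x \<in> carrier G" for x
  proof -
    have "\<chi> (inv b \<otimes> x) = inverse (\<chi> b) * \<chi> x \<and> \<chi> (x \<otimes> inv b) = inverse (\<chi> b) * \<chi> x"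
    proof (cases "x \<in> B")
      case True
      then show ?thesis using characters_onD(1)[OF \<chi>] ib character_inv[OF \<chi> B b] by simp
    next
      case False
      then show ?thesis using mult_mem_subgroup_iff[OF b x] out by simp
    qed
    then show "\<chi> (inv b \<otimes> x) = inverse (\<chi> b) * \<chi> x" "\<chi> (x \<otimes> inv b) = inverse (\<chi> b) * \<chi> x" by auto
  qed
  show "delta b \<star> character_idempotent B \<chi> = (\<lambda>x. \<chi> b * character_idempotent B \<chi> x)"
    unfolding delta_conv[OF bG]
    using out sub 1(1) by (auto simp: character_idempotent_def fun_eq_iff)
  show "character_idempotent B \<chi> \<star> delta b = (\<lambda>x. \<chi> b * character_idempotent B \<chi> x)"
    unfolding conv_delta[OF bG]
    using out sub 1(2) by (auto simp: character_idempotent_def fun_eq_iff)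
qed

lemma character_idempotent_one:
  assumes "\<chi> \<in> characters_on G B"
  shows "character_idempotent B \<chi> \<one> = inverse (of_nat (card B))"
  using character_one[OF assms B] by (simp add: character_idempotent_def)

lemma character_idempotent_nonzero:
  assumes "\<chi> \<in> characters_on G B"
  shows "character_idempotent B \<chi> \<noteq> (\<lambda>x. 0)"
proof
  assume "character_idempotent B \<chi> = (\<lambda>x. 0)"
  then have "character_idempotent B \<chi> \<one> = 0" by (rule fun_cong)
  then show False using character_idempotent_one[OF assms] card_subgroup_pos by simp
qed

lemma character_idempotent_idem:
  assumes \<chi>: "\<chi> \<in> characters_on G B"
  shows "character_idempotent B \<chi> \<star> character_idempotent B \<chi> = character_idempotent B \<chi>" (is "?e \<star> ?e = ?e")
proof
  fix x
  have ea: "?e \<in> alg" using character_idempotent_closed[OF \<chi>] .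
  have "?e \<star> ?e = delta \<one> \<star> ?e \<star> ?e" using ea by (simp add: delta_one_conv)
  also have "\<dots> = (\<lambda>x. \<Sum>g\<in>carrier G. ?e g * (delta \<one> \<star> delta g \<star> ?e) x)" by (rule conv_expand[OF ea])
  finally have "(?e \<star> ?e) x = (\<Sum>g\<in>carrier G. ?e g * (delta g \<star> ?e) x)"
    by (simp add: delta_one_conv delta_closed cong: sum.cong)
  also have "\<dots> = (\<Sum>g\<in>B. ?e g * (delta g \<star> ?e) x)"
    using subgroup.subset[OF B] fin characters_onD(3)[OF \<chi>]
    by (intro sum.mono_neutral_right) (auto simp: character_idempotent_def)
  also have "\<dots> = (\<Sum>g\<in>B. inverse (of_nat (card B)) * ?e x)"
  proof (intro sum.cong refl)
    fix g assume g: "g \<in> B"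
    show "?e g * (delta g \<star> ?e) x = inverse (of_nat (card B)) * ?e x"
      unfolding delta_conv_character_idempotent[OF \<chi> g]
      using characters_onD(2)[OF \<chi> g] by (simp add: character_idempotent_def)
  qed
  also have "\<dots> = ?e x" using card_subgroup_pos by simp
  finally show "(?e \<star> ?e) x = ?e x" .
qed

text \<open>All terms of the sum for the value at \<open>g\<close> agree, so it is the number of
  \<open>y \<in> B\<close> with \<open>g^-1 y g \<in> B\<close>, divided by
  \<open>|B|^2\<close>.\<close>

lemma conv_character_idempotents_nonzero:
  assumes \<chi>: "\<chi> \<in> characters_on G B" and \<chi>': "\<chi>' \<in> characters_on G B"
    and g: "g \<in> carrier G" and i: "intertwines G B \<chi> \<chi>' g"
  shows "(character_idempotent B \<chi> \<star> delta g \<star> character_idempotent B \<chi>') g \<noteq> 0"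
proof -
  let ?e = "character_idempotent B \<chi>" and ?e' = "character_idempotent B \<chi>'"
  let ?n = "inverse (of_nat (card B)) :: complex"
  let ?S = "{y \<in> B. inv g \<otimes> y \<otimes> g \<in> B}"
  have BG: "y \<in> carrier G" if "y \<in> B" for y using subgroup.mem_carrier[OF B that] .
  have "(?e \<star> delta g \<star> ?e') g = (\<Sum>y\<in>carrier G. ?e y * ?e' (inv g \<otimes> (inv y \<otimes> g)))"
    unfolding conv_assoc delta_conv[OF g] using g by (simp add: conv_def cong: sum.cong)
  also have "\<dots> = (\<Sum>y\<in>carrier G. if y \<in> ?S then ?n * ?n else 0)"
  proof (intro sum.cong refl)
    fix y assume y: "y \<in> carrier G"
    have inv: "inv g \<otimes> (inv y \<otimes> g) = inv (inv g \<otimes> y \<otimes> g)"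
      using g y by (simp add: inv_mult_group m_assoc)
    show "?e y * ?e' (inv g \<otimes> (inv y \<otimes> g)) = (if y \<in> ?S then ?n * ?n else 0)"
    proof (cases "y \<in> ?S")
      case True
      then have "\<chi> y = \<chi>' (inv g \<otimes> y \<otimes> g)" using i by (simp add: intertwines_def)
      moreover have "\<chi> y \<noteq> 0" using characters_onD(2)[OF \<chi>] True by simp
      ultimately show ?thesis
        using True character_inv[OF \<chi>' B] by (simp add: character_idempotent_def inv)
    next
      case False
      have "inv (inv g \<otimes> y \<otimes> g) \<notin> B" if "inv g \<otimes> y \<otimes> g \<notin> B"
        using that subgroup.m_inv_closed[OF B, of "inv (inv g \<otimes> y \<otimes> g)"] g y by auto
      then have "\<chi> y = 0 \<or> \<chi>' (inv (inv g \<otimes> y \<otimes> g)) = 0"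
        using False characters_onD(3)[OF \<chi>] characters_onD(3)[OF \<chi>'] by auto
      then show ?thesis using False by (auto simp: character_idempotent_def inv)
    qed
  qed
  also have "\<dots> = (\<Sum>y\<in>?S. ?n * ?n)"
    using BG fin by (intro sum.mono_neutral_cong_right) auto
  also have "\<dots> = of_nat (card ?S) * (?n * ?n)" by simp
  also have "\<dots> \<noteq> 0"
  proof -
    have "\<one> \<in> ?S" using subgroup.one_closed[OF B] g by simp
    moreover have "finite ?S" using finite_subgroup by simp
    ultimately have "card ?S \<noteq> 0" by (metis card_0_eq empty_iff)
    then show ?thesis using card_subgroup_pos by simp
  qed
  finally show ?thesis .
qed

text \<open>A \<open>b\<close> that violates the condition can be absorbed on either side of
  \<open>delta g\<close>, with two different scalars.\<close>

lemma conv_character_idempotents_zero: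
  assumes \<chi>: "\<chi> \<in> characters_on G B" and \<chi>': "\<chi>' \<in> characters_on G B"
    and g: "g \<in> carrier G" and i: "\<not> intertwines G B \<chi> \<chi>' g"
  shows "character_idempotent B \<chi> \<star> delta g \<star> character_idempotent B \<chi>' = (\<lambda>x. 0)"
proof -
  let ?e = "character_idempotent B \<chi>" and ?e' = "character_idempotent B \<chi>'"
  let ?X = "?e \<star> delta g \<star> ?e'"
  obtain b where b: "b \<in> B" "inv g \<otimes> b \<otimes> g \<in> B" "\<chi> b \<noteq> \<chi>' (inv g \<otimes> b \<otimes> g)"
    using i by (auto simp: intertwines_def)
  have bG: "b \<in> carrier G" using subgroup.mem_carrier[OF B b(1)] .
  have "(?e \<star> delta b) \<star> delta g \<star> ?e' = ?e \<star> (delta b \<star> delta g) \<star> ?e'" by (simp only: conv_assoc)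
  also have "delta b \<star> delta g = delta g \<star> delta (inv g \<otimes> b \<otimes> g)"
    using g bG by (simp add: delta_conv_delta m_assoc inv_mult_cancel)
  also have "?e \<star> (delta g \<star> delta (inv g \<otimes> b \<otimes> g)) \<star> ?e' = ?e \<star> delta g \<star> (delta (inv g \<otimes> b \<otimes> g) \<star> ?e')"
    by (simp only: conv_assoc)
  finally have "(\<lambda>x. \<chi> b * ?X x) = (\<lambda>x. \<chi>' (inv g \<otimes> b \<otimes> g) * ?X x)"
    unfolding delta_conv_character_idempotent[OF \<chi>' b(2)] delta_conv_character_idempotent[OF \<chi> b(1)]
      conv_scale_left conv_scale_right .
  then show ?thesis using b(3) by (auto simp: fun_eq_iff)
qed

text \<open>The elements \<open>e \<star> delta g \<star> e'\<close> span \<open>e A e'\<close>, and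
  each is nonzero exactly when \<open>g\<close> intertwines.\<close>

lemma linked_character_idempotents_iff:
  assumes \<chi>: "\<chi> \<in> characters_on G B" and \<chi>': "\<chi>' \<in> characters_on G B"
  shows "linked (group_algebra G) (character_idempotent B \<chi>) (character_idempotent B \<chi>') \<longleftrightarrow>
    (\<exists>g\<in>carrier G. intertwines G B \<chi> \<chi>' g)"
proof
  let ?e = "character_idempotent B \<chi>" and ?e' = "character_idempotent B \<chi>'"
  have c: "?e \<in> alg" "?e' \<in> alg" using character_idempotent_closed \<chi> \<chi>' by auto
  {
    assume "linked (group_algebra G) ?e ?e'"
    then obtain a where a: "a \<in> alg" "?e \<star> a \<star> ?e' \<noteq> (\<lambda>x. 0)" using linked_iff[OF c] by blast
    show "\<exists>g\<in>carrier G. intertwines G B \<chi> \<chi>' g"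
    proof (rule ccontr)
      assume "\<not> ?thesis"
      then have "?e \<star> a \<star> ?e' = (\<lambda>x. 0)"
        unfolding conv_expand[OF a(1)] using conv_character_idempotents_zero[OF \<chi> \<chi>'] by simp
      then show False using a(2) by simp
    qed
  next
    assume "\<exists>g\<in>carrier G. intertwines G B \<chi> \<chi>' g"
    then obtain g where g: "g \<in> carrier G" "intertwines G B \<chi> \<chi>' g" by blast
    then have "?e \<star> delta g \<star> ?e' \<noteq> (\<lambda>x. 0)"
      using conv_character_idempotents_nonzero[OF \<chi> \<chi>' g] by (metis)
    then show "linked (group_algebra G) ?e ?e'" using linked_iff[OF c] delta_closed[OF g(1)] by blast
  }
qed

text \<open>Mackey's irreducibility criterion. If \<open>e \<star> delta g \<star> e\<close> is a
  multiple of \<open>e\<close> and does not vanish at \<open>g\<close>, then \<open>g\<close> lies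
  in the support \<open>B\<close> of \<open>e\<close>; conversely only \<open>g \<in> B\<close>
  contribute, and they act by scalars.\<close>

lemma minimal_character_idempotent_iff:
  assumes \<chi>: "\<chi> \<in> characters_on G B"
  shows "minimal_idempotent (group_algebra G) (character_idempotent B \<chi>) \<longleftrightarrow>
    (\<forall>g\<in>carrier G. intertwines G B \<chi> \<chi> g \<longrightarrow> g \<in> B)"
proof
  let ?e = "character_idempotent B \<chi>"
  {
    assume m: "minimal_idempotent (group_algebra G) ?e"
    show "\<forall>g\<in>carrier G. intertwines G B \<chi> \<chi> g \<longrightarrow> g \<in> B"
    proof (intro ballI impI)
      fix g assume g: "g \<in> carrier G" "intertwines G B \<chi> \<chi> g"
      obtain c where "?e \<star> delta g \<star> ?e = (\<lambda>x. c * ?e x)"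
        using m delta_closed[OF g(1)] unfolding minimal_idempotent_iff by blast
      then have "?e g \<noteq> 0" using conv_character_idempotents_nonzero[OF \<chi> \<chi> g] by auto
      then show "g \<in> B" using characters_onD(3)[OF \<chi>] by (auto simp: character_idempotent_def)
    qed
  next
    assume i: "\<forall>g\<in>carrier G. intertwines G B \<chi> \<chi> g \<longrightarrow> g \<in> B"
    have X: "?e \<star> delta g \<star> ?e = (\<lambda>x. \<chi> g * ?e x)" if g: "g \<in> carrier G" for g
    proof (cases "g \<in> B")
      case True
      then show ?thesis
        by (simp add: delta_conv_character_idempotent[OF \<chi>] conv_scale_left character_idempotent_idem[OF \<chi>])
    next
      case False
      then show ?thesis
        using i g conv_character_idempotents_zero[OF \<chi> \<chi> g] characters_onD(3)[OF \<chi>] by auto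
    qed
    have "\<exists>c. ?e \<star> a \<star> ?e = (\<lambda>x. c * ?e x)" if a: "a \<in> alg" for a
    proof -
      have "?e \<star> a \<star> ?e = (\<lambda>x. (\<Sum>g\<in>carrier G. a g * \<chi> g) * ?e x)"
        unfolding conv_expand[OF a] by (simp add: X sum_distrib_right mult.assoc cong: sum.cong)
      then show ?thesis by blast
    qed
    then show "minimal_idempotent (group_algebra G) ?e"
      unfolding minimal_idempotent_iff
      using character_idempotent_closed[OF \<chi>] character_idempotent_idem[OF \<chi>]
        character_idempotent_nonzero[OF \<chi>] by blast
  }
qed

end

end

section \<open>Invariance under algebra isomorphisms\<close>

definition algebra_iso :: "(complex, 'a) module \<Rightarrow> (complex, 'b) module \<Rightarrow> ('a \<Rightarrow> 'b) set" where
  "algebra_iso A B = {h \<in> ring_iso A B. \<forall>c. \<forall>x\<in>carrier A. h (c \<odot>\<^bsub>A\<^esub> x) = c \<odot>\<^bsub>B\<^esub> h x}"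

locale group_algebra_iso = G: finite_group G + H: finite_group H for G H +
  fixes h
  assumes h: "h \<in> algebra_iso (group_algebra G) (group_algebra H)"
begin

lemma bij: "bij_betw h G.alg H.alg"
  using h by (simp add: algebra_iso_def ring_iso_def G.group_algebra_carrier H.group_algebra_carrier)

lemma closed: "x \<in> G.alg \<Longrightarrow> h x \<in> H.alg"
  using bij by (auto simp: bij_betw_def)

lemma hom_mult: "x \<in> G.alg \<Longrightarrow> y \<in> G.alg \<Longrightarrow> h (G.conv x y) = H.conv (h x) (h y)"
  using h ring_hom_mult[of h "group_algebra G" "group_algebra H" x y] closed
  by (auto simp: algebra_iso_def ring_iso_def G.group_algebra_carrier
      G.group_algebra_mult H.group_algebra_mult)

lemma hom_add: "x \<in> G.alg \<Longrightarrow> y \<in> G.alg \<Longrightarrow> h (\<lambda>g. x g + y g) = (\<lambda>g. h x g + h y g)"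
  using h ring_hom_add[of h "group_algebra G" "group_algebra H" x y]
  by (auto simp: algebra_iso_def ring_iso_def G.group_algebra_carrier
      G.group_algebra_add H.group_algebra_add)

lemma hom_scale: "x \<in> G.alg \<Longrightarrow> h (\<lambda>g. c * x g) = (\<lambda>g. c * h x g)"
  using h by (auto simp: algebra_iso_def G.group_algebra_carrier
      G.group_algebra_smult H.group_algebra_smult)

lemma hom_zero: "h (\<lambda>g. 0) = (\<lambda>g. 0)"
  using hom_scale[of "\<lambda>g. 0" 0] by (simp add: G.alg_def)

lemma hom_eq_zero_iff: "x \<in> G.alg \<Longrightarrow> h x = (\<lambda>g. 0) \<longleftrightarrow> x = (\<lambda>g. 0)"
  using bij hom_zero by (auto simp: bij_betw_def inj_on_def G.alg_def)

lemma hom_sum: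
  assumes "finite S" "\<And>i. i \<in> S \<Longrightarrow> F i \<in> G.alg"
  shows "h (\<lambda>g. \<Sum>i\<in>S. c i * F i g) = (\<lambda>g. \<Sum>i\<in>S. c i * h (F i) g)"
  using assms
proof (induction S rule: finite_induct)
  case empty
  then show ?case by (simp add: hom_zero)
next
  case (insert i S)
  have "(\<lambda>g. \<Sum>i\<in>S. c i * F i g) \<in> G.alg" "(\<lambda>g. c i * F i g) \<in> G.alg"
    using insert.prems by (auto simp: G.alg_def)
  then have "h (\<lambda>g. c i * F i g + (\<Sum>i\<in>S. c i * F i g))
    = (\<lambda>g. h (\<lambda>g. c i * F i g) g + h (\<lambda>g. \<Sum>i\<in>S. c i * F i g) g)" by (intro hom_add)
  then show ?case using insert by (simp add: hom_scale)
qed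

lemma hom_triple:
  assumes "f \<in> G.alg" "a \<in> G.alg" "f' \<in> G.alg"
  shows "h (G.conv (G.conv f a) f') = H.conv (H.conv (h f) (h a)) (h f')"
  using assms by (simp add: hom_mult)

lemma minimal_idempotent_image:
  assumes "minimal_idempotent (group_algebra G) f"
  shows "minimal_idempotent (group_algebra H) (h f)"
proof -
  note F = assms[unfolded G.minimal_idempotent_iff]
  then have f: "f \<in> G.alg" by blast
  have "\<exists>c. H.conv (H.conv (h f) b) (h f) = (\<lambda>x. c * h f x)" if "b \<in> H.alg" for b
  proof -
    obtain a where a: "a \<in> G.alg" "b = h a"
      using bij_betw_imp_surj_on[OF bij] \<open>b \<in> H.alg\<close> by blast
    then obtain c where "G.conv (G.conv f a) f = (\<lambda>x. c * f x)" using F by blast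
    then have "H.conv (H.conv (h f) b) (h f) = (\<lambda>x. c * h f x)"
      using hom_triple[OF f a(1) f] a(2) hom_scale[OF f] by simp
    then show ?thesis by blast
  qed
  then show ?thesis using F f closed hom_mult[OF f f] hom_eq_zero_iff[OF f]
    unfolding H.minimal_idempotent_iff by auto
qed

lemma linked_image_iff:
  assumes f: "f \<in> G.alg" "f' \<in> G.alg"
  shows "linked (group_algebra H) (h f) (h f') \<longleftrightarrow> linked (group_algebra G) f f'"
proof -
  have "(\<exists>b\<in>H.alg. H.conv (H.conv (h f) b) (h f') \<noteq> (\<lambda>x. 0)) \<longleftrightarrow>
    (\<exists>a\<in>G.alg. H.conv (H.conv (h f) (h a)) (h f') \<noteq> (\<lambda>x. 0))"
    unfolding bij_betw_imp_surj_on[OF bij, symmetric] by simp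
  also have "\<dots> \<longleftrightarrow> (\<exists>a\<in>G.alg. G.conv (G.conv f a) f' \<noteq> (\<lambda>x. 0))"
    using f by (simp add: hom_triple[symmetric] hom_eq_zero_iff)
  finally show ?thesis using f closed by (simp add: G.linked_iff H.linked_iff)
qed

text \<open>Both sides are traces of multiplication operators on the regular module.\<close>

lemma value_at_one:
  assumes f: "f \<in> G.alg"
  shows "of_nat (card (carrier H)) * h f \<one>\<^bsub>H\<^esub> = of_nat (card (carrier G)) * f \<one>\<^bsub>G\<^esub>"
proof -
  define k where "k = inv_into G.alg h"
  have k: "k y \<in> G.alg" "h (k y) = y" if "y \<in> H.alg" for y
    using that bij by (auto simp: k_def bij_betw_def inv_into_into f_inv_into_f)
  have kh: "k (h x) = x" if "x \<in> G.alg" for x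
    using that bij by (simp add: k_def bij_betw_def)
  have reg: "of_nat (card (carrier G)) * f \<one>\<^bsub>G\<^esub> = (\<Sum>g\<in>carrier G. G.conv (delta g) f g)"
    by (simp add: G.delta_conv)
  have dH: "delta y \<in> H.alg" if "y \<in> carrier H" for y using that by (rule H.delta_closed)
  have dG: "delta x \<in> G.alg" if "x \<in> carrier G" for x using that by (rule G.delta_closed)
  \<comment> \<open>The matrices of \<open>h\<close> and of its inverse \<open>k\<close> with
    respect to the two bases of point masses are inverse to each other; this makes the two traces
    equal.\<close>
  have dual: "(\<Sum>y\<in>carrier H. h (delta x) y * k (delta y) g) = delta x g" if x: "x \<in> carrier G" for x g
  proof -
    have "h (\<lambda>g. \<Sum>y\<in>carrier H. h (delta x) y * k (delta y) g)
      = (\<lambda>g. \<Sum>y\<in>carrier H. h (delta x) y * h (k (delta y)) g)"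
      using H.fin k(1) dH by (intro hom_sum) auto
    also have "\<dots> = (\<lambda>g. \<Sum>y\<in>carrier H. h (delta x) y * delta y g)"
      using k(2) dH by simp
    also have "\<dots> = h (delta x)" using H.alg_expand[OF closed[OF dG[OF x]]] by simp
    finally have "h (\<lambda>g. \<Sum>y\<in>carrier H. h (delta x) y * k (delta y) g) = h (delta x)" .
    moreover have "(\<lambda>g. \<Sum>y\<in>carrier H. h (delta x) y * k (delta y) g) \<in> G.alg"
      using k(1) dH by (auto simp: G.alg_def)
    ultimately have "(\<lambda>g. \<Sum>y\<in>carrier H. h (delta x) y * k (delta y) g) = delta x"
      using bij dG[OF x] by (auto simp: bij_betw_def inj_on_def)
    then show ?thesis by (rule fun_cong)
  qed
  have "of_nat (card (carrier H)) * h f \<one>\<^bsub>H\<^esub> = (\<Sum>y\<in>carrier H. H.conv (delta y) (h f) y)"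
    by (simp add: H.delta_conv)
  also have "\<dots> = (\<Sum>y\<in>carrier H. \<Sum>x\<in>carrier G. G.conv (k (delta y)) f x * h (delta x) y)"
  proof (intro sum.cong refl)
    fix y assume y: "y \<in> carrier H"
    have "H.conv (delta y) (h f) = h (G.conv (k (delta y)) f)"
      using k dH[OF y] f by (simp add: hom_mult)
    also have "G.conv (k (delta y)) f = (\<lambda>g. \<Sum>x\<in>carrier G. G.conv (k (delta y)) f x * delta x g)"
      by (rule G.alg_expand) simp
    also have "h \<dots> = (\<lambda>g. \<Sum>x\<in>carrier G. G.conv (k (delta y)) f x * h (delta x) g)"
      using G.fin dG by (intro hom_sum) auto
    finally show "H.conv (delta y) (h f) y = (\<Sum>x\<in>carrier G. G.conv (k (delta y)) f x * h (delta x) y)"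
      by simp
  qed
  also have "\<dots> = (\<Sum>y\<in>carrier H. \<Sum>x\<in>carrier G. \<Sum>g\<in>carrier G.
      f (inv\<^bsub>G\<^esub> g \<otimes>\<^bsub>G\<^esub> x) * (h (delta x) y * k (delta y) g))"
    by (intro sum.cong refl) (simp add: G.conv_def sum_distrib_left sum_distrib_right mult_ac)
  also have "\<dots> = (\<Sum>x\<in>carrier G. \<Sum>y\<in>carrier H. \<Sum>g\<in>carrier G.
      f (inv\<^bsub>G\<^esub> g \<otimes>\<^bsub>G\<^esub> x) * (h (delta x) y * k (delta y) g))"
    by (rule sum.swap)
  also have "\<dots> = (\<Sum>x\<in>carrier G. \<Sum>g\<in>carrier G. \<Sum>y\<in>carrier H.
      f (inv\<^bsub>G\<^esub> g \<otimes>\<^bsub>G\<^esub> x) * (h (delta x) y * k (delta y) g))"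
    by (intro sum.cong refl) (rule sum.swap)
  also have "\<dots> = (\<Sum>x\<in>carrier G. \<Sum>g\<in>carrier G. f (inv\<^bsub>G\<^esub> g \<otimes>\<^bsub>G\<^esub> x) * delta x g)"
    by (intro sum.cong refl) (simp only: sum_distrib_left[symmetric] dual)
  also have "\<dots> = (\<Sum>x\<in>carrier G. \<Sum>g\<in>carrier G. if g = x then f \<one>\<^bsub>G\<^esub> else 0)"
    by (intro sum.cong refl) (auto simp: delta_def)
  also have "\<dots> = of_nat (card (carrier G)) * f \<one>\<^bsub>G\<^esub>"
    using G.fin by simp
  finally show ?thesis .
qed

end

lemma complex_algebras_isomorphic_iff: "complex_algebras_isomorphic A B \<longleftrightarrow> algebra_iso A B \<noteq> {}"
  by (auto simp: complex_algebras_isomorphic_def algebra_iso_def)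

lemma group_iso_imp_algebras_isomorphic:
  assumes "finite_group G" "finite_group H" and \<phi>: "\<phi> \<in> iso G H"
  shows "complex_algebras_isomorphic (group_algebra G) (group_algebra H)"
proof -
  interpret G: finite_group G by fact
  interpret H: finite_group H by fact
  define \<psi> where "\<psi> = inv_into (carrier G) \<phi>"
  have \<psi>: "\<psi> \<in> iso H G" unfolding \<psi>_def using G.iso_set_sym[OF \<phi>] .
  then have bij: "bij_betw \<psi> (carrier H) (carrier G)" by (simp add: iso_def)
  interpret \<psi>: group_hom H G \<psi> using \<psi> by unfold_locales (simp add: iso_def)
  define h where "h f = (\<lambda>y. if y \<in> carrier H then f (\<psi> y) else (0::complex))" for f
  have "h \<in> ring_iso (group_algebra G) (group_algebra H)"
  proof (rule ring_iso_memI)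
    fix x y :: "'a \<Rightarrow> complex"
    assume x: "x \<in> carrier (group_algebra G)" and y: "y \<in> carrier (group_algebra G)"
    have hc: "h x \<in> H.alg" for x by (simp add: h_def H.alg_def)
    show "h x \<in> carrier (group_algebra H)" using hc by (simp add: H.group_algebra_carrier)
    show "h (x \<oplus>\<^bsub>group_algebra G\<^esub> y) = h x \<oplus>\<^bsub>group_algebra H\<^esub> h y"
      by (auto simp: h_def G.group_algebra_add H.group_algebra_add)
    have "h (G.conv x y) = H.conv (h x) (h y)"
    proof
      fix z
      show "h (G.conv x y) z = H.conv (h x) (h y) z"
      proof (cases "z \<in> carrier H")
        case z: True
        have "h (G.conv x y) z = (\<Sum>g\<in>carrier G. x g * y (inv\<^bsub>G\<^esub> g \<otimes>\<^bsub>G\<^esub> \<psi> z))"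
          using z by (simp add: h_def G.conv_def)
        also have "\<dots> = (\<Sum>w\<in>carrier H. x (\<psi> w) * y (inv\<^bsub>G\<^esub> (\<psi> w) \<otimes>\<^bsub>G\<^esub> \<psi> z))"
          by (rule sum.reindex_bij_betw[OF bij, symmetric])
        also have "\<dots> = H.conv (h x) (h y) z"
          using z by (simp add: h_def H.conv_def cong: sum.cong)
        finally show ?thesis .
      qed (simp add: h_def H.conv_def)
    qed
    then show "h (x \<otimes>\<^bsub>group_algebra G\<^esub> y) = h x \<otimes>\<^bsub>group_algebra H\<^esub> h y"
      using x y hc by (simp add: G.group_algebra_carrier G.group_algebra_mult H.group_algebra_mult)
  next
    have "\<psi> y = \<one>\<^bsub>G\<^esub> \<longleftrightarrow> y = \<one>\<^bsub>H\<^esub>" if "y \<in> carrier H" for y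
      using bij that \<psi>.hom_one H.one_closed unfolding bij_betw_def inj_on_def by metis
    then show "h \<one>\<^bsub>group_algebra G\<^esub> = \<one>\<^bsub>group_algebra H\<^esub>"
      by (auto simp: h_def group_algebra_def)
  next
    show "bij_betw h (carrier (group_algebra G)) (carrier (group_algebra H))"
    proof (rule bij_betw_byWitness[of _ "\<lambda>f x. if x \<in> carrier G then f (\<phi> x) else 0"])
      have inv: "\<psi> (\<phi> x) = x" if "x \<in> carrier G" for x
        using \<phi> that by (simp add: \<psi>_def iso_def bij_betw_def)
      have inv': "\<phi> (\<psi> y) = y" if "y \<in> carrier H" for y
        using \<phi> that by (auto simp: \<psi>_def iso_def bij_betw_def f_inv_into_f)
      have cl: "\<phi> x \<in> carrier H" if "x \<in> carrier G" for x
        using \<phi> that by (auto simp: iso_def bij_betw_def)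
      show "\<forall>f\<in>carrier (group_algebra G). (\<lambda>x. if x \<in> carrier G then h f (\<phi> x) else 0) = f"
        using inv cl by (auto simp: G.group_algebra_carrier G.alg_def h_def)
      show "\<forall>f\<in>carrier (group_algebra H). h (\<lambda>x. if x \<in> carrier G then f (\<phi> x) else 0) = f"
        using inv' by (auto simp: H.group_algebra_carrier H.alg_def h_def)
    qed (auto simp: G.group_algebra_carrier H.group_algebra_carrier G.alg_def H.alg_def h_def)
  qed
  moreover have "h (c \<odot>\<^bsub>group_algebra G\<^esub> x) = c \<odot>\<^bsub>group_algebra H\<^esub> h x" for c x
    by (auto simp: h_def G.group_algebra_smult H.group_algebra_smult)
  ultimately show ?thesis unfolding complex_algebras_isomorphic_def by blast
qed

lemma complex_algebras_isomorphic_trans: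
  assumes "complex_algebras_isomorphic A B" "complex_algebras_isomorphic B C"
  shows "complex_algebras_isomorphic A C"
proof -
  obtain h k where h: "h \<in> ring_iso A B" "\<forall>c. \<forall>x\<in>carrier A. h (c \<odot>\<^bsub>A\<^esub> x) = c \<odot>\<^bsub>B\<^esub> h x"
    and k: "k \<in> ring_iso B C" "\<forall>c. \<forall>x\<in>carrier B. k (c \<odot>\<^bsub>B\<^esub> x) = c \<odot>\<^bsub>C\<^esub> k x"
    using assms unfolding complex_algebras_isomorphic_def by blast
  have "k \<circ> h \<in> ring_iso A C" using ring_iso_set_trans[OF h(1) k(1)] .
  moreover have "h x \<in> carrier B" if "x \<in> carrier A" for x
    using ring_iso_memE(1)[OF h(1) that] .
  ultimately show ?thesis
    unfolding complex_algebras_isomorphic_def using h(2) k(2) by (intro bexI[of _ "k \<circ> h"]) auto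
qed

section \<open>Counting classes of minimal idempotents\<close>

lemma card_le_two_image:
  assumes "finite S" and fib: "\<And>x. x \<in> S \<Longrightarrow> \<exists>u v. {y \<in> S. f y = f x} \<subseteq> {u, v}"
  shows "card S \<le> 2 * card (f ` S)"
proof -
  have "S = (\<Union>c\<in>f ` S. {y \<in> S. f y = c})" by auto
  then have "card S \<le> (\<Sum>c\<in>f ` S. card {y \<in> S. f y = c})"
    using card_UN_le[of "f ` S" "\<lambda>c. {y \<in> S. f y = c}"] assms(1) by simp
  also have "\<dots> \<le> (\<Sum>c\<in>f ` S. 2)"
  proof (rule sum_mono)
    fix c assume "c \<in> f ` S"
    then obtain u v where "{y \<in> S. f y = c} \<subseteq> {u, v}" using fib by blast
    then have "card {y \<in> S. f y = c} \<le> card {u, v}" by (intro card_mono) auto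
    also have "\<dots> \<le> 2" by (simp add: card_insert_if)
    finally show "card {y \<in> S. f y = c} \<le> 2" .
  qed
  finally show ?thesis by simp
qed

text \<open>As \<open>inverse 0 = 0\<close>, the value 0 outside the subgroup is kept.\<close>

definition inverse_character :: "('a \<Rightarrow> complex) \<Rightarrow> 'a \<Rightarrow> complex" where
  "inverse_character \<chi> = (\<lambda>x. inverse (\<chi> x))"

lemma inverse_character_inverse [simp]: "inverse_character (inverse_character \<chi>) = \<chi>"
  by (simp add: inverse_character_def)

lemma inverse_character_eq_iff [simp]: "inverse_character \<chi> = inverse_character \<psi> \<longleftrightarrow> \<chi> = \<psi>"
  using inverse_character_inverse by metis

text \<open>Inversion is an involution of \<open>S\<close> without fixed points, so its orbits
  partition \<open>S\<close> into sets of size two.\<close>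

lemma card_inverse_pairs:
  assumes fin: "finite S" and closed: "\<And>\<chi>. \<chi> \<in> S \<Longrightarrow> inverse_character \<chi> \<in> S \<and> inverse_character \<chi> \<noteq> \<chi>"
  shows "2 * card ((\<lambda>\<chi>. {\<chi>, inverse_character \<chi>}) ` S) = card S"
proof -
  let ?P = "\<lambda>\<chi>. {\<chi>, inverse_character \<chi>}"
  have "card (\<Union>(?P ` S)) = (\<Sum>c\<in>?P ` S. card c)"
  proof (rule card_Union_disjoint)
    show "disjoint (?P ` S)"
      unfolding pairwise_def disjnt_def
    proof (intro ballI impI)
      fix c d assume "c \<in> ?P ` S" "d \<in> ?P ` S" "c \<noteq> d"
      then obtain a b where ab: "c = ?P a" "d = ?P b" by blast
      have "?P a = ?P b" if "z \<in> ?P a" "z \<in> ?P b" for z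
        using that by (auto simp: insert_commute)
      then show "c \<inter> d = {}" using ab \<open>c \<noteq> d\<close> by blast
    qed
  qed auto
  also have "\<dots> = (\<Sum>c\<in>?P ` S. 2)"
  proof (rule sum.cong[OF refl])
    fix c assume "c \<in> ?P ` S"
    then obtain a where "a \<in> S" "c = ?P a" by blast
    then show "card c = 2" using closed[of a] by (auto simp: card_insert_if)
  qed
  also have "\<Union>(?P ` S) = S" using closed by auto
  finally show ?thesis by simp
qed

text \<open>Each \<open>\<chi> \<in> \<Theta>\<close> yields a pair \<open>{\<xi>, \<xi>\<^sup>-\<^sup>1}\<close> in \<open>\<Xi>\<close>, and at most two \<open>\<chi>\<close> yield the same pair.\<close>

lemma group_algebras_not_isomorphic:
  fixes G :: "('a, 'm) monoid_scheme" and H :: "('b, 'n) monoid_scheme"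
  assumes "finite_group G" "finite_group H"
    and B: "subgroup B G" and C: "subgroup C H"
    and index: "card (carrier G) * card C = card (carrier H) * card B"
    and \<Theta>: "finite \<Theta>" "\<Theta> \<subseteq> characters_on G B"
      "\<And>\<chi> g. \<chi> \<in> \<Theta> \<Longrightarrow> g \<in> carrier G \<Longrightarrow> intertwines G B \<chi> \<chi> g \<Longrightarrow> g \<in> B"
      "\<And>\<chi> \<chi>' g. \<chi> \<in> \<Theta> \<Longrightarrow> \<chi>' \<in> \<Theta> \<Longrightarrow> g \<in> carrier G \<Longrightarrow> intertwines G B \<chi> \<chi>' g \<Longrightarrow>
        \<chi>' \<in> {\<chi>, inverse_character \<chi>}"
    and \<Xi>: "finite \<Xi>" "\<Xi> \<subseteq> characters_on H C"
      "\<And>\<chi>. \<chi> \<in> \<Xi> \<Longrightarrow> inverse_character \<chi> \<in> \<Xi> \<and> inverse_character \<chi> \<noteq> \<chi>"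
      "\<And>\<chi>. \<chi> \<in> \<Xi> \<Longrightarrow> \<exists>g\<in>carrier H. intertwines H C \<chi> (inverse_character \<chi>) g"
      "\<And>f. minimal_idempotent (group_algebra H) f \<Longrightarrow>
        of_nat (card C) * f \<one>\<^bsub>H\<^esub> = 1 \<Longrightarrow>
        \<exists>\<chi>\<in>\<Xi>. minimal_idempotent (group_algebra H) (character_idempotent C \<chi>) \<and>
          linked (group_algebra H) (character_idempotent C \<chi>) f"
    and less: "card \<Xi> < card \<Theta>"
  shows "\<not> complex_algebras_isomorphic (group_algebra G) (group_algebra H)"
proof
  interpret G: finite_group G by fact
  interpret H: finite_group H by fact
  assume "complex_algebras_isomorphic (group_algebra G) (group_algebra H)"
  then obtain h where "h \<in> algebra_iso (group_algebra G) (group_algebra H)"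
    by (auto simp: complex_algebras_isomorphic_iff)
  then interpret group_algebra_iso G H h by unfold_locales
  let ?e = "character_idempotent B" and ?e' = "character_idempotent C"
  have ch: "\<chi> \<in> characters_on G B" if "\<chi> \<in> \<Theta>" for \<chi> using that \<Theta>(2) by blast
  have ch': "\<chi> \<in> characters_on H C" if "\<chi> \<in> \<Xi>" for \<chi> using that \<Xi>(2) by blast
  have ea: "?e \<chi> \<in> G.alg" if "\<chi> \<in> \<Theta>" for \<chi> using G.character_idempotent_closed[OF B ch[OF that]] .
  have mG: "minimal_idempotent (group_algebra G) (?e \<chi>)" if "\<chi> \<in> \<Theta>" for \<chi>
    using G.minimal_character_idempotent_iff[OF B ch[OF that]] \<Theta>(3)[OF that] by blast
  have mH: "minimal_idempotent (group_algebra H) (h (?e \<chi>))" if "\<chi> \<in> \<Theta>" for \<chi>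
    using minimal_idempotent_image[OF mG[OF that]] .
  have ex: "\<exists>\<xi>\<in>\<Xi>. minimal_idempotent (group_algebra H) (?e' \<xi>) \<and>
      linked (group_algebra H) (?e' \<xi>) (h (?e \<chi>))" if x: "\<chi> \<in> \<Theta>" for \<chi>
  proof (rule \<Xi>(5)[OF mH[OF x]])
    \<comment> \<open>Equality of the two indices turns the value \<open>1 / |B|\<close> into
      \<open>1 / |C|\<close> for the image idempotent.\<close>
    have "of_nat (card (carrier H)) * h (?e \<chi>) \<one>\<^bsub>H\<^esub> = of_nat (card (carrier G)) * inverse (of_nat (card B))"
      using value_at_one[OF ea[OF x]] G.character_idempotent_one[OF B ch[OF x]] by simp
    moreover have "of_nat (card (carrier G)) * (of_nat (card C) :: complex) = of_nat (card (carrier H)) * of_nat (card B)"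
      using index by (metis of_nat_mult)
    moreover have "of_nat (card B) \<noteq> (0::complex)" using G.card_subgroup_pos[OF B] by simp
    moreover have "of_nat (card (carrier H)) \<noteq> (0::complex)"
      using H.card_subgroup_pos[OF H.subgroup_self] by simp
    ultimately have "of_nat (card (carrier H)) * (of_nat (card C) * h (?e \<chi>) \<one>\<^bsub>H\<^esub>) = of_nat (card (carrier H))"
      by (simp add: mult.left_commute[of _ "of_nat (card C)"]) (simp add: mult.assoc[symmetric] mult.commute)
    then show "of_nat (card C) * h (?e \<chi>) \<one>\<^bsub>H\<^esub> = 1"
      using H.card_subgroup_pos[OF H.subgroup_self] by simp
  qed
  define \<kappa> where "\<kappa> \<chi> = (SOME \<xi>. \<xi> \<in> \<Xi> \<and> minimal_idempotent (group_algebra H) (?e' \<xi>) \<and>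
      linked (group_algebra H) (?e' \<xi>) (h (?e \<chi>)))" for \<chi>
  have \<kappa>: "\<kappa> \<chi> \<in> \<Xi>" "minimal_idempotent (group_algebra H) (?e' (\<kappa> \<chi>))"
      "linked (group_algebra H) (?e' (\<kappa> \<chi>)) (h (?e \<chi>))" if "\<chi> \<in> \<Theta>" for \<chi>
    using someI_ex[of "\<lambda>\<xi>. \<xi> \<in> \<Xi> \<and> minimal_idempotent (group_algebra H) (?e' \<xi>) \<and>
      linked (group_algebra H) (?e' \<xi>) (h (?e \<chi>))"] ex[OF that] unfolding \<kappa>_def by blast+
  have idem: "f \<in> H.alg" "H.conv f f = f" if "minimal_idempotent (group_algebra H) f" for f
    using that by (auto simp: H.minimal_idempotent_iff)
  have minself: "linked (group_algebra H) f f" if "minimal_idempotent (group_algebra H) f" for f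
    unfolding H.linked_iff[OF idem(1)[OF that] idem(1)[OF that]]
    using idem[OF that] that by (intro bexI[of _ f]) (auto simp: H.minimal_idempotent_iff)
  let ?P = "\<lambda>\<chi>. {\<chi>, inverse_character \<chi>}"
  \<comment> \<open>If the pairs agree, then \<open>\<kappa> \<chi>\<close> and
    \<open>\<kappa> \<chi>'\<close> are linked, by equality or by the assumed intertwiner of a
    character with its inverse. Linkage is followed from the image of \<open>\<chi>\<close> through
    \<open>\<kappa> \<chi>\<close> and \<open>\<kappa> \<chi>'\<close> to the image of
    \<open>\<chi>'\<close> and then pulled back to \<open>G\<close>.\<close>
  have pair: "\<chi>' \<in> {\<chi>, inverse_character \<chi>}"
    if x: "\<chi> \<in> \<Theta>" "\<chi>' \<in> \<Theta>" and eq: "?P (\<kappa> \<chi>) = ?P (\<kappa> \<chi>')" for \<chi> \<chi>'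
  proof -
    note m = \<kappa>(2)[OF x(1)] \<kappa>(2)[OF x(2)]
    have "\<kappa> \<chi>' = \<kappa> \<chi> \<or> \<kappa> \<chi>' = inverse_character (\<kappa> \<chi>)" using eq by auto
    then have l: "linked (group_algebra H) (?e' (\<kappa> \<chi>)) (?e' (\<kappa> \<chi>'))"
    proof
      assume "\<kappa> \<chi>' = inverse_character (\<kappa> \<chi>)"
      then show ?thesis
        using \<Xi>(4)[OF \<kappa>(1)[OF x(1)]]
          H.linked_character_idempotents_iff[OF C ch'[OF \<kappa>(1)[OF x(1)]] ch'[OF \<kappa>(1)[OF x(2)]]] by simp
    qed (use minself m in simp)
    have "linked (group_algebra H) (h (?e \<chi>)) (?e' (\<kappa> \<chi>))"
      by (rule H.linked_sym[OF mH[OF x(1)] idem[OF m(1)] \<kappa>(3)[OF x(1)]])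
    then have "linked (group_algebra H) (h (?e \<chi>)) (?e' (\<kappa> \<chi>'))"
      using H.linked_trans[OF m(1) idem[OF mH[OF x(1)]] idem(1)[OF m(2)]] l by blast
    then have "linked (group_algebra H) (h (?e \<chi>)) (h (?e \<chi>'))"
      using H.linked_trans[OF m(2) idem[OF mH[OF x(1)]] idem(1)[OF mH[OF x(2)]]] \<kappa>(3)[OF x(2)] by blast
    then have "linked (group_algebra G) (?e \<chi>) (?e \<chi>')"
      using linked_image_iff[OF ea[OF x(1)] ea[OF x(2)]] by simp
    then obtain g where "g \<in> carrier G" "intertwines G B \<chi> \<chi>' g"
      using G.linked_character_idempotents_iff[OF B ch[OF x(1)] ch[OF x(2)]] by blast
    then show ?thesis using \<Theta>(4)[OF x] by blast
  qed
  have "card \<Theta> \<le> 2 * card ((\<lambda>\<chi>. ?P (\<kappa> \<chi>)) ` \<Theta>)"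
  proof (rule card_le_two_image[OF \<Theta>(1)])
    fix \<chi> assume "\<chi> \<in> \<Theta>"
    then have "{\<chi>' \<in> \<Theta>. ?P (\<kappa> \<chi>') = ?P (\<kappa> \<chi>)} \<subseteq> {\<chi>, inverse_character \<chi>}"
      using pair[of \<chi>] by blast
    then show "\<exists>u v. {\<chi>' \<in> \<Theta>. ?P (\<kappa> \<chi>') = ?P (\<kappa> \<chi>)} \<subseteq> {u, v}" by blast
  qed
  also have "\<dots> \<le> 2 * card (?P ` \<Xi>)"
    using \<kappa>(1) \<Xi>(1) by (intro mult_le_mono2 card_mono) auto
  also have "\<dots> = card \<Xi>" by (rule card_inverse_pairs[OF \<Xi>(1,3)])
  finally show False using less by simp
qed

section \<open>Finite chain rings\<close>

lemma card_eq_mult_fibre: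
  assumes fin: "finite S" and fib: "\<And>y. y \<in> f ` S \<Longrightarrow> card {x \<in> S. f x = y} = k"
  shows "card S = card (f ` S) * k"
proof -
  have "card S = (\<Sum>y\<in>f ` S. card {x \<in> S. f x = y})"
    using sum.image_gen[OF fin, of "\<lambda>_. 1" f] by (simp only: card_eq_sum)
  then show ?thesis using fib by simp
qed

text \<open>A finite local ring whose maximal ideal is generated by \<open>\<pi>\<close>, with exact
  nilpotency index \<open>n\<close>. Both the quotients \<open>\<oo>/\<pp>^n\<close> and their
  unramified quadratic extensions are treated as instances.\<close>

locale chain_ring = cring S for S (structure) +
  fixes \<pi> and n :: nat
  assumes finite_carrier: "finite (carrier S)"
    and pi_closed [simp]: "\<pi> \<in> carrier S"
    and unit_or_multiple: "x \<in> carrier S \<Longrightarrow> x \<in> Units S \<or> (\<exists>y\<in>carrier S. x = \<pi> \<otimes> y)"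
    and pi_pow_n: "\<pi> [^] n = \<zero>"
    and pi_pow_pred: "\<pi> [^] (n - 1) \<noteq> \<zero>"
    and n_pos: "0 < n"
begin

definition pw :: "nat \<Rightarrow> 'a set" where
  "pw i = (\<lambda>y. \<pi> [^] i \<otimes> y) ` carrier S"

lemma pwI: "y \<in> carrier S \<Longrightarrow> \<pi> [^] i \<otimes> y \<in> pw i"
  by (simp add: pw_def)

lemma pwE:
  assumes "x \<in> pw i"
  obtains y where "y \<in> carrier S" "x = \<pi> [^] i \<otimes> y"
  using assms by (auto simp: pw_def)

lemma pw_subset: "pw i \<subseteq> carrier S"
  by (auto simp: pw_def)

lemma pw_closed: "x \<in> pw i \<Longrightarrow> x \<in> carrier S"
  using pw_subset by blast

lemma finite_pw: "finite (pw i)"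
  using finite_carrier by (simp add: pw_def)

lemma pw_zero: "pw 0 = carrier S"
  by (force simp: pw_def image_iff)

lemma pw_n: "n \<le> i \<Longrightarrow> pw i = {\<zero>}"
proof -
  assume "n \<le> i"
  then have "\<pi> [^] i = \<pi> [^] n \<otimes> \<pi> [^] (i - n)" using nat_pow_mult[of \<pi> n "i - n"] by simp
  then have "\<pi> [^] i = \<zero>" using pi_pow_n by simp
  then show ?thesis by (auto simp: pw_def intro!: image_eqI[of _ _ \<zero>])
qed

lemma zero_in_pw: "\<zero> \<in> pw i"
  using pwI[of \<zero> i] by simp

lemma pw_add: "x \<in> pw i \<Longrightarrow> y \<in> pw i \<Longrightarrow> x \<oplus> y \<in> pw i"
proof -
  assume "x \<in> pw i" "y \<in> pw i"
  then obtain a b where "a \<in> carrier S" "b \<in> carrier S" "x = \<pi> [^] i \<otimes> a" "y = \<pi> [^] i \<otimes> b"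
    by (metis pwE)
  then show ?thesis using pwI[of "a \<oplus> b" i] by (simp add: r_distr)
qed

lemma pw_mult: "x \<in> pw i \<Longrightarrow> y \<in> carrier S \<Longrightarrow> x \<otimes> y \<in> pw i"
  "x \<in> pw i \<Longrightarrow> y \<in> carrier S \<Longrightarrow> y \<otimes> x \<in> pw i"
proof -
  assume x: "x \<in> pw i" and y: "y \<in> carrier S"
  obtain a where a: "a \<in> carrier S" "x = \<pi> [^] i \<otimes> a" using x by (rule pwE)
  show "x \<otimes> y \<in> pw i" using pwI[of "a \<otimes> y" i] a y by (simp add: m_assoc)
  then show "y \<otimes> x \<in> pw i" using pw_closed[OF x] y by (simp add: m_comm)
qed

lemma pw_inv: "x \<in> pw i \<Longrightarrow> \<ominus> x \<in> pw i"
  using pw_mult(1)[of x i "\<ominus> \<one>"] pw_closed[of x i] by (simp add: r_minus)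

lemma pw_minus: "x \<in> pw i \<Longrightarrow> y \<in> pw i \<Longrightarrow> x \<ominus> y \<in> pw i"
  unfolding minus_eq using pw_add pw_inv by blast

lemma pw_mono: "i \<le> j \<Longrightarrow> pw j \<subseteq> pw i"
proof
  fix x assume ij: "i \<le> j" and "x \<in> pw j"
  then obtain a where a: "a \<in> carrier S" "x = \<pi> [^] j \<otimes> a" by (auto elim: pwE)
  have "\<pi> [^] j = \<pi> [^] i \<otimes> \<pi> [^] (j - i)" using nat_pow_mult[of \<pi> i "j - i"] ij by simp
  then show "x \<in> pw i" using a pwI[of "\<pi> [^] (j - i) \<otimes> a" i] by (simp add: m_assoc)
qed

lemma pw_mult_pw: "x \<in> pw i \<Longrightarrow> y \<in> pw j \<Longrightarrow> x \<otimes> y \<in> pw (i + j)"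
proof -
  assume "x \<in> pw i" "y \<in> pw j"
  then obtain a b where ab: "a \<in> carrier S" "b \<in> carrier S" "x = \<pi> [^] i \<otimes> a" "y = \<pi> [^] j \<otimes> b"
    by (metis pwE)
  then have "x \<otimes> y = (\<pi> [^] i \<otimes> \<pi> [^] j) \<otimes> (a \<otimes> b)" by (simp add: m_ac)
  then show ?thesis using ab pwI[of "a \<otimes> b" "i + j"] by (simp add: nat_pow_mult)
qed

lemma pw_mult_pw_zero: "x \<in> pw i \<Longrightarrow> y \<in> pw j \<Longrightarrow> n \<le> i + j \<Longrightarrow> x \<otimes> y = \<zero>"
  using pw_mult_pw[of x i y j] pw_n[of "i + j"] by simp

lemma unit_iff: "x \<in> carrier S \<Longrightarrow> x \<in> Units S \<longleftrightarrow> x \<notin> pw 1"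
proof
  assume x: "x \<in> carrier S" and "x \<in> Units S"
  show "x \<notin> pw 1"
  proof
    assume "x \<in> pw 1"
    then obtain y where y: "y \<in> carrier S" "x = \<pi> \<otimes> y" by (auto elim: pwE)
    have "\<pi> [^] (n - 1) = \<pi> [^] (n - 1) \<otimes> x \<otimes> inv x"
      using \<open>x \<in> Units S\<close> x by (simp add: m_assoc)
    also have "\<pi> [^] (n - 1) \<otimes> x = (\<pi> [^] (n - 1) \<otimes> \<pi>) \<otimes> y" using y by (simp add: m_assoc)
    also have "\<pi> [^] (n - 1) \<otimes> \<pi> = \<zero>"
      using pi_pow_n n_pos nat_pow_Suc[of \<pi> "n - 1"] by simp
    finally show False using pi_pow_pred y \<open>x \<in> Units S\<close> by simp
  qed
next
  assume "x \<in> carrier S" "x \<notin> pw 1"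
  then show "x \<in> Units S" using unit_or_multiple[of x] pwI[of _ 1] by auto
qed

lemma unit_add_pw:
  assumes "u \<in> Units S" "x \<in> pw 1"
  shows "u \<oplus> x \<in> Units S"
proof -
  have c: "u \<in> carrier S" "x \<in> carrier S" using assms pw_closed by auto
  have "u \<oplus> x \<notin> pw 1"
  proof
    assume "u \<oplus> x \<in> pw 1"
    then have "u \<oplus> x \<ominus> x \<in> pw 1" using pw_minus assms(2) by blast
    moreover have "u \<oplus> x \<ominus> x = u" using c by algebra
    ultimately show False using unit_iff[OF c(1)] assms(1) by simp
  qed
  then show ?thesis using unit_iff c by simp
qed

text \<open>A factor \<open>\<pi>\<close> is split off repeatedly until a unit remains, which must
  happen before step \<open>k\<close>.\<close>

lemma valuation:
  assumes x: "x \<in> carrier S" "x \<notin> pw k"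
  obtains i u where "i < k" "u \<in> Units S" "x = \<pi> [^] i \<otimes> u"
proof -
  have "x \<in> pw k \<or> (\<exists>i<k. \<exists>u\<in>Units S. x = \<pi> [^] i \<otimes> u)"
  proof (induction k)
    case 0
    then show ?case using x by (simp add: pw_zero)
  next
    case (Suc k)
    then show ?case
    proof
      assume "x \<in> pw k"
      then obtain y where y: "y \<in> carrier S" "x = \<pi> [^] k \<otimes> y" by (rule pwE)
      show ?thesis
      proof (cases "y \<in> Units S")
        case False
        then obtain z where z: "z \<in> carrier S" "y = \<pi> \<otimes> z" using unit_or_multiple[OF y(1)] by blast
        then have "x = \<pi> [^] Suc k \<otimes> z" using y by (simp add: m_assoc)
        then show ?thesis using pwI[OF z(1)] by blast
      qed (use y in blast)
    qed (use less_SucI in blast)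
  qed
  then show thesis using x(2) that by blast
qed

text \<open>If \<open>\<pi>^i u = \<pi>^(i+1) y\<close>, the unit \<open>u - \<pi> y\<close>
  annihilates \<open>\<pi>^i\<close>, contrary to \<open>\<pi>^(n-1) \<noteq> 0\<close>. Valuations
  below \<open>n\<close> are therefore well defined.\<close>

lemma pi_pow_unit_in_pw_iff:
  assumes "u \<in> Units S" "i < n"
  shows "\<pi> [^] i \<otimes> u \<in> pw k \<longleftrightarrow> k \<le> i"
proof
  have uc: "u \<in> carrier S" using Units_closed[OF assms(1)] .
  show "\<pi> [^] i \<otimes> u \<in> pw k" if "k \<le> i"
    using pwI[OF uc, of i] pw_mono[OF that] by blast
  show "k \<le> i" if "\<pi> [^] i \<otimes> u \<in> pw k"
  proof (rule ccontr)
    assume "\<not> k \<le> i"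
    then have "\<pi> [^] i \<otimes> u \<in> pw (Suc i)" using that pw_mono[of "Suc i" k] by auto
    then obtain y where y: "y \<in> carrier S" "\<pi> [^] i \<otimes> u = \<pi> [^] Suc i \<otimes> y" by (rule pwE)
    have v: "u \<ominus> \<pi> \<otimes> y \<in> Units S"
      using unit_add_pw[OF assms(1) pw_inv, of "\<pi> \<otimes> y"] pwI[OF y(1), of 1] by (simp add: minus_eq)
    have "\<pi> [^] i \<otimes> (u \<ominus> \<pi> \<otimes> y) = \<pi> [^] i \<otimes> u \<ominus> \<pi> [^] Suc i \<otimes> y"
      using y(1) uc by (simp add: minus_eq r_distr r_minus m_assoc)
    also have "\<dots> = \<zero>" using y uc by (simp add: minus_eq r_neg)
    finally have "\<pi> [^] i \<otimes> (u \<ominus> \<pi> \<otimes> y) \<otimes> inv (u \<ominus> \<pi> \<otimes> y) = \<zero>" using v by simp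
    then have "\<pi> [^] i = \<zero>" using v y(1) uc by (simp add: m_assoc Units_r_inv)
    then have "\<pi> [^] i \<otimes> \<pi> [^] (n - 1 - i) = \<zero>" by simp
    then show False using pi_pow_pred assms(2) nat_pow_mult[of \<pi> i "n - 1 - i"] by simp
  qed
qed

lemma pi_pow_mult_eq_zero_iff:
  assumes x: "x \<in> carrier S" and "i \<le> n"
  shows "\<pi> [^] i \<otimes> x = \<zero> \<longleftrightarrow> x \<in> pw (n - i)"
proof
  assume "x \<in> pw (n - i)"
  then show "\<pi> [^] i \<otimes> x = \<zero>"
    using pw_mult_pw_zero[of "\<pi> [^] i" i x "n - i"] pwI[OF one_closed, of i] assms by simp
next
  assume z: "\<pi> [^] i \<otimes> x = \<zero>"
  show "x \<in> pw (n - i)"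
  proof (rule ccontr)
    assume "x \<notin> pw (n - i)"
    then obtain j u where u: "j < n - i" "u \<in> Units S" "x = \<pi> [^] j \<otimes> u"
      using valuation[OF x] by blast
    then have "\<pi> [^] (i + j) \<otimes> u = \<zero>"
      using z Units_closed[OF u(2)] by (simp add: m_assoc[symmetric] nat_pow_mult)
    then have "\<pi> [^] (i + j) \<otimes> u \<in> pw n" by (simp add: zero_in_pw)
    then show False using pi_pow_unit_in_pw_iff[OF u(2), of "i + j" n] u(1) by simp
  qed
qed

text \<open>The order of the socle. Multiplication by \<open>\<pi>^(n-1)\<close> identifies the
  residue field with the socle, so this is the residue field order expressed inside the
  ring.\<close>

definition q :: nat where "q = card (pw (n - 1))"

text \<open>Multiplication by \<open>\<pi>^(n-1-i)\<close> maps \<open>pw i\<close> onto the socle,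
  and its kernel is \<open>pw (Suc i)\<close>.\<close>

lemma card_pw_step: "i < n \<Longrightarrow> card (pw i) = card (pw (Suc i)) * q"
proof -
  assume i: "i < n"
  let ?f = "\<lambda>x. \<pi> [^] (n - 1 - i) \<otimes> x"
  have img: "?f ` pw i = pw (n - 1)"
  proof -
    have "\<pi> [^] (n - 1 - i) \<otimes> (\<pi> [^] i \<otimes> y) = \<pi> [^] (n - 1) \<otimes> y" if "y \<in> carrier S" for y
      using that i by (simp add: m_assoc[symmetric] nat_pow_mult)
    then show ?thesis by (auto simp: pw_def image_image cong: image_cong)
  qed
  have "card (pw i) = card (?f ` pw i) * card (pw (Suc i))"
  proof (rule card_eq_mult_fibre[OF finite_pw])
    fix y assume "y \<in> ?f ` pw i"
    then obtain x where x: "x \<in> pw i" "y = ?f x" by blast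
    have xc: "x \<in> carrier S" using pw_closed[OF x(1)] .
    have "{x' \<in> pw i. ?f x' = y} = (\<lambda>z. x \<oplus> z) ` pw (Suc i)"
    proof (intro equalityI subsetI)
      fix x' assume "x' \<in> {x' \<in> pw i. ?f x' = y}"
      then have x': "x' \<in> pw i" "?f x' = ?f x" using x by auto
      have x'c: "x' \<in> carrier S" using pw_closed[OF x'(1)] .
      have "?f (x' \<ominus> x) = ?f x' \<ominus> ?f x" using xc x'c by (simp add: minus_eq r_distr r_minus)
      also have "\<dots> = \<zero>" using x' xc by (simp add: minus_eq r_neg)
      finally have "x' \<ominus> x \<in> pw (n - (n - 1 - i))"
        using pi_pow_mult_eq_zero_iff[of "x' \<ominus> x" "n - 1 - i"] xc x'c by simp
      then have "x' \<ominus> x \<in> pw (Suc i)" using i by simp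
      moreover have "x' = x \<oplus> (x' \<ominus> x)" using xc x'c by algebra
      ultimately show "x' \<in> (\<lambda>z. x \<oplus> z) ` pw (Suc i)" by blast
    next
      fix x' assume "x' \<in> (\<lambda>z. x \<oplus> z) ` pw (Suc i)"
      then obtain z where z: "z \<in> pw (Suc i)" "x' = x \<oplus> z" by blast
      have zc: "z \<in> carrier S" using pw_closed[OF z(1)] .
      have "?f z = \<zero>" using pi_pow_mult_eq_zero_iff[of z "n - 1 - i"] z(1) zc i by simp
      then have "?f x' = y" using z(2) x(2) xc zc by (simp add: r_distr)
      moreover have "x' \<in> pw i" using z x(1) pw_mono[of i "Suc i"] pw_add by auto
      ultimately show "x' \<in> {x' \<in> pw i. ?f x' = y}" by simp
    qed
    moreover have "inj_on (\<lambda>z. x \<oplus> z) (pw (Suc i))"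
      using xc pw_closed by (auto simp: inj_on_def)
    ultimately show "card {x' \<in> pw i. ?f x' = y} = card (pw (Suc i))" by (simp add: card_image)
  qed
  then show ?thesis by (simp only: img q_def mult.commute)
qed

lemma card_pw: "i \<le> n \<Longrightarrow> card (pw i) = q ^ (n - i)"
proof (induction "n - i" arbitrary: i)
  case 0
  then show ?case using pw_n[of i] by simp
next
  case (Suc k)
  then have "card (pw (Suc i)) = q ^ (n - Suc i)" by simp
  moreover have "n - i = Suc (n - Suc i)" using Suc by simp
  ultimately show ?case using card_pw_step[of i] Suc by simp
qed

lemma card_carrier: "card (carrier S) = q ^ n"
  using card_pw[of 0] pw_zero by simp

lemma q_gt_1: "1 < q"
proof -
  have "{\<zero>, \<pi> [^] (n - 1)} \<subseteq> pw (n - 1)" using zero_in_pw pwI[OF one_closed, of "n - 1"] by simp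
  then have "card {\<zero>, \<pi> [^] (n - 1)} \<le> q" unfolding q_def using finite_pw card_mono by blast
  then show ?thesis using pi_pow_pred by (simp add: card_insert_if)
qed

lemma card_Units: "card (Units S) = q ^ n - q ^ (n - 1)"
proof -
  have "Units S = carrier S - pw 1" using unit_iff by auto
  then have "card (Units S) = card (carrier S) - card (pw 1)"
    using card_Diff_subset[OF finite_pw pw_subset] by simp
  then show ?thesis using card_carrier card_pw[of 1] n_pos by simp
qed

text \<open>The element \<open>\<pi>^(n-1)\<close> of the socle has additive order 2, so Lagrange's
  theorem applies.\<close>

lemma even_q:
  assumes "\<one> \<oplus> \<one> \<in> pw 1"
  shows "even q"
proof -
  have P: "subgroup (pw (n - 1)) (add_monoid S)"
  proof (rule add.subgroupI)
    show "pw (n - 1) \<noteq> {}" using zero_in_pw by blast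
  qed (use pw_subset pw_add pw_inv in \<open>auto simp: a_inv_def\<close>)
  define A where "A = (add_monoid S)\<lparr>carrier := pw (n - 1)\<rparr>"
  interpret A: group A unfolding A_def
    using add.subgroup_imp_group[OF P] .
  let ?p = "\<pi> [^] (n - 1)"
  have p: "?p \<in> carrier A" using pwI[OF one_closed, of "n - 1"] by (simp add: A_def)
  have "?p \<oplus> ?p = ?p \<otimes> (\<one> \<oplus> \<one>)" by (simp add: r_distr)
  also have "\<dots> = \<zero>" using pi_pow_mult_eq_zero_iff[of "\<one> \<oplus> \<one>" "n - 1"] assms n_pos by simp
  finally have "?p \<otimes>\<^bsub>A\<^esub> ?p = \<one>\<^bsub>A\<^esub>" by (simp add: A_def)
  then have "?p [^]\<^bsub>A\<^esub> (2::nat) = \<one>\<^bsub>A\<^esub>" using p by (simp add: numeral_2_eq_2)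
  then have "A.ord ?p dvd 2" using A.pow_eq_id[OF p] by simp
  moreover have "A.ord ?p \<noteq> 1" using A.ord_eq_1[OF p] pi_pow_pred by (simp add: A_def)
  ultimately have "A.ord ?p = 2" using two_is_prime_nat by (metis prime_nat_iff)
  then show ?thesis using A.ord_dvd_group_order[OF p] by (simp add: A_def order_def q_def)
qed

end

section \<open>A unitary group over an unramified quadratic extension\<close>

text \<open>The pair \<open>(x, z)\<close> stands for the matrix with rows \<open>(x, z)\<close> and \<open>(\<sigma> z, \<sigma> x)\<close>.\<close>

definition SU :: "('a, 'm) ring_scheme \<Rightarrow> ('a \<Rightarrow> 'a) \<Rightarrow> ('a \<times> 'a) monoid" where
  "SU E \<sigma> = \<lparr>
     carrier = {(x, z). x \<in> carrier E \<and> z \<in> carrier E \<and> x \<otimes>\<^bsub>E\<^esub> \<sigma> x \<ominus>\<^bsub>E\<^esub> z \<otimes>\<^bsub>E\<^esub> \<sigma> z = \<one>\<^bsub>E\<^esub>},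
     monoid.mult = (\<lambda>(x, z) (x', z').
       (x \<otimes>\<^bsub>E\<^esub> x' \<oplus>\<^bsub>E\<^esub> z \<otimes>\<^bsub>E\<^esub> \<sigma> z', x \<otimes>\<^bsub>E\<^esub> z' \<oplus>\<^bsub>E\<^esub> z \<otimes>\<^bsub>E\<^esub> \<sigma> x')),
     one = (\<one>\<^bsub>E\<^esub>, \<zero>\<^bsub>E\<^esub>)\<rparr>"

text \<open>\<open>\<kappa>\<close> is the order of the residue field of the fixed ring of \<open>\<sigma>\<close>; the two cardinalities are
  all that is used about that ring.\<close>

locale unramified_ring = chain_ring E \<pi> n for E (structure) and \<pi> n +
  fixes \<sigma> :: "'a \<Rightarrow> 'a" and \<omega> and r \<kappa> :: nat
  assumes conj_hom: "\<sigma> \<in> ring_hom E E"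
    and conj_conj [simp]: "x \<in> carrier E \<Longrightarrow> \<sigma> (\<sigma> x) = x"
    and conj_pi [simp]: "\<sigma> \<pi> = \<pi>"
    and omega_closed [simp]: "\<omega> \<in> carrier E"
    and trace_omega: "\<omega> \<oplus> \<sigma> \<omega> = \<one>"
    and n_eq: "n = 2 * r"
    and residue_char: "\<one> \<oplus> \<one> \<in> pw 1"
    and q_eq: "q = \<kappa> ^ 2"
    and card_fixed_units: "card {x \<in> Units E. \<sigma> x = x} = \<kappa> ^ n - \<kappa> ^ (n - 1)"
    and card_fixed_socle: "card {x \<in> pw (n - 1). \<sigma> x = x} = \<kappa>"
begin

declare Units_closed [simp]

sublocale conj: ring_hom_cring E E \<sigma>
  using conj_hom by unfold_locales

lemma r_pos: "0 < r" using n_pos n_eq by simp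

lemma kappa_gt_1: "1 < \<kappa>" using q_gt_1 q_eq by (cases "\<kappa> \<le> 1") (auto simp: le_Suc_eq)

lemma even_kappa: "even \<kappa>" using even_q[OF residue_char] q_eq by simp

lemma conj_pw: "x \<in> pw i \<Longrightarrow> \<sigma> x \<in> pw i"
  using pwI by (auto elim!: pwE)

lemma conj_unit: "x \<in> Units E \<Longrightarrow> \<sigma> x \<in> Units E"
proof -
  assume x: "x \<in> Units E"
  have xc: "x \<in> carrier E" using Units_closed[OF x] .
  have "x \<in> pw 1" if "\<sigma> x \<in> pw 1" using conj_pw[OF that] xc by simp
  then show ?thesis using x xc unit_iff by auto
qed

lemma pw_r_prod: "x \<in> pw r \<Longrightarrow> y \<in> pw r \<Longrightarrow> x \<otimes> y = \<zero>"
  using pw_mult_pw_zero n_eq by simp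

abbreviation \<Gamma> where "\<Gamma> \<equiv> SU E \<sigma>"

lemma SU_mult: "(x, z) \<otimes>\<^bsub>\<Gamma>\<^esub> (x', z') = (x \<otimes> x' \<oplus> z \<otimes> \<sigma> z', x \<otimes> z' \<oplus> z \<otimes> \<sigma> x')"
  and SU_one: "\<one>\<^bsub>\<Gamma>\<^esub> = (\<one>, \<zero>)"
  and SU_carrier: "(x, z) \<in> carrier \<Gamma> \<longleftrightarrow>
    x \<in> carrier E \<and> z \<in> carrier E \<and> x \<otimes> \<sigma> x \<ominus> z \<otimes> \<sigma> z = \<one>"
  by (simp_all add: SU_def)

lemma SU_inverse_left:
  assumes "(x, z) \<in> carrier \<Gamma>"
  shows "(\<sigma> x, \<ominus> z) \<in> carrier \<Gamma>" "(\<sigma> x, \<ominus> z) \<otimes>\<^bsub>\<Gamma>\<^esub> (x, z) = \<one>\<^bsub>\<Gamma>\<^esub>"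
proof -
  have c: "x \<in> carrier E" "z \<in> carrier E" "\<sigma> x \<in> carrier E" "\<sigma> z \<in> carrier E"
    and d: "x \<otimes> \<sigma> x \<ominus> z \<otimes> \<sigma> z = \<one>" using assms by (auto simp: SU_carrier)
  have "\<sigma> x \<otimes> x \<ominus> \<ominus> z \<otimes> (\<ominus> \<sigma> z) = x \<otimes> \<sigma> x \<ominus> z \<otimes> \<sigma> z" using c by algebra
  then show "(\<sigma> x, \<ominus> z) \<in> carrier \<Gamma>" using c d by (simp add: SU_carrier)
  have "\<sigma> x \<otimes> x \<oplus> (\<ominus> z) \<otimes> \<sigma> z = x \<otimes> \<sigma> x \<ominus> z \<otimes> \<sigma> z" "\<sigma> x \<otimes> z \<oplus> (\<ominus> z) \<otimes> \<sigma> x = \<zero>"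
    using c by algebra+
  then show "(\<sigma> x, \<ominus> z) \<otimes>\<^bsub>\<Gamma>\<^esub> (x, z) = \<one>\<^bsub>\<Gamma>\<^esub>" using d by (simp add: SU_mult SU_one)
qed

sublocale SU: finite_group \<Gamma>
proof -
  have "group \<Gamma>"
  proof (rule groupI)
    fix g h assume g: "g \<in> carrier \<Gamma>" and h: "h \<in> carrier \<Gamma>"
    obtain x z x' z' where gh: "g = (x, z)" "h = (x', z')" by (metis surj_pair)
    have c: "x \<in> carrier E" "z \<in> carrier E" "\<sigma> x \<in> carrier E" "\<sigma> z \<in> carrier E"
      "x' \<in> carrier E" "z' \<in> carrier E" "\<sigma> x' \<in> carrier E" "\<sigma> z' \<in> carrier E"
      and d: "x \<otimes> \<sigma> x \<ominus> z \<otimes> \<sigma> z = \<one>" "x' \<otimes> \<sigma> x' \<ominus> z' \<otimes> \<sigma> z' = \<one>"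
      using g h by (auto simp: gh SU_carrier)
    have "(x \<otimes> x' \<oplus> z \<otimes> \<sigma> z') \<otimes> (\<sigma> x \<otimes> \<sigma> x' \<oplus> \<sigma> z \<otimes> z') \<ominus> (x \<otimes> z' \<oplus> z \<otimes> \<sigma> x') \<otimes> (\<sigma> x \<otimes> \<sigma> z' \<oplus> \<sigma> z \<otimes> x')
      = (x \<otimes> \<sigma> x \<ominus> z \<otimes> \<sigma> z) \<otimes> (x' \<otimes> \<sigma> x' \<ominus> z' \<otimes> \<sigma> z')"
      using c by algebra
    then show "g \<otimes>\<^bsub>\<Gamma>\<^esub> h \<in> carrier \<Gamma>" using c d by (simp add: gh SU_mult SU_carrier)
  next
    show "\<one>\<^bsub>\<Gamma>\<^esub> \<in> carrier \<Gamma>" by (simp add: SU_one SU_carrier minus_eq)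
  next
    fix g h k assume ghk: "g \<in> carrier \<Gamma>" "h \<in> carrier \<Gamma>" "k \<in> carrier \<Gamma>"
    obtain x z x' z' y w where e: "g = (x, z)" "h = (x', z')" "k = (y, w)" by (metis surj_pair)
    have c: "x \<in> carrier E" "z \<in> carrier E" "x' \<in> carrier E" "z' \<in> carrier E" "\<sigma> x' \<in> carrier E" "\<sigma> z' \<in> carrier E"
      "y \<in> carrier E" "w \<in> carrier E" "\<sigma> y \<in> carrier E" "\<sigma> w \<in> carrier E"
      using ghk by (auto simp: e SU_carrier)
    have 1: "(x \<otimes> x' \<oplus> z \<otimes> \<sigma> z') \<otimes> y \<oplus> (x \<otimes> z' \<oplus> z \<otimes> \<sigma> x') \<otimes> \<sigma> w
      = x \<otimes> (x' \<otimes> y \<oplus> z' \<otimes> \<sigma> w) \<oplus> z \<otimes> (\<sigma> x' \<otimes> \<sigma> w \<oplus> \<sigma> z' \<otimes> y)"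
      using c by algebra
    have 2: "(x \<otimes> x' \<oplus> z \<otimes> \<sigma> z') \<otimes> w \<oplus> (x \<otimes> z' \<oplus> z \<otimes> \<sigma> x') \<otimes> \<sigma> y
      = x \<otimes> (x' \<otimes> w \<oplus> z' \<otimes> \<sigma> y) \<oplus> z \<otimes> (\<sigma> x' \<otimes> \<sigma> y \<oplus> \<sigma> z' \<otimes> w)"
      using c by algebra
    show "g \<otimes>\<^bsub>\<Gamma>\<^esub> h \<otimes>\<^bsub>\<Gamma>\<^esub> k = g \<otimes>\<^bsub>\<Gamma>\<^esub> (h \<otimes>\<^bsub>\<Gamma>\<^esub> k)"
      using 1 2 c by (simp add: e SU_mult)
  next
    fix g assume "g \<in> carrier \<Gamma>"
    then show "\<one>\<^bsub>\<Gamma>\<^esub> \<otimes>\<^bsub>\<Gamma>\<^esub> g = g" by (cases g) (auto simp: SU_one SU_mult SU_carrier)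
  next
    fix g assume "g \<in> carrier \<Gamma>"
    then show "\<exists>h\<in>carrier \<Gamma>. h \<otimes>\<^bsub>\<Gamma>\<^esub> g = \<one>\<^bsub>\<Gamma>\<^esub>" using SU_inverse_left by (cases g) blast
  qed
  moreover have "carrier \<Gamma> \<subseteq> carrier E \<times> carrier E" by (auto simp: SU_carrier)
  then have "finite (carrier \<Gamma>)" using finite_carrier finite_subset by blast
  ultimately show "finite_group \<Gamma>" by (simp add: finite_group_def finite_group_axioms_def)
qed

lemma SU_inv: "(x, z) \<in> carrier \<Gamma> \<Longrightarrow> inv\<^bsub>\<Gamma>\<^esub> (x, z) = (\<sigma> x, \<ominus> z)"
  using SU_inverse_left by (intro SU.inv_equality) auto

section \<open>The norm one torus\<close>

definition T :: "'a set" where "T = {x \<in> carrier E. x \<otimes> \<sigma> x = \<one>}"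

abbreviation TG where "TG \<equiv> (units_of E)\<lparr>carrier := T\<rparr>"

lemma T_closed: "x \<in> T \<Longrightarrow> x \<in> carrier E" and T_norm: "x \<in> T \<Longrightarrow> x \<otimes> \<sigma> x = \<one>"
  by (auto simp: T_def)

lemma T_unit: "x \<in> T \<Longrightarrow> x \<in> Units E"
  unfolding T_def Units_def using m_comm[of x "\<sigma> x"] by auto

lemma T_subgroup: "subgroup T (units_of E)"
proof -
  interpret U: comm_group "units_of E" by (rule units_comm_group)
  show ?thesis
  proof (rule U.subgroupI)
    show "T \<subseteq> carrier (units_of E)" using T_unit by (auto simp: units_of_def)
    show "T \<noteq> {}" by (auto simp: T_def intro!: exI[of _ \<one>])
    fix x assume x: "x \<in> T"
    have "inv\<^bsub>units_of E\<^esub> x = \<sigma> x"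
    proof (rule U.inv_equality)
      show "\<sigma> x \<otimes>\<^bsub>units_of E\<^esub> x = \<one>\<^bsub>units_of E\<^esub>"
        using T_norm[OF x] T_closed[OF x] by (simp add: units_of_def m_comm)
    qed (use T_unit[OF x] conj_unit in \<open>auto simp: units_of_def\<close>)
    then show "inv\<^bsub>units_of E\<^esub> x \<in> T" using x by (auto simp: T_def m_comm)
    fix y assume y: "y \<in> T"
    have c: "x \<in> carrier E" "y \<in> carrier E" "\<sigma> x \<in> carrier E" "\<sigma> y \<in> carrier E"
      using x y by (auto simp: T_def)
    have "(x \<otimes> y) \<otimes> (\<sigma> x \<otimes> \<sigma> y) = (x \<otimes> \<sigma> x) \<otimes> (y \<otimes> \<sigma> y)" using c by algebra
    then show "x \<otimes>\<^bsub>units_of E\<^esub> y \<in> T" using c T_norm[OF x] T_norm[OF y] by (simp add: T_def units_of_def)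
  qed
qed

sublocale TG: comm_group TG
proof -
  interpret U: comm_group "units_of E" by (rule units_comm_group)
  show "comm_group TG" using U.subgroup_imp_group[OF T_subgroup] U.m_comm subgroup.subset[OF T_subgroup]
    by (intro group.group_comm_groupI) auto
qed

lemma TG_simps [simp]: "carrier TG = T" "x \<otimes>\<^bsub>units_of E\<^esub> y = x \<otimes> y" "\<one>\<^bsub>units_of E\<^esub> = \<one>"
  by (simp_all add: units_of_def)

lemma TG_inv: assumes x: "x \<in> T" shows "inv\<^bsub>TG\<^esub> x = \<sigma> x"
proof (rule TG.inv_equality)
  have c: "x \<in> carrier E" "x \<otimes> \<sigma> x = \<one>" using x by (auto simp: T_def)
  then show "\<sigma> x \<otimes>\<^bsub>TG\<^esub> x = \<one>\<^bsub>TG\<^esub>" by (simp add: m_comm)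
  show "\<sigma> x \<in> carrier TG" using c by (simp add: T_def m_comm)
qed (use x in simp)

lemma finite_T: "finite T"
  using finite_carrier by (simp add: T_def)

lemma T_mult: "x \<in> T \<Longrightarrow> y \<in> T \<Longrightarrow> x \<otimes> y \<in> T" and T_conj: "x \<in> T \<Longrightarrow> \<sigma> x \<in> T" and T_one: "\<one> \<in> T"
  using TG.m_closed[of x y] TG.inv_closed[of x] TG.one_closed TG_inv[of x] by auto

text \<open>Hilbert 90: the map \<open>y \<mapsto> y / \<sigma> y\<close> from the units to \<open>T\<close> is surjective.\<close>

lemma hilbert_90:
  assumes x: "x \<in> T"
  obtains y where "y \<in> Units E" "y = x \<otimes> \<sigma> y"
proof -
  have xc: "x \<in> carrier E" "\<sigma> x \<in> carrier E" using T_closed[OF x] by auto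
  \<comment> \<open>Every \<open>u + x \<sigma>(u)\<close> satisfies the required equation because
    \<open>x \<sigma>(x) = 1\<close>; only a choice of \<open>u\<close> that gives a unit is
    missing.\<close>
  have gen: "u \<oplus> x \<otimes> \<sigma> u = x \<otimes> \<sigma> (u \<oplus> x \<otimes> \<sigma> u)" if u: "u \<in> carrier E" for u
  proof -
    have uc: "\<sigma> u \<in> carrier E" using u by simp
    have "x \<otimes> (\<sigma> u \<oplus> \<sigma> x \<otimes> u) = x \<otimes> \<sigma> u \<oplus> (x \<otimes> \<sigma> x) \<otimes> u" using xc u uc by algebra
    then show ?thesis using xc u uc T_norm[OF x] by (simp add: a_comm)
  qed
  show thesis
  proof (cases "\<one> \<oplus> x \<in> Units E")
    case True
    then show ?thesis using that[of "\<one> \<oplus> x"] gen[of \<one>] xc by simp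
  next
    case False
    have sc: "\<sigma> \<omega> \<in> carrier E" by simp
    have p: "\<one> \<oplus> x \<in> pw 1" using False unit_iff xc by simp
    \<comment> \<open>In this case \<open>x\<close> is -1 modulo \<open>\<pi>\<close>, and -1 is 1
      there, so \<open>\<omega> + x \<sigma>(\<omega>)\<close> is congruent to the trace of
      \<open>\<omega>\<close>, which is 1.\<close>
    have "\<omega> \<oplus> x \<otimes> \<sigma> \<omega> = (\<omega> \<oplus> \<sigma> \<omega>) \<oplus> (\<sigma> \<omega> \<otimes> (\<one> \<oplus> x) \<ominus> (\<one> \<oplus> \<one>) \<otimes> \<sigma> \<omega>)"
      using xc sc omega_closed by algebra
    moreover have "\<sigma> \<omega> \<otimes> (\<one> \<oplus> x) \<ominus> (\<one> \<oplus> \<one>) \<otimes> \<sigma> \<omega> \<in> pw 1"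
      using p residue_char pw_mult sc by (intro pw_minus) auto
    ultimately have "\<omega> \<oplus> x \<otimes> \<sigma> \<omega> \<in> Units E"
      using unit_add_pw[OF Units_one_closed] by (simp add: trace_omega)
    then show ?thesis using that gen[of \<omega>] by simp
  qed
qed

text \<open>The fibres of the Hilbert 90 map \<open>y \<mapsto> y / \<sigma> y\<close> are cosets of
  the group of \<open>\<sigma>\<close>-fixed units, so the order is the quotient of
  \<open>\<kappa>^(2n) - \<kappa>^(2n-2)\<close> by
  \<open>\<kappa>^n - \<kappa>^(n-1)\<close>.\<close>

lemma card_T: "card T = \<kappa> ^ (n - 1) * (\<kappa> + 1)"
proof -
  let ?F = "{x \<in> Units E. \<sigma> x = x}"
  let ?f = "\<lambda>y. y \<otimes> inv (\<sigma> y)"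
  have fT: "?f y \<in> T" if "y \<in> Units E" for y
  proof -
    have s: "\<sigma> y \<in> Units E" using conj_unit[OF that] .
    have c: "y \<in> carrier E" "\<sigma> y \<in> carrier E" "inv y \<in> carrier E" "inv (\<sigma> y) \<in> carrier E"
      using that s by auto
    have "\<sigma> (inv (\<sigma> y)) \<otimes> y = \<sigma> (inv (\<sigma> y) \<otimes> \<sigma> y)" using c by simp
    then have "\<sigma> (inv (\<sigma> y)) \<otimes> y = \<one>" using s by simp
    then have "\<sigma> (inv (\<sigma> y)) = inv y" using c comm_inv_char[of y "\<sigma> (inv (\<sigma> y))"] by (simp add: m_comm)
    then have "?f y \<otimes> \<sigma> (?f y) = (y \<otimes> inv y) \<otimes> (\<sigma> y \<otimes> inv (\<sigma> y))"
      using c by (simp add: m_ac)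
    then show ?thesis using that s c by (simp add: T_def)
  qed
  have img: "?f ` Units E = T"
  proof (intro equalityI subsetI)
    fix x assume x: "x \<in> T"
    then obtain y where y: "y \<in> Units E" "y = x \<otimes> \<sigma> y" by (rule hilbert_90)
    have "(x \<otimes> \<sigma> y) \<otimes> inv (\<sigma> y) = x" using conj_unit[OF y(1)] T_closed[OF x] by (simp add: m_assoc)
    then have "x = ?f y" unfolding y(2)[symmetric] by (rule sym)
    then show "x \<in> ?f ` Units E" using y(1) by (rule image_eqI)
  qed (use fT in auto)
  have "card (Units E) = card (?f ` Units E) * card ?F"
  proof (rule card_eq_mult_fibre)
    show "finite (Units E)" by (rule finite_subset[OF _ finite_carrier]) auto
    fix x assume "x \<in> ?f ` Units E"
    then obtain y where y: "y \<in> Units E" "x = ?f y" by blast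
    have sy: "\<sigma> y \<in> Units E" using conj_unit[OF y(1)] .
    have yc: "y \<in> carrier E" "\<sigma> y \<in> carrier E" using y(1) by auto
    have "{y' \<in> Units E. ?f y' = x} = (\<lambda>v. y \<otimes> v) ` ?F"
    proof (intro equalityI subsetI)
      fix y' assume "y' \<in> {y' \<in> Units E. ?f y' = x}"
      then have y': "y' \<in> Units E" "?f y' = ?f y" using y(2) by auto
      have sy': "\<sigma> y' \<in> Units E" using conj_unit[OF y'(1)] .
      have c: "y' \<in> carrier E" "\<sigma> y' \<in> carrier E" "inv (\<sigma> y) \<in> carrier E" "inv (\<sigma> y') \<in> carrier E" "inv y \<in> carrier E"
        using y' sy sy' y(1) by auto
      have "y' \<otimes> \<sigma> y = (?f y' \<otimes> \<sigma> y') \<otimes> \<sigma> y" using sy' c yc by (simp add: m_assoc)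
      also have "\<dots> = (y \<otimes> (inv (\<sigma> y) \<otimes> \<sigma> y)) \<otimes> \<sigma> y'" unfolding y'(2) using c yc by algebra
      finally have e: "y' \<otimes> \<sigma> y = y \<otimes> \<sigma> y'" using sy yc c by simp
      define v where "v = inv y \<otimes> y'"
      have v: "v \<in> Units E" using y(1) y'(1) by (simp add: v_def)
      have vc: "v \<in> carrier E" "\<sigma> v \<in> carrier E" using v by auto
      have yv: "y' = y \<otimes> v" using y(1) c yc by (simp add: v_def m_assoc[symmetric])
      have "(y \<otimes> \<sigma> y) \<otimes> v = (y \<otimes> \<sigma> y) \<otimes> \<sigma> v"
        using e yc vc by (simp add: yv m_ac)
      then have "\<sigma> v = v" using Units_l_cancel[of "y \<otimes> \<sigma> y" v "\<sigma> v"] y(1) sy vc by simp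
      then show "y' \<in> (\<lambda>v. y \<otimes> v) ` ?F" using v yv by blast
    next
      fix y' assume "y' \<in> (\<lambda>v. y \<otimes> v) ` ?F"
      then obtain v where v: "v \<in> Units E" "\<sigma> v = v" "y' = y \<otimes> v" by blast
      have vc: "v \<in> carrier E" "inv v \<in> carrier E" "inv (\<sigma> y) \<in> carrier E" using v sy by auto
      have "?f y' = (y \<otimes> v) \<otimes> inv (\<sigma> y \<otimes> v)" using v yc vc by simp
      also have "inv (\<sigma> y \<otimes> v) = inv v \<otimes> inv (\<sigma> y)"
      proof -
        have "(inv v \<otimes> inv (\<sigma> y)) \<otimes> (\<sigma> y \<otimes> v) = inv v \<otimes> (inv (\<sigma> y) \<otimes> \<sigma> y) \<otimes> v"
          using vc yc by (simp add: m_assoc)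
        then have "(inv v \<otimes> inv (\<sigma> y)) \<otimes> (\<sigma> y \<otimes> v) = \<one>" using v sy vc by simp
        then show ?thesis using vc yc by (intro comm_inv_char) (auto simp: m_comm)
      qed
      also have "(y \<otimes> v) \<otimes> (inv v \<otimes> inv (\<sigma> y)) = y \<otimes> (v \<otimes> inv v) \<otimes> inv (\<sigma> y)"
        using vc yc by (simp add: m_assoc)
      also have "\<dots> = x" using v(1) y(2) yc vc by simp
      finally show "y' \<in> {y' \<in> Units E. ?f y' = x}" using v y(1) by simp
    qed
    moreover have "inj_on (\<lambda>v. y \<otimes> v) ?F" using y(1) by (auto simp: inj_on_def)
    ultimately show "card {y' \<in> Units E. ?f y' = x} = card ?F" by (simp add: card_image)
  qed
  then have eq: "(\<kappa> ^ 2) ^ n - (\<kappa> ^ 2) ^ (n - 1) = card T * (\<kappa> ^ n - \<kappa> ^ (n - 1))"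
    using card_Units card_fixed_units img unfolding q_eq by simp
  obtain m where m: "n = Suc m" using n_pos by (cases n) auto
  obtain k where k: "\<kappa> = Suc k" "0 < k" using kappa_gt_1 by (cases \<kappa>) auto
  have "(\<kappa> ^ 2) ^ n - (\<kappa> ^ 2) ^ (n - 1) = (\<kappa> ^ m * \<kappa> ^ m) * (\<kappa> ^ 2 - 1)"
    by (simp add: m power_mult_distrib power2_eq_square algebra_simps)
  also have "\<kappa> ^ 2 - 1 = (\<kappa> + 1) * k" by (simp add: k power2_eq_square)
  finally have "(\<kappa> ^ m * (\<kappa> + 1)) * (\<kappa> ^ m * k) = card T * (\<kappa> ^ m * k)"
    using eq by (simp add: m k algebra_simps)
  moreover have "\<kappa> ^ m * k > 0" using k by simp
  ultimately show ?thesis using kappa_gt_1 by (auto simp: m)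
qed


section \<open>The subgroup B and inflated characters\<close>

text \<open>The elements of the group that are diagonal modulo \<open>\<pi>^r\<close>.\<close>

definition B :: "('a \<times> 'a) set" where "B = {(x, z). (x, z) \<in> carrier \<Gamma> \<and> z \<in> pw r}"

text \<open>The norm of an element of \<open>pw r\<close> is 0, because \<open>2 * r = n\<close>;
  the determinant condition then concerns \<open>x\<close> alone.\<close>

lemma B_iff: "(x, z) \<in> B \<longleftrightarrow> x \<in> T \<and> z \<in> pw r"
proof -
  have "z \<otimes> \<sigma> z = \<zero>" if "z \<in> pw r" using pw_r_prod[OF that conj_pw[OF that]] .
  then show ?thesis by (auto simp: B_def SU_carrier T_def pw_closed minus_eq)
qed

lemma B_mult:
  assumes "(x, z) \<in> B" "(x', z') \<in> B"
  shows "(x, z) \<otimes>\<^bsub>\<Gamma>\<^esub> (x', z') = (x \<otimes> x', x \<otimes> z' \<oplus> z \<otimes> \<sigma> x')"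
  using assms pw_r_prod[of z "\<sigma> z'"] conj_pw[of z' r] T_closed[of x] T_closed[of x']
  by (simp add: SU_mult B_iff)

lemma B_subgroup: "subgroup B \<Gamma>"
proof (rule SU.subgroupI)
  show "B \<subseteq> carrier \<Gamma>" by (auto simp: B_def)
  have "(\<one>, \<zero>) \<in> B" using T_one zero_in_pw by (simp add: B_iff)
  then show "B \<noteq> {}" by blast
  fix g assume g: "g \<in> B"
  obtain x z where xz: "g = (x, z)" by (cases g)
  have "inv\<^bsub>\<Gamma>\<^esub> g = (\<sigma> x, \<ominus> z)" using g by (simp add: xz B_def SU_inv)
  then show "inv\<^bsub>\<Gamma>\<^esub> g \<in> B" using g T_conj pw_inv by (simp add: xz B_iff)
  fix h assume h: "h \<in> B"
  obtain x' z' where xz': "h = (x', z')" by (cases h)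
  have "x \<otimes> z' \<oplus> z \<otimes> \<sigma> x' \<in> pw r"
    using g h T_closed pw_mult pw_add by (auto simp: xz xz' B_iff)
  then show "g \<otimes>\<^bsub>\<Gamma>\<^esub> h \<in> B"
    using B_mult[of x z x' z'] g h T_mult by (auto simp: xz xz' B_iff)
qed

lemma card_B: "card B = card T * \<kappa> ^ (2 * r)"
proof -
  have "B = T \<times> pw r" by (auto simp: B_iff)
  moreover have "card (pw r) = \<kappa> ^ (2 * r)"
    using card_pw[of r] n_eq q_eq by (simp add: power_mult)
  ultimately show ?thesis by (simp add: card_cartesian_product)
qed

text \<open>The condition \<open>x \<in> T\<close> is left to \<open>\<theta>\<close>, which
  vanishes outside \<open>T\<close>. On \<open>B\<close> this is a character because
  \<open>z \<otimes> \<sigma> z'\<close> vanishes in the first entry of a product.\<close>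

definition inflate :: "('a \<Rightarrow> complex) \<Rightarrow> 'a \<times> 'a \<Rightarrow> complex" where
  "inflate \<theta> = (\<lambda>(x, z). if z \<in> pw r then \<theta> x else 0)"

abbreviation chars where "chars \<equiv> characters_on TG T"

lemma inflate_character: "\<theta> \<in> chars \<Longrightarrow> inflate \<theta> \<in> characters_on \<Gamma> B"
proof -
  assume \<theta>: "\<theta> \<in> chars"
  show ?thesis
    unfolding characters_on_def
  proof (intro CollectI conjI ballI allI impI)
    fix g h assume g: "g \<in> B" and h: "h \<in> B"
    obtain x z x' z' where gh: "g = (x, z)" "h = (x', z')" by (metis surj_pair)
    have "g \<otimes>\<^bsub>\<Gamma>\<^esub> h \<in> B" using subgroup.m_closed[OF B_subgroup g h] .
    then show "inflate \<theta> (g \<otimes>\<^bsub>\<Gamma>\<^esub> h) = inflate \<theta> g * inflate \<theta> h"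
      using B_mult[of x z x' z'] g h characters_onD(1)[OF \<theta>, of x x']
      by (auto simp: gh B_iff inflate_def)
  next
    fix g assume "g \<in> B"
    then show "inflate \<theta> g \<noteq> 0" using characters_onD(2)[OF \<theta>] by (cases g) (auto simp: B_iff inflate_def)
  next
    fix g assume "g \<notin> B"
    then show "inflate \<theta> g = 0" using characters_onD(3)[OF \<theta>] by (cases g) (auto simp: B_iff inflate_def)
  qed
qed

lemma inflate_inj: "inflate \<theta> = inflate \<theta>' \<longleftrightarrow> \<theta> = \<theta>'"
proof
  assume e: "inflate \<theta> = inflate \<theta>'"
  show "\<theta> = \<theta>'"
  proof
    fix x show "\<theta> x = \<theta>' x" using fun_cong[OF e, of "(x, \<zero>)"] zero_in_pw by (simp add: inflate_def)
  qed
qed simp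

lemma inflate_inverse: "inverse_character (inflate \<theta>) = inflate (inverse_character \<theta>)"
  by (auto simp: inverse_character_def inflate_def fun_eq_iff)

lemma chars_inverse: "\<theta> \<in> chars \<Longrightarrow> inverse_character \<theta> \<in> chars"
  by (auto simp: characters_on_def inverse_character_def)

lemma chars_conj: "\<theta> \<in> chars \<Longrightarrow> x \<in> T \<Longrightarrow> \<theta> (\<sigma> x) = inverse (\<theta> x)"
  using TG.character_inv[OF _ TG.subgroup_self, of \<theta> x] TG_inv by simp

lemma chars_one: "\<theta> \<in> chars \<Longrightarrow> \<theta> \<one> = 1"
  using TG.character_one[OF _ TG.subgroup_self, of \<theta>] by simp

lemma finite_chars: "finite chars" and card_chars: "card chars = card T"
  using TG.card_characters finite_T by simp_all

section \<open>The deepest congruence subgroup of the torus and primitive characters\<close>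

definition H :: "'a set" where "H = {x \<in> T. x \<ominus> \<one> \<in> pw (n - 1)}"

lemma H_ratio:
  assumes "x \<in> T" "y \<in> T" "x \<ominus> y \<in> pw (n - 1)"
  shows "x \<otimes> \<sigma> y \<in> H"
proof -
  have c: "x \<in> carrier E" "y \<in> carrier E" "\<sigma> y \<in> carrier E" using assms T_closed by auto
  have "x \<otimes> \<sigma> y \<ominus> y \<otimes> \<sigma> y = (x \<ominus> y) \<otimes> \<sigma> y" using c by algebra
  then have "x \<otimes> \<sigma> y \<ominus> \<one> \<in> pw (n - 1)" using pw_mult(1)[OF assms(3) c(3)] T_norm[OF assms(2)] by simp
  then show ?thesis using T_mult T_conj assms by (simp add: H_def)
qed

lemma H_subgroup: "subgroup H TG"
proof (rule TG.subgroupI)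
  show "H \<subseteq> carrier TG" by (auto simp: H_def)
  have "\<one> \<in> H" using T_one zero_in_pw by (simp add: H_def minus_eq r_neg)
  then show "H \<noteq> {}" by blast
  fix x assume x: "x \<in> H"
  then have xT: "x \<in> T" by (simp add: H_def)
  have "\<one> \<ominus> x \<in> pw (n - 1)"
  proof -
    have "\<one> \<ominus> x = \<ominus> (x \<ominus> \<one>)" using T_closed[OF xT] by algebra
    then show ?thesis using x pw_inv by (simp add: H_def)
  qed
  then have "\<one> \<otimes> \<sigma> x \<in> H" using H_ratio[OF T_one xT] by simp
  then show "inv\<^bsub>TG\<^esub> x \<in> H" using TG_inv[OF xT] T_closed[OF T_conj[OF xT]] by simp
  fix y assume y: "y \<in> H"
  then have yT: "y \<in> T" by (simp add: H_def)
  have c: "x \<in> carrier E" "y \<in> carrier E" using xT yT T_closed by auto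
  have "x \<otimes> y \<ominus> \<one> = (x \<ominus> \<one>) \<otimes> y \<oplus> (y \<ominus> \<one>)" using c by algebra
  then have "x \<otimes> y \<ominus> \<one> \<in> pw (n - 1)" using x y pw_mult(1) pw_add c by (simp add: H_def)
  then show "x \<otimes>\<^bsub>TG\<^esub> y \<in> H" using T_mult[OF xT yT] by (simp add: H_def)
qed

lemma n_ge_2: "2 \<le> n" using n_eq r_pos by simp

lemma socle_mult: "x \<in> pw (n - 1) \<Longrightarrow> y \<in> pw 1 \<Longrightarrow> x \<otimes> y = \<zero>"
  using pw_mult_pw_zero n_ge_2 by simp

lemma socle_double: "x \<in> pw (n - 1) \<Longrightarrow> x \<oplus> x = \<zero>"
proof -
  assume x: "x \<in> pw (n - 1)"
  have "x \<oplus> x = x \<otimes> (\<one> \<oplus> \<one>)" using pw_closed[OF x] by algebra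
  then show ?thesis using socle_mult[OF x residue_char] by simp
qed

text \<open>The norm of \<open>1 + s\<close> is 1 plus the trace of \<open>s\<close>, since the
  product of \<open>s\<close> and \<open>\<sigma> s\<close> is 0.\<close>

lemma T_one_plus_socle_iff:
  assumes s: "s \<in> pw (n - 1)"
  shows "\<one> \<oplus> s \<in> T \<longleftrightarrow> s \<oplus> \<sigma> s = \<zero>"
proof -
  have c: "s \<in> carrier E" "\<sigma> s \<in> carrier E" using pw_closed[OF s] by auto
  have "s \<in> pw 1" using subsetD[OF pw_mono[of 1 "n - 1"] s] n_ge_2 by linarith
  then have z: "s \<otimes> \<sigma> s = \<zero>" using socle_mult[OF s conj_pw] by simp
  have "(\<one> \<oplus> s) \<otimes> (\<one> \<oplus> \<sigma> s) = \<one> \<oplus> (s \<oplus> \<sigma> s) \<oplus> s \<otimes> \<sigma> s" using c by algebra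
  then have "(\<one> \<oplus> s) \<otimes> \<sigma> (\<one> \<oplus> s) = \<one> \<oplus> (s \<oplus> \<sigma> s)" using z c by simp
  moreover have "\<one> \<oplus> (s \<oplus> \<sigma> s) = \<one> \<longleftrightarrow> s \<oplus> \<sigma> s = \<zero>"
    using add.l_cancel[of \<one> "s \<oplus> \<sigma> s" \<zero>] c by auto
  ultimately show ?thesis using c by (simp add: T_def)
qed

text \<open>Doubling is 0 on the socle, so trace 0 and fixed by \<open>\<sigma>\<close> mean the
  same there; \<open>card_fixed_socle\<close> counts these elements.\<close>

lemma card_H: "card H = \<kappa>"
proof -
  have "H = (\<lambda>s. \<one> \<oplus> s) ` {s \<in> pw (n - 1). \<sigma> s = s}"
  proof (intro equalityI subsetI)
    fix x assume x: "x \<in> H"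
    then have xc: "x \<in> carrier E" and s: "x \<ominus> \<one> \<in> pw (n - 1)" and xT: "x \<in> T"
      by (auto simp: H_def T_def)
    let ?s = "x \<ominus> \<one>"
    have sc: "?s \<in> carrier E" "\<sigma> ?s \<in> carrier E" using pw_closed[OF s] by auto
    have xs: "x = \<one> \<oplus> ?s" using xc by algebra
    then have "?s \<oplus> \<sigma> ?s = \<zero>" using T_one_plus_socle_iff[OF s] xT by simp
    moreover have "?s \<oplus> ?s = \<zero>" using socle_double[OF s] .
    ultimately have "\<sigma> ?s = ?s" using add.l_cancel[of ?s "\<sigma> ?s" ?s] sc by simp
    then show "x \<in> (\<lambda>s. \<one> \<oplus> s) ` {s \<in> pw (n - 1). \<sigma> s = s}" using xs s by blast
  next
    fix x assume "x \<in> (\<lambda>s. \<one> \<oplus> s) ` {s \<in> pw (n - 1). \<sigma> s = s}"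
    then obtain s where s: "s \<in> pw (n - 1)" "\<sigma> s = s" "x = \<one> \<oplus> s" by blast
    have sc: "s \<in> carrier E" using pw_closed[OF s(1)] .
    have "x \<in> T" using T_one_plus_socle_iff[OF s(1)] socle_double[OF s(1)] s by simp
    moreover have "\<one> \<oplus> s \<ominus> \<one> = s" using sc by algebra
    ultimately show "x \<in> H" using s by (simp add: H_def)
  qed
  moreover have "inj_on (\<lambda>s. \<one> \<oplus> s) {s \<in> pw (n - 1). \<sigma> s = s}"
    using pw_closed by (auto simp: inj_on_def)
  ultimately show ?thesis using card_fixed_socle by (simp add: card_image)
qed

definition prim :: "('a \<Rightarrow> complex) set" where
  "prim = {\<theta> \<in> chars. \<exists>h\<in>H. \<theta> h \<noteq> 1}"

text \<open>Only \<open>\<kappa>\<close> and \<open>card T\<close> enter, and \<open>card T\<close>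
  is given by \<open>\<kappa>\<close> and \<open>n\<close>; hence the number is the same for the two
  rings to be compared.\<close>

lemma card_prim: "card prim * \<kappa> = card T * \<kappa> - card T"
proof -
  let ?N = "{\<theta> \<in> chars. \<forall>h\<in>H. \<theta> h = 1}"
  have "card ?N * \<kappa> = card T"
    using TG.card_characters_trivial_on(2)[OF _ H_subgroup] finite_T card_H by simp
  moreover have "card prim = card chars - card ?N"
  proof -
    have "prim = chars - ?N" by (auto simp: prim_def)
    then show ?thesis using finite_chars by (simp add: card_Diff_subset)
  qed
  ultimately show ?thesis using card_chars by (simp add: diff_mult_distrib)
qed

lemma prim_inverse: "\<theta> \<in> prim \<Longrightarrow> inverse_character \<theta> \<in> prim"
  using chars_inverse by (auto simp: prim_def inverse_character_def)

text \<open>Since \<open>\<omega>\<close> has trace 1, an element of trace 0 has the form \<open>m - \<sigma> m\<close>.\<close>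

lemma trace_zero_form:
  assumes s: "s \<in> carrier E" "s \<oplus> \<sigma> s = \<zero>"
  shows "s = s \<otimes> \<omega> \<ominus> \<sigma> (s \<otimes> \<omega>)"
proof -
  have c: "\<sigma> s \<in> carrier E" "\<sigma> \<omega> \<in> carrier E" using s by auto
  have "s \<otimes> \<omega> \<ominus> \<sigma> s \<otimes> \<sigma> \<omega> = s \<otimes> (\<omega> \<oplus> \<sigma> \<omega>) \<ominus> (s \<oplus> \<sigma> s) \<otimes> \<sigma> \<omega>"
    using s(1) c omega_closed by algebra
  then show ?thesis using s c by (simp add: trace_omega minus_eq)
qed


section \<open>Intertwiners of inflated characters\<close>

text \<open>In the first entry the part that depends on \<open>y\<close> is
  \<open>m - \<sigma> m\<close> with \<open>m = \<sigma>(x z) y\<close>, which is the shape provided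
  by \<open>trace_zero_form\<close>. The second entry decides whether the conjugate is again in
  \<open>B\<close>.\<close>

lemma conjugate_in_SU:
  assumes "x \<in> carrier E" "z \<in> carrier E" "t \<in> carrier E" "y \<in> carrier E"
  shows "(\<sigma> x, \<ominus> z) \<otimes>\<^bsub>\<Gamma>\<^esub> (t, y) \<otimes>\<^bsub>\<Gamma>\<^esub> (x, z) =
    (x \<otimes> \<sigma> x \<otimes> t \<ominus> z \<otimes> \<sigma> z \<otimes> \<sigma> t \<oplus> (\<sigma> (x \<otimes> z) \<otimes> y \<ominus> x \<otimes> z \<otimes> \<sigma> y),
     \<sigma> x \<otimes> z \<otimes> (t \<ominus> \<sigma> t) \<oplus> (\<sigma> x \<otimes> \<sigma> x \<otimes> y \<ominus> z \<otimes> z \<otimes> \<sigma> y))"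
proof -
  have c: "\<sigma> x \<in> carrier E" "\<sigma> z \<in> carrier E" "\<sigma> t \<in> carrier E" "\<sigma> y \<in> carrier E" using assms by auto
  have "(\<sigma> x \<otimes> t \<oplus> \<ominus> z \<otimes> \<sigma> y) \<otimes> x \<oplus> (\<sigma> x \<otimes> y \<oplus> \<ominus> z \<otimes> \<sigma> t) \<otimes> \<sigma> z
    = x \<otimes> \<sigma> x \<otimes> t \<ominus> z \<otimes> \<sigma> z \<otimes> \<sigma> t \<oplus> (\<sigma> x \<otimes> \<sigma> z \<otimes> y \<ominus> x \<otimes> z \<otimes> \<sigma> y)"
    "(\<sigma> x \<otimes> t \<oplus> \<ominus> z \<otimes> \<sigma> y) \<otimes> z \<oplus> (\<sigma> x \<otimes> y \<oplus> \<ominus> z \<otimes> \<sigma> t) \<otimes> \<sigma> x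
    = \<sigma> x \<otimes> z \<otimes> (t \<ominus> \<sigma> t) \<oplus> (\<sigma> x \<otimes> \<sigma> x \<otimes> y \<ominus> z \<otimes> z \<otimes> \<sigma> y)"
    using assms c by algebra+
  then show ?thesis using assms c by (simp add: SU_mult)
qed

lemma intertwines_inflateD:
  assumes i: "intertwines \<Gamma> B (inflate \<theta>) (inflate \<theta>') (x, z)" and g: "(x, z) \<in> carrier \<Gamma>"
    and b: "(t, y) \<in> B"
    and c: "(\<sigma> x, \<ominus> z) \<otimes>\<^bsub>\<Gamma>\<^esub> (t, y) \<otimes>\<^bsub>\<Gamma>\<^esub> (x, z) = (t', y')" "y' \<in> pw r"
  shows "\<theta> t = \<theta>' t'"
proof -
  have "(t', y') \<in> carrier \<Gamma>"
    using c(1) SU_inverse_left(1)[OF g] g b SU.m_closed[of _ "(x, z)"] SU.m_closed[of _ "(t, y)"]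
    by (metis (no_types, lifting) B_subgroup subgroup.mem_carrier)
  then have "(t', y') \<in> B" using c(2) by (simp add: B_def)
  then have "inflate \<theta> (t, y) = inflate \<theta>' (t', y')"
    using i b SU_inv[OF g] c(1) by (auto simp: intertwines_def)
  then show ?thesis using b c(2) by (simp add: inflate_def B_iff)
qed

lemma intertwines_inflateI:
  assumes g: "(x, z) \<in> carrier \<Gamma>"
    and "\<And>t y t' y'. t \<in> T \<Longrightarrow> y \<in> pw r \<Longrightarrow> t' \<in> T \<Longrightarrow> y' \<in> pw r \<Longrightarrow>
      (\<sigma> x, \<ominus> z) \<otimes>\<^bsub>\<Gamma>\<^esub> (t, y) \<otimes>\<^bsub>\<Gamma>\<^esub> (x, z) = (t', y') \<Longrightarrow> \<theta> t = \<theta>' t'"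
  shows "intertwines \<Gamma> B (inflate \<theta>) (inflate \<theta>') (x, z)"
  unfolding intertwines_def
proof (intro ballI impI)
  fix b assume b: "b \<in> B" "inv\<^bsub>\<Gamma>\<^esub> (x, z) \<otimes>\<^bsub>\<Gamma>\<^esub> b \<otimes>\<^bsub>\<Gamma>\<^esub> (x, z) \<in> B"
  obtain t y t' y' where e: "b = (t, y)" "inv\<^bsub>\<Gamma>\<^esub> (x, z) \<otimes>\<^bsub>\<Gamma>\<^esub> b \<otimes>\<^bsub>\<Gamma>\<^esub> (x, z) = (t', y')"
    by (metis surj_pair)
  then have "\<theta> t = \<theta>' t'" using assms(2)[of t y t' y'] b SU_inv[OF g] by (simp add: B_iff)
  then show "inflate \<theta> b = inflate \<theta>' (inv\<^bsub>\<Gamma>\<^esub> (x, z) \<otimes>\<^bsub>\<Gamma>\<^esub> b \<otimes>\<^bsub>\<Gamma>\<^esub> (x, z))"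
    using b e by (simp add: inflate_def B_iff)
qed

text \<open>The socle part of \<open>h\<close> has trace 0, so it is \<open>m - \<sigma> m\<close>
  with \<open>m = \<pi>^(n-1) s \<omega>\<close>.\<close>

lemma H_elim:
  assumes "h \<in> H"
  obtains s where "s \<in> carrier E" "h = \<one> \<oplus> \<pi> [^] (n - 1) \<otimes> s"
    "\<pi> [^] (n - 1) \<otimes> s = \<pi> [^] (n - 1) \<otimes> (s \<otimes> \<omega>) \<ominus> \<sigma> (\<pi> [^] (n - 1) \<otimes> (s \<otimes> \<omega>))"
proof -
  have hT: "h \<in> T" and p: "h \<ominus> \<one> \<in> pw (n - 1)" using assms by (auto simp: H_def)
  obtain s where s: "s \<in> carrier E" "h \<ominus> \<one> = \<pi> [^] (n - 1) \<otimes> s" using p by (rule pwE)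
  let ?p = "\<pi> [^] (n - 1)"
  have h: "h = \<one> \<oplus> (h \<ominus> \<one>)" using T_closed[OF hT] by algebra
  then have hs: "h = \<one> \<oplus> ?p \<otimes> s" unfolding s(2) .
  then have "?p \<otimes> s \<oplus> \<sigma> (?p \<otimes> s) = \<zero>"
    using T_one_plus_socle_iff[OF pwI[OF s(1)]] hT by simp
  then have "?p \<otimes> s = (?p \<otimes> s) \<otimes> \<omega> \<ominus> \<sigma> ((?p \<otimes> s) \<otimes> \<omega>)" using s by (intro trace_zero_form) auto
  then have "?p \<otimes> s = ?p \<otimes> (s \<otimes> \<omega>) \<ominus> \<sigma> (?p \<otimes> (s \<otimes> \<omega>))" using s(1) by (simp add: m_assoc)
  then show thesis using that[OF s(1) hs] by blast
qed

text \<open>If \<open>x z\<close> had valuation below \<open>r\<close>, conjugating suitable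
  elements \<open>(1, y)\<close> of \<open>B\<close> would produce every first entry
  \<open>h \<in> H\<close>, and \<open>\<theta>'\<close> would be trivial on \<open>H\<close>. So
  \<open>x z \<in> pw r\<close>; by the determinant condition one of \<open>x\<close>,
  \<open>z\<close> is a unit. If it is \<open>x\<close>, then \<open>g \<in> B\<close>; if it is
  \<open>z\<close>, then \<open>g\<close> inverts the torus modulo \<open>N\<close>-type
  terms.\<close>

lemma intertwines_primitive:
  assumes \<theta>: "\<theta> \<in> prim" and \<theta>': "\<theta>' \<in> prim" and g: "g \<in> carrier \<Gamma>"
    and i: "intertwines \<Gamma> B (inflate \<theta>) (inflate \<theta>') g"
  shows "g \<in> B \<and> \<theta>' = \<theta> \<or> \<theta>' = inverse_character \<theta>"
proof -
  obtain x z where gxz: "g = (x, z)" by (cases g)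
  have xc: "x \<in> carrier E" "z \<in> carrier E" and d: "x \<otimes> \<sigma> x \<ominus> z \<otimes> \<sigma> z = \<one>"
    using g by (auto simp: gxz SU_carrier)
  have sc: "\<sigma> x \<in> carrier E" "\<sigma> z \<in> carrier E" using xc by auto
  note g' = g[unfolded gxz] and i' = i[unfolded gxz]
  have ch: "\<theta> \<in> chars" "\<theta>' \<in> chars" using \<theta> \<theta>' by (auto simp: prim_def)
  have xz: "x \<otimes> z \<in> pw r"
  proof (rule ccontr)
    assume "x \<otimes> z \<notin> pw r"
    then obtain i u where u: "i < r" "u \<in> Units E" "x \<otimes> z = \<pi> [^] i \<otimes> u"
      using valuation[of "x \<otimes> z" r] xc by auto
    have su: "\<sigma> u \<in> Units E" using conj_unit[OF u(2)] .
    have "\<theta>' h = 1" if hH: "h \<in> H" for h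
    proof -
      obtain s where s: "s \<in> carrier E" "h = \<one> \<oplus> \<pi> [^] (n - 1) \<otimes> s"
        "\<pi> [^] (n - 1) \<otimes> s = \<pi> [^] (n - 1) \<otimes> (s \<otimes> \<omega>) \<ominus> \<sigma> (\<pi> [^] (n - 1) \<otimes> (s \<otimes> \<omega>))"
        by (rule H_elim[OF hH])
      \<comment> \<open>Chosen so that \<open>\<sigma>(x z) y = \<pi>^(n-1) s \<omega>\<close>: the
        exponents \<open>i\<close>, \<open>r\<close> and \<open>r - 1 - i\<close> add up to
        \<open>n - 1\<close>. The last is the true difference because \<open>i < r\<close>.\<close>
      define y where "y = \<pi> [^] r \<otimes> (\<pi> [^] (r - 1 - i) \<otimes> (inv (\<sigma> u) \<otimes> (s \<otimes> \<omega>)))"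
      have yc: "\<pi> [^] (r - 1 - i) \<otimes> (inv (\<sigma> u) \<otimes> (s \<otimes> \<omega>)) \<in> carrier E" using su s(1) by simp
      have y: "y \<in> pw r" unfolding y_def using pwI[OF yc] .
      have yc': "y \<in> carrier E" "\<sigma> y \<in> carrier E" using pw_closed[OF y] by auto
      have "\<sigma> (x \<otimes> z) \<otimes> y = (\<pi> [^] i \<otimes> \<pi> [^] r \<otimes> \<pi> [^] (r - 1 - i)) \<otimes> (\<sigma> u \<otimes> inv (\<sigma> u)) \<otimes> (s \<otimes> \<omega>)"
      proof -
        have "inv (\<sigma> u) \<in> carrier E" "\<sigma> u \<in> carrier E" "u \<in> carrier E" "\<pi> [^] i \<in> carrier E"
          "\<pi> [^] r \<in> carrier E" "\<pi> [^] (r - 1 - i) \<in> carrier E" using su u(2) by auto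
        then show ?thesis unfolding u(3) y_def using s(1)
          by (simp add: m_ac del: conj.hom_mult) (simp add: m_ac)
      qed
      also have "\<pi> [^] i \<otimes> \<pi> [^] r \<otimes> \<pi> [^] (r - 1 - i) = \<pi> [^] (n - 1)"
        using u(1) n_eq by (simp add: nat_pow_mult mult_2)
      finally have m: "\<sigma> (x \<otimes> z) \<otimes> y = \<pi> [^] (n - 1) \<otimes> (s \<otimes> \<omega>)" using su s(1) by simp
      have "\<sigma> (\<sigma> (x \<otimes> z) \<otimes> y) = x \<otimes> z \<otimes> \<sigma> y" using xc yc' by simp
      then have m': "x \<otimes> z \<otimes> \<sigma> y = \<sigma> (\<pi> [^] (n - 1) \<otimes> (s \<otimes> \<omega>))" using m by simp
      have b: "(\<one>, y) \<in> B" using T_one y by (simp add: B_iff)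
      have "x \<otimes> \<sigma> x \<otimes> \<one> \<ominus> z \<otimes> \<sigma> z \<otimes> \<sigma> \<one> = \<one>" using d xc by simp
      then have fst: "x \<otimes> \<sigma> x \<otimes> \<one> \<ominus> z \<otimes> \<sigma> z \<otimes> \<sigma> \<one> \<oplus> (\<sigma> (x \<otimes> z) \<otimes> y \<ominus> x \<otimes> z \<otimes> \<sigma> y) = h"
        using m m' s(2,3) by simp
      have snd: "\<sigma> x \<otimes> z \<otimes> (\<one> \<ominus> \<sigma> \<one>) \<oplus> (\<sigma> x \<otimes> \<sigma> x \<otimes> y \<ominus> z \<otimes> z \<otimes> \<sigma> y) \<in> pw r"
        using pw_minus[OF pw_mult(2)[OF y, of "\<sigma> x \<otimes> \<sigma> x"] pw_mult(2)[OF conj_pw[OF y], of "z \<otimes> z"]] xc sc yc'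
        by (simp add: minus_eq r_neg)
      have "\<theta> \<one> = \<theta>' h"
        using intertwines_inflateD[OF i' g' b conjugate_in_SU[OF xc one_closed yc'(1)] snd] unfolding fst .
      then show ?thesis using chars_one[OF ch(1)] by simp
    qed
    then show False using \<theta>' by (auto simp: prim_def)
  qed
  show ?thesis
  proof (cases "x \<in> Units E")
    case True
    have "z = inv x \<otimes> (x \<otimes> z)" using True xc by (simp add: m_assoc[symmetric])
    then have "z \<in> pw r" using pw_mult(2)[OF xz, of "inv x"] True by simp
    then have gB: "g \<in> B" using g by (simp add: gxz B_def)
    \<comment> \<open>Conjugation inside \<open>B\<close> does not change the values of a character
      of \<open>B\<close>.\<close>
    have "\<theta>' t = \<theta> t" for t
    proof (cases "t \<in> T")
      case t: True
      have b: "(t, \<zero>) \<in> B" using t zero_in_pw by (simp add: B_iff)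
      have ib: "inv\<^bsub>\<Gamma>\<^esub> g \<in> B" using subgroup.m_inv_closed[OF B_subgroup gB] .
      have b': "inv\<^bsub>\<Gamma>\<^esub> g \<otimes>\<^bsub>\<Gamma>\<^esub> (t, \<zero>) \<in> B" using subgroup.m_closed[OF B_subgroup ib b] .
      have b'': "inv\<^bsub>\<Gamma>\<^esub> g \<otimes>\<^bsub>\<Gamma>\<^esub> (t, \<zero>) \<otimes>\<^bsub>\<Gamma>\<^esub> g \<in> B" using subgroup.m_closed[OF B_subgroup b' gB] .
      have inf: "inflate \<theta>' \<in> characters_on \<Gamma> B" using inflate_character[OF ch(2)] .
      have "inflate \<theta> (t, \<zero>) = inflate \<theta>' (inv\<^bsub>\<Gamma>\<^esub> g) * inflate \<theta>' (t, \<zero>) * inflate \<theta>' g"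
        using i b b'' characters_onD(1)[OF inf] ib b' gB by (simp add: intertwines_def)
      also have "\<dots> = inflate \<theta>' (t, \<zero>)"
        using SU.character_inv[OF inf B_subgroup gB] characters_onD(2)[OF inf gB] by simp
      finally show ?thesis using zero_in_pw by (simp add: inflate_def)
    qed (use characters_onD(3)[OF ch(1)] characters_onD(3)[OF ch(2)] in simp)
    then show ?thesis using gB by blast
  next
    case False
    then have x1: "x \<in> pw 1" using unit_iff xc by simp
    have "z \<in> Units E"
    proof (rule ccontr)
      assume "z \<notin> Units E"
      then have "z \<in> pw 1" using unit_iff xc by simp
      then have "\<one> \<in> pw 1" using x1 pw_mult(1) pw_minus sc d by metis
      then show False using unit_iff[OF one_closed] by simp
    qed
    then have "x = (x \<otimes> z) \<otimes> inv z" using xc by (simp add: m_assoc)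
    then have xr: "x \<in> pw r" using pw_mult(1)[OF xz, of "inv z"] \<open>z \<in> Units E\<close> by simp
    have xx: "x \<otimes> \<sigma> x = \<zero>" using pw_r_prod[OF xr conj_pw[OF xr]] .
    have zz: "z \<otimes> \<sigma> z = \<ominus> \<one>"
    proof -
      have "z \<otimes> \<sigma> z = x \<otimes> \<sigma> x \<ominus> (x \<otimes> \<sigma> x \<ominus> z \<otimes> \<sigma> z)" using xc sc by algebra
      then show ?thesis using d xx by (simp add: minus_eq)
    qed
    \<comment> \<open>Here \<open>x\<close> has norm 0 and \<open>z\<close> has norm -1, so
      conjugating \<open>(t, 0)\<close> gives an element of \<open>B\<close> with first entry
      \<open>\<sigma> t\<close>, the inverse of \<open>t\<close>.\<close>
    have "\<theta>' t = inverse (\<theta> t)" for t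
    proof (cases "t \<in> T")
      case t: True
      have tc: "t \<in> carrier E" "\<sigma> t \<in> carrier E" using T_closed[OF t] by auto
      have b: "(t, \<zero>) \<in> B" using t zero_in_pw by (simp add: B_iff)
      have fst: "x \<otimes> \<sigma> x \<otimes> t \<ominus> z \<otimes> \<sigma> z \<otimes> \<sigma> t \<oplus> (\<sigma> (x \<otimes> z) \<otimes> \<zero> \<ominus> x \<otimes> z \<otimes> \<sigma> \<zero>) = \<sigma> t"
        using xx zz tc xc by (simp add: minus_eq l_minus)
      have snd: "\<sigma> x \<otimes> z \<otimes> (t \<ominus> \<sigma> t) \<oplus> (\<sigma> x \<otimes> \<sigma> x \<otimes> \<zero> \<ominus> z \<otimes> z \<otimes> \<sigma> \<zero>) \<in> pw r"
        using pw_mult(1)[OF pw_mult(1)[OF conj_pw[OF xr], of z], of "t \<ominus> \<sigma> t"] xc tc sc by (simp add: minus_eq)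
      have "\<theta> t = \<theta>' (\<sigma> t)"
        using intertwines_inflateD[OF i' g' b conjugate_in_SU[OF xc tc(1) zero_closed] snd] unfolding fst .
      then show ?thesis using chars_conj[OF ch(2) t] by simp
    qed (use characters_onD(3)[OF ch(1)] characters_onD(3)[OF ch(2)] in simp)
    then show ?thesis by (auto simp: inverse_character_def)
  qed
qed

text \<open>For \<open>m\<close> divisible by \<open>\<pi>\<^bsup>n-1-e\<^esup>\<close> one has \<open>(1 + m)\<^sup>2 = 1 + 2 m\<close>: by \<open>e < r\<close>, \<open>2 (n - 1 - e) \<ge> n\<close>.\<close>

lemma H_square:
  assumes two: "\<one> \<oplus> \<one> = \<pi> [^] e \<otimes> \<epsilon>" and \<epsilon>: "\<epsilon> \<in> Units E" "\<sigma> \<epsilon> = \<epsilon>" and e: "e < r" and h: "h \<in> H"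
  obtains t where "t \<in> T" "t \<otimes> t = h"
proof -
  obtain s where s: "s \<in> carrier E" "h = \<one> \<oplus> \<pi> [^] (n - 1) \<otimes> s"
    "\<pi> [^] (n - 1) \<otimes> s = \<pi> [^] (n - 1) \<otimes> (s \<otimes> \<omega>) \<ominus> \<sigma> (\<pi> [^] (n - 1) \<otimes> (s \<otimes> \<omega>))"
    by (rule H_elim[OF h])
  define d where "d = s \<otimes> \<omega> \<ominus> \<sigma> (s \<otimes> \<omega>)"
  define k where "k = n - 1 - e"
  \<comment> \<open>The factor \<open>inv \<epsilon>\<close> compensates the unit in
    \<open>2 = \<pi>^e \<epsilon>\<close>, so that \<open>2 v\<close> is the socle part of
    \<open>h\<close>. Since \<open>\<sigma> v = -v\<close>, the norm of \<open>1 + v\<close> is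
    \<open>1 - v^2 = 1\<close>.\<close>
  define v where "v = \<pi> [^] k \<otimes> (inv \<epsilon> \<otimes> d)"
  have c: "\<epsilon> \<in> carrier E" "inv \<epsilon> \<in> carrier E" "d \<in> carrier E" "\<sigma> (s \<otimes> \<omega>) \<in> carrier E" "s \<otimes> \<omega> \<in> carrier E"
    using \<epsilon> s(1) by (auto simp: d_def)
  have vk: "v \<in> pw k" unfolding v_def using pwI c by simp
  have vc: "v \<in> carrier E" using pw_closed[OF vk] .
  have sd: "\<sigma> d = \<ominus> d"
  proof -
    have "\<sigma> d = \<sigma> (s \<otimes> \<omega>) \<ominus> \<sigma> (\<sigma> (s \<otimes> \<omega>))" unfolding d_def minus_eq using c by (simp del: conj.hom_mult)
    also have "\<sigma> (\<sigma> (s \<otimes> \<omega>)) = s \<otimes> \<omega>" using c by simp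
    also have "\<sigma> (s \<otimes> \<omega>) \<ominus> s \<otimes> \<omega> = \<ominus> d" unfolding d_def using c(4,5) by algebra
    finally show ?thesis .
  qed
  have se: "\<sigma> (inv \<epsilon>) = inv \<epsilon>"
  proof -
    have "\<epsilon> \<otimes> \<sigma> (inv \<epsilon>) = \<sigma> (\<epsilon> \<otimes> inv \<epsilon>)" by (simp only: conj.hom_mult[OF c(1,2)] \<epsilon>(2))
    then have "\<epsilon> \<otimes> \<sigma> (inv \<epsilon>) = \<one>" using \<epsilon> by simp
    then show ?thesis using comm_inv_char[of \<epsilon> "\<sigma> (inv \<epsilon>)"] c by simp
  qed
  have sv: "\<sigma> v = \<ominus> v" unfolding v_def using c by (simp add: sd se r_minus)
  have vv: "v \<otimes> v = \<zero>" using pw_mult_pw_zero[OF vk vk] e n_eq by (simp add: k_def)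
  have "(\<one> \<oplus> v) \<otimes> (\<one> \<oplus> \<ominus> v) = \<one> \<ominus> v \<otimes> v" using vc by algebra
  then have tT: "\<one> \<oplus> v \<in> T" using vc sv vv by (simp add: T_def minus_eq)
  have "(\<one> \<oplus> v) \<otimes> (\<one> \<oplus> v) = \<one> \<oplus> (\<one> \<oplus> \<one>) \<otimes> v \<oplus> v \<otimes> v" using vc by algebra
  also have "\<dots> = \<one> \<oplus> (\<pi> [^] e \<otimes> \<epsilon>) \<otimes> v" unfolding vv using vc \<epsilon> by (simp add: two)
  also have "(\<pi> [^] e \<otimes> \<epsilon>) \<otimes> v = (\<pi> [^] e \<otimes> \<pi> [^] k) \<otimes> (\<epsilon> \<otimes> inv \<epsilon>) \<otimes> d"
    unfolding v_def using c by (simp add: m_ac)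
  also have "\<pi> [^] e \<otimes> \<pi> [^] k = \<pi> [^] (n - 1)" using e n_eq by (simp add: nat_pow_mult k_def)
  also have "\<pi> [^] (n - 1) \<otimes> (\<epsilon> \<otimes> inv \<epsilon>) \<otimes> d = \<pi> [^] (n - 1) \<otimes> s"
  proof -
    have "\<pi> [^] (n - 1) \<otimes> d = \<pi> [^] (n - 1) \<otimes> (s \<otimes> \<omega>) \<ominus> \<pi> [^] (n - 1) \<otimes> \<sigma> (s \<otimes> \<omega>)"
      unfolding d_def minus_eq using c by (simp add: r_distr r_minus del: conj.hom_mult)
    also have "\<pi> [^] (n - 1) \<otimes> \<sigma> (s \<otimes> \<omega>) = \<sigma> (\<pi> [^] (n - 1) \<otimes> (s \<otimes> \<omega>))"
      using s(1) by simp
    finally show ?thesis using s(3) \<epsilon> c by simp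
  qed
  finally show thesis using that[OF tT] s(2) by simp
qed

text \<open>A self-inverse character takes only the values 1 and -1 on \<open>T\<close>, hence is
  trivial on squares and by \<open>H_square\<close> on \<open>H\<close>.\<close>

lemma primitive_not_self_inverse:
  assumes two: "\<one> \<oplus> \<one> = \<pi> [^] e \<otimes> \<epsilon>" and \<epsilon>: "\<epsilon> \<in> Units E" "\<sigma> \<epsilon> = \<epsilon>" and e: "e < r"
    and \<theta>: "\<theta> \<in> prim"
  shows "inverse_character \<theta> \<noteq> \<theta>"
proof
  assume eq: "inverse_character \<theta> = \<theta>"
  obtain h where h: "h \<in> H" "\<theta> h \<noteq> 1" and ch: "\<theta> \<in> chars" using \<theta> by (auto simp: prim_def)
  obtain t where t: "t \<in> T" "t \<otimes> t = h" by (rule H_square[OF two \<epsilon> e h(1)])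
  have "\<theta> h = \<theta> t * \<theta> t" using characters_onD(1)[OF ch t(1) t(1)] t(2) by simp
  moreover have "inverse (\<theta> t) = \<theta> t" using fun_cong[OF eq, of t] by (simp add: inverse_character_def)
  ultimately show False using h(2) characters_onD(2)[OF ch t(1)] by (metis right_inverse)
qed


section \<open>Induced modules in characteristic 2\<close>

context
  assumes char2: "\<one> \<oplus> \<one> = \<zero>" and r_ge_2: "2 \<le> r"
begin

lemma double: "x \<in> carrier E \<Longrightarrow> x \<oplus> x = \<zero>"
proof -
  assume x: "x \<in> carrier E"
  have "x \<oplus> x = (\<one> \<oplus> \<one>) \<otimes> x" using x by algebra
  then show ?thesis using char2 x by simp
qed

lemma neg_eq: "x \<in> carrier E \<Longrightarrow> \<ominus> x = x"
  using double[of x] by (simp add: minus_equality)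

text \<open>The pair \<open>(0, 1)\<close> has determinant -1, which is 1 here. Conjugation by it
  acts on first entries as \<open>\<sigma>\<close>, that is, as inversion of
  \<open>T\<close>.\<close>

lemma intertwines_conj:
  assumes \<theta>: "\<theta> \<in> chars"
  shows "(\<zero>, \<one>) \<in> carrier \<Gamma>" "(\<zero>, \<one>) \<notin> B"
    "intertwines \<Gamma> B (inflate \<theta>) (inflate (inverse_character \<theta>)) (\<zero>, \<one>)"
proof -
  show g: "(\<zero>, \<one>) \<in> carrier \<Gamma>" by (simp add: SU_carrier minus_eq neg_eq)
  show "(\<zero>, \<one>) \<notin> B"
    using pi_pow_unit_in_pw_iff[of \<one> 0 r] n_pos r_ge_2 by (simp add: B_iff)
  show "intertwines \<Gamma> B (inflate \<theta>) (inflate (inverse_character \<theta>)) (\<zero>, \<one>)"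
  proof (rule intertwines_inflateI[OF g])
    fix t y t' y'
    assume t: "t \<in> T" and y: "y \<in> pw r"
      and e: "(\<sigma> \<zero>, \<ominus> \<one>) \<otimes>\<^bsub>\<Gamma>\<^esub> (t, y) \<otimes>\<^bsub>\<Gamma>\<^esub> (\<zero>, \<one>) = (t', y')"
    have c: "t \<in> carrier E" "y \<in> carrier E" using T_closed[OF t] pw_closed[OF y] by auto
    then have "t' = \<sigma> t"
      using e neg_eq[of "\<sigma> t"] unfolding conjugate_in_SU[OF zero_closed one_closed c]
      by (simp add: minus_eq l_minus)
    then show "\<theta> t = inverse_character \<theta> t'" using chars_conj[OF \<theta> t] by (simp add: inverse_character_def)
  qed
qed

text \<open>For such \<open>\<theta>\<close> the element \<open>(0, 1)\<close> outside
  \<open>B\<close> intertwines the inflated character with itself.\<close>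

lemma not_minimal_self_inverse:
  assumes \<theta>: "\<theta> \<in> chars" "inverse_character \<theta> = \<theta>"
  shows "\<not> minimal_idempotent (group_algebra \<Gamma>) (character_idempotent B (inflate \<theta>))"
  using SU.minimal_character_idempotent_iff[OF B_subgroup inflate_character[OF \<theta>(1)]]
    intertwines_conj[OF \<theta>(1)] \<theta>(2) by auto

text \<open>The element \<open>(1 + \<pi>\<^bsup>r-1\<^esup>, \<pi>\<^bsup>r-1\<^esup>)\<close> outside \<open>B\<close> intertwines an imprimitive character with itself.\<close>

lemma not_minimal_imprimitive:
  assumes \<theta>: "\<theta> \<in> chars" "\<theta> \<notin> prim"
  shows "\<not> minimal_idempotent (group_algebra \<Gamma>) (character_idempotent B (inflate \<theta>))"
proof -
  define p where "p = \<pi> [^] (r - 1)"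
  let ?x = "\<one> \<oplus> p"
  have pc: "p \<in> carrier E" and xc: "?x \<in> carrier E" by (simp_all add: p_def)
  have pp: "p \<in> pw (r - 1)" using pwI[OF one_closed, of "r - 1"] by (simp add: p_def)
  have p1: "p \<in> pw 1" using subsetD[OF pw_mono[of 1 "r - 1"] pp] r_ge_2 by linarith
  have sx: "\<sigma> ?x = ?x" and sp: "\<sigma> p = p" by (simp_all add: p_def)
  have "?x \<otimes> ?x \<ominus> p \<otimes> p = \<one> \<oplus> (p \<oplus> p)" using pc by algebra
  then have g: "(?x, p) \<in> carrier \<Gamma>" using pc by (simp add: SU_carrier double sp)
  have "\<not> r \<le> r - 1" "r - 1 < n" using n_eq r_ge_2 by linarith+
  then have "p \<notin> pw r" using pi_pow_unit_in_pw_iff[of \<one> "r - 1" r] by (simp add: p_def)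
  then have gB: "(?x, p) \<notin> B" by (simp add: B_iff)
  have "intertwines \<Gamma> B (inflate \<theta>) (inflate \<theta>) (?x, p)"
  proof (rule intertwines_inflateI[OF g])
    fix t y t' y'
    assume t: "t \<in> T" and y: "y \<in> pw r" and t': "t' \<in> T" and y': "y' \<in> pw r"
      and e: "(\<sigma> ?x, \<ominus> p) \<otimes>\<^bsub>\<Gamma>\<^esub> (t, y) \<otimes>\<^bsub>\<Gamma>\<^esub> (?x, p) = (t', y')"
    have c: "t \<in> carrier E" "y \<in> carrier E" "\<sigma> t \<in> carrier E" "\<sigma> y \<in> carrier E"
      using T_closed[OF t] pw_closed[OF y] by auto
    have e1: "t' = ?x \<otimes> ?x \<otimes> t \<ominus> p \<otimes> p \<otimes> \<sigma> t \<oplus> (?x \<otimes> p \<otimes> y \<ominus> ?x \<otimes> p \<otimes> \<sigma> y)"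
      and e2: "y' = ?x \<otimes> p \<otimes> (t \<ominus> \<sigma> t) \<oplus> (?x \<otimes> ?x \<otimes> y \<ominus> p \<otimes> p \<otimes> \<sigma> y)"
      using e[unfolded conjugate_in_SU[OF xc pc c(1,2)]] unfolding conj.hom_mult[OF xc pc] sx sp by simp_all
    have xu: "?x \<in> Units E" using unit_add_pw[OF Units_one_closed p1] .
    have ixc: "inv ?x \<in> carrier E" using xu by simp
    let ?w = "t \<ominus> \<sigma> t"
    have wc: "?w \<in> carrier E" using c by simp
    \<comment> \<open>The second entry \<open>y'\<close> lies in \<open>pw r\<close>. Removing its
      terms in \<open>y\<close> and then the unit \<open>?x\<close> leaves
      \<open>p (t - \<sigma> t)\<close> in \<open>pw r\<close>; as \<open>p\<close> has valuation
      \<open>r - 1\<close>, the factor \<open>t - \<sigma> t\<close> is in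
      \<open>pw 1\<close>.\<close>
    have "?x \<otimes> ?x \<otimes> y \<ominus> p \<otimes> p \<otimes> \<sigma> y \<in> pw r"
      using pw_minus[OF pw_mult(2)[OF y, of "?x \<otimes> ?x"] pw_mult(2)[OF conj_pw[OF y], of "p \<otimes> p"]] xc pc by simp
    then have "y' \<ominus> (?x \<otimes> ?x \<otimes> y \<ominus> p \<otimes> p \<otimes> \<sigma> y) \<in> pw r" using pw_minus y' by blast
    moreover have "y' \<ominus> (?x \<otimes> ?x \<otimes> y \<ominus> p \<otimes> p \<otimes> \<sigma> y) = ?x \<otimes> p \<otimes> ?w"
      unfolding e2 using xc pc c wc by (simp add: minus_eq a_assoc r_neg)
    ultimately have "?x \<otimes> p \<otimes> ?w \<in> pw r" by simp
    then have "inv ?x \<otimes> (?x \<otimes> p \<otimes> ?w) \<in> pw r" using pw_mult(2) ixc by blast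
    moreover have "inv ?x \<otimes> (?x \<otimes> p \<otimes> ?w) = (inv ?x \<otimes> ?x) \<otimes> (p \<otimes> ?w)" using ixc xc pc wc by (simp add: m_assoc)
    ultimately have pwr: "p \<otimes> ?w \<in> pw r" using xu pc wc by simp
    have w1: "?w \<in> pw 1"
    proof (rule ccontr)
      assume "?w \<notin> pw 1"
      then have "?w \<in> Units E" using unit_iff[OF wc] by simp
      then show False using pi_pow_unit_in_pw_iff[of ?w "r - 1" r] pwr[unfolded p_def] \<open>\<not> r \<le> r - 1\<close> \<open>r - 1 < n\<close> by blast
    qed
    have gen: "(\<one> \<oplus> d \<oplus> k) \<otimes> a \<ominus> k \<otimes> a' \<oplus> (u \<otimes> b \<ominus> u \<otimes> b') \<ominus> a = k \<otimes> (a \<ominus> a') \<oplus> d \<otimes> a \<oplus> u \<otimes> (b \<ominus> b')"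
      if "d \<in> carrier E" "k \<in> carrier E" "a \<in> carrier E" "a' \<in> carrier E" "u \<in> carrier E" "b \<in> carrier E" "b' \<in> carrier E"
      for d k a a' u b b'
      using that by algebra
    have "?x \<otimes> ?x = \<one> \<oplus> (p \<oplus> p) \<oplus> p \<otimes> p" using pc by algebra
    then have "t' \<ominus> t = p \<otimes> p \<otimes> ?w \<oplus> (p \<oplus> p) \<otimes> t \<oplus> ?x \<otimes> p \<otimes> (y \<ominus> \<sigma> y)"
      using gen[of "p \<oplus> p" "p \<otimes> p" t "\<sigma> t" "?x \<otimes> p" y "\<sigma> y"] pc xc c e1 by simp
    also have "?x \<otimes> p \<otimes> (y \<ominus> \<sigma> y) = ?x \<otimes> (p \<otimes> (y \<ominus> \<sigma> y))" using pc xc c by (intro m_assoc) auto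
    also have "(p \<oplus> p) \<otimes> t = \<zero>" using double[OF pc] c by simp
    also have "p \<otimes> p \<otimes> ?w \<oplus> \<zero> \<oplus> ?x \<otimes> (p \<otimes> (y \<ominus> \<sigma> y)) \<in> pw (n - 1)"
    proof -
      \<comment> \<open>The exponents just suffice: both remaining terms of \<open>t' - t\<close>
        lie in the socle, so \<open>t'\<close> and \<open>t\<close> differ by an element of
        \<open>H\<close>.\<close>
      have ex: "(r - 1) + (r - 1) + 1 = n - 1" "(r - 1) + r = n - 1" using n_eq r_ge_2 by simp_all
      have 1: "p \<otimes> p \<otimes> ?w \<in> pw (n - 1)" using pw_mult_pw[OF pw_mult_pw[OF pp pp] w1] unfolding ex(1) .
      have "p \<otimes> (y \<ominus> \<sigma> y) \<in> pw (n - 1)"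
        using pw_mult_pw[OF pp pw_minus[OF y conj_pw[OF y]]] unfolding ex(2) .
      then have 2: "?x \<otimes> (p \<otimes> (y \<ominus> \<sigma> y)) \<in> pw (n - 1)" using pw_mult(2) xc by blast
      have "p \<otimes> p \<otimes> ?w \<oplus> \<zero> = p \<otimes> p \<otimes> ?w" using pc wc by simp
      then show ?thesis using pw_add[OF 1 2] by simp
    qed
    finally have "t' \<otimes> \<sigma> t \<in> H" using H_ratio[OF t' t] by simp
    then have "\<theta> (t' \<otimes> \<sigma> t) = 1" using \<theta> by (auto simp: prim_def)
    then have "\<theta> t' * inverse (\<theta> t) = 1"
      using characters_onD(1)[OF \<theta>(1) t' T_conj[OF t]] chars_conj[OF \<theta>(1) t] by simp
    then show "\<theta> t = \<theta> t'" using characters_onD(2)[OF \<theta>(1) t] by (simp add: field_simps)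
  qed
  then show ?thesis
    using SU.minimal_character_idempotent_iff[OF B_subgroup inflate_character[OF \<theta>(1)]] g gB by blast
qed

text \<open>In characteristic 2 the equation becomes \<open>(t + 1)^2 = \<pi>^(n-1)\<close>. A
  nonzero square has even valuation, while \<open>n - 1 = 2 r - 1\<close> is odd.\<close>

lemma not_square:
  assumes t: "t \<in> carrier E"
  shows "t \<otimes> t \<noteq> \<one> \<oplus> \<pi> [^] (n - 1)"
proof
  let ?p = "\<pi> [^] (n - 1)"
  assume e: "t \<otimes> t = \<one> \<oplus> ?p"
  let ?z = "t \<oplus> \<one>"
  have "?z \<otimes> ?z = t \<otimes> t \<oplus> (t \<oplus> t) \<oplus> \<one>" using t by algebra
  also have "\<dots> = ?p \<oplus> (\<one> \<oplus> \<one>)" unfolding e double[OF t] by (simp add: a_ac)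
  finally have zz: "?z \<otimes> ?z = ?p" using char2 by simp
  have zc: "?z \<in> carrier E" using t by simp
  have "?z \<notin> pw r" using pw_r_prod[of ?z ?z] zz pi_pow_pred by auto
  then obtain i u where u: "i < r" "u \<in> Units E" "?z = \<pi> [^] i \<otimes> u" using valuation[OF zc] by blast
  have "?p = \<pi> [^] (i + i) \<otimes> (u \<otimes> u)"
    using zz unfolding u(3) nat_pow_mult[OF pi_closed, symmetric] using u(2) by (simp add: m_ac)
  then have "?p \<otimes> \<one> \<in> pw k \<longleftrightarrow> k \<le> i + i" for k
    using pi_pow_unit_in_pw_iff[of "u \<otimes> u" "i + i" k] u n_eq by simp
  moreover have "?p \<otimes> \<one> \<in> pw k \<longleftrightarrow> k \<le> n - 1" for k
    using pi_pow_unit_in_pw_iff[of \<one> "n - 1" k] n_pos by simp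
  ultimately have "n - 1 = i + i" by (metis le_refl le_antisym)
  then show False using n_eq u(1) by presburger
qed

text \<open>A character trivial on the squares of \<open>T\<close> is its own inverse. By
  \<open>not_square\<close> such a character can be chosen nontrivial at
  \<open>1 + \<pi>^(n-1)\<close>, an element of \<open>H\<close>.\<close>

lemma primitive_self_inverse_exists: "\<exists>\<theta>\<in>prim. inverse_character \<theta> = \<theta>"
proof -
  let ?Q = "(\<lambda>t. t \<otimes> t) ` T"
  let ?p = "\<pi> [^] (n - 1)"
  have Q: "subgroup ?Q TG"
  proof (rule TG.subgroupI)
    show "?Q \<subseteq> carrier TG" using T_mult by auto
    show "?Q \<noteq> {}" using T_one by blast
    fix a assume "a \<in> ?Q"
    then obtain s where s: "s \<in> T" "a = s \<otimes> s" by blast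
    have "inv\<^bsub>TG\<^esub> a = \<sigma> s \<otimes> \<sigma> s" using TG_inv[OF T_mult[OF s(1) s(1)]] s T_closed[OF s(1)] by simp
    then show "inv\<^bsub>TG\<^esub> a \<in> ?Q" using T_conj[OF s(1)] by blast
    fix b assume "b \<in> ?Q"
    then obtain t where t: "t \<in> T" "b = t \<otimes> t" by blast
    have "a \<otimes> b = (s \<otimes> t) \<otimes> (s \<otimes> t)" using s t T_closed by (simp add: m_ac)
    then show "a \<otimes>\<^bsub>TG\<^esub> b \<in> ?Q" using T_mult[OF s(1) t(1)] by auto
  qed
  have p: "?p \<in> pw (n - 1)" using pwI[OF one_closed, of "n - 1"] by simp
  have h: "\<one> \<oplus> ?p \<in> T" using T_one_plus_socle_iff[OF p] double[of ?p] by simp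
  have "\<one> \<oplus> ?p \<ominus> \<one> = ?p" using pw_closed[OF p] by algebra
  then have hH: "\<one> \<oplus> ?p \<in> H" using h p by (simp add: H_def)
  have "\<one> \<oplus> ?p \<notin> ?Q"
  proof
    assume "\<one> \<oplus> ?p \<in> ?Q"
    then obtain t where "t \<in> T" "\<one> \<oplus> ?p = t \<otimes> t" by blast
    then show False using not_square[OF T_closed] by metis
  qed
  then obtain \<theta> where \<theta>: "\<theta> \<in> chars" "\<forall>q\<in>?Q. \<theta> q = 1" "\<theta> (\<one> \<oplus> ?p) \<noteq> 1"
    using TG.character_separates[OF _ Q, of "\<one> \<oplus> ?p"] h finite_T by auto
  have "inverse (\<theta> t) = \<theta> t" for t
  proof (cases "t \<in> T")
    case True
    then have "\<theta> t * \<theta> t = 1" using characters_onD(1)[OF \<theta>(1) True True] \<theta>(2) by simp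
    then show ?thesis using inverse_unique by blast
  qed (use characters_onD(3)[OF \<theta>(1)] in simp)
  then have "inverse_character \<theta> = \<theta>" by (simp add: inverse_character_def)
  then show ?thesis using \<theta> hH by (auto simp: prim_def)
qed

end

end

section \<open>Exhaustion of the irreducible modules of the critical dimension\<close>

lemma (in group) pow_card_subgroup:
  assumes "finite (carrier G)" "subgroup K G" "x \<in> K"
  shows "x [^] card K = \<one>"
proof -
  interpret K: group "G\<lparr>carrier := K\<rparr>" using subgroup_imp_group[OF assms(2)] .
  have "x [^]\<^bsub>G\<lparr>carrier := K\<rparr>\<^esub> order (G\<lparr>carrier := K\<rparr>) = \<one>" using K.pow_order_eq_1 assms(3) by simp
  then show ?thesis by (simp add: order_def nat_pow_consistent[symmetric])
qed

context unramified_ring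
begin

text \<open>Otherwise \<open>y^2\<close> is congruent to 1 modulo \<open>\<pi>\<close>. The group
  \<open>V\<close> of such units has order a power of \<open>\<kappa>\<close>, prime to
  \<open>l\<close>, so \<open>y^2 = 1\<close>, and then \<open>y = 1\<close> because
  \<open>l\<close> is odd.\<close>

lemma one_minus_square_unit:
  assumes l: "Factorial_Ring.prime l" "odd l" "coprime l \<kappa>" and D: "subgroup D TG" "card D = l" and y: "y \<in> D" "y \<noteq> \<one>"
  shows "\<one> \<ominus> y \<otimes> y \<in> Units E"
proof (rule ccontr)
  assume nu: "\<one> \<ominus> y \<otimes> y \<notin> Units E"
  interpret U: comm_group "units_of E" by (rule units_comm_group)
  have finU: "finite (carrier (units_of E))"
    by (rule finite_subset[OF _ finite_carrier]) (auto simp: units_of_carrier)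
  have DU: "subgroup D (units_of E)" using U.incl_subgroup[OF T_subgroup D(1)] .
  have yT: "y \<in> T" using subgroup.subset[OF D(1)] y(1) by auto
  have yc: "y \<in> carrier E" and yU: "y \<in> Units E" using T_closed[OF yT] T_unit[OF yT] by auto
  define V where "V = {x \<in> Units E. x \<ominus> \<one> \<in> pw 1}"
  have V: "subgroup V (units_of E)"
  proof (rule U.subgroupI)
    show "V \<subseteq> carrier (units_of E)" by (auto simp: V_def units_of_carrier)
    have "\<one> \<in> V" using zero_in_pw by (simp add: V_def minus_eq r_neg)
    then show "V \<noteq> {}" by blast
    fix a assume a: "a \<in> V"
    then have aU: "a \<in> Units E" "a \<in> carrier E" "inv a \<in> carrier E" "a \<ominus> \<one> \<in> pw 1" by (auto simp: V_def)
    have "inv a \<ominus> \<one> = \<ominus> (inv a \<otimes> (a \<ominus> \<one>))"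
    proof -
      have "\<ominus> (inv a \<otimes> (a \<ominus> \<one>)) = \<ominus> (inv a \<otimes> a) \<oplus> inv a" using aU by algebra
      then show ?thesis using aU by (simp add: minus_eq a_comm)
    qed
    then have "inv a \<ominus> \<one> \<in> pw 1" using pw_inv[OF pw_mult(2)[OF aU(4,3)]] by simp
    then show "inv\<^bsub>units_of E\<^esub> a \<in> V" using aU units_of_inv by (simp add: V_def)
    fix b assume "b \<in> V"
    then have bU: "b \<in> Units E" "b \<in> carrier E" "b \<ominus> \<one> \<in> pw 1" by (auto simp: V_def)
    have "a \<otimes> b \<ominus> \<one> = (a \<ominus> \<one>) \<otimes> b \<oplus> (b \<ominus> \<one>)" using aU bU by algebra
    then have "a \<otimes> b \<ominus> \<one> \<in> pw 1" using pw_add[OF pw_mult(1)[OF aU(4) bU(2)] bU(3)] by simp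
    then show "a \<otimes>\<^bsub>units_of E\<^esub> b \<in> V" using aU bU by (simp add: V_def)
  qed
  have "V = (\<lambda>s. \<one> \<oplus> s) ` pw 1"
  proof (intro equalityI subsetI)
    fix x assume "x \<in> V"
    then have "x \<in> carrier E" "x \<ominus> \<one> \<in> pw 1" by (auto simp: V_def)
    moreover have "x = \<one> \<oplus> (x \<ominus> \<one>)" using calculation(1) by algebra
    ultimately show "x \<in> (\<lambda>s. \<one> \<oplus> s) ` pw 1" by blast
  next
    fix x assume "x \<in> (\<lambda>s. \<one> \<oplus> s) ` pw 1"
    then obtain s where s: "s \<in> pw 1" "x = \<one> \<oplus> s" by blast
    have "\<one> \<oplus> s \<ominus> \<one> = s" using pw_closed[OF s(1)] by algebra
    then show "x \<in> V" using s unit_add_pw[OF Units_one_closed s(1)] by (simp add: V_def)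
  qed
  moreover have "inj_on (\<lambda>s. \<one> \<oplus> s) (pw 1)" using pw_closed by (auto simp: inj_on_def)
  ultimately have cV: "card V = \<kappa> ^ (2 * (n - 1))"
    using card_pw[of 1] n_pos by (simp add: card_image q_eq power_mult)
  have yy: "y \<otimes> y \<in> V"
  proof -
    have "\<one> \<ominus> y \<otimes> y \<in> pw 1" using nu unit_iff yc by simp
    then have "\<ominus> (\<one> \<ominus> y \<otimes> y) \<in> pw 1" by (rule pw_inv)
    moreover have "\<ominus> (\<one> \<ominus> y \<otimes> y) = y \<otimes> y \<ominus> \<one>" using yc by algebra
    ultimately show ?thesis using yU by (simp add: V_def)
  qed
  have yyU: "y \<otimes> y \<in> carrier (units_of E)" "y \<in> carrier (units_of E)" using yU by (simp_all add: units_of_carrier)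
  have "y \<otimes> y \<in> D" using subgroup.m_closed[OF DU y(1) y(1)] by simp
  then have "U.ord (y \<otimes> y) dvd l" using U.pow_card_subgroup[OF finU DU] D(2) U.pow_eq_id[OF yyU(1)] by auto
  moreover have "U.ord (y \<otimes> y) dvd \<kappa> ^ (2 * (n - 1))"
    using U.pow_card_subgroup[OF finU V yy] cV U.pow_eq_id[OF yyU(1)] by auto
  moreover have "coprime l (\<kappa> ^ (2 * (n - 1)))" using l(3) by simp
  ultimately have "U.ord (y \<otimes> y) = 1" using coprime_common_divisor_nat by blast
  then have "y \<otimes> y = \<one>" using U.ord_eq_1[OF yyU(1)] by simp
  then have "y [^]\<^bsub>units_of E\<^esub> (2::nat) = \<one>" using yc by (simp add: numeral_2_eq_2)
  then have "U.ord y dvd 2" using U.pow_eq_id[OF yyU(2)] by simp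
  moreover have "U.ord y dvd l" using U.pow_card_subgroup[OF finU DU y(1)] D(2) U.pow_eq_id[OF yyU(2)] by auto
  moreover have "coprime l 2" using l(2) by simp
  ultimately have "U.ord y = 1" using coprime_common_divisor_nat by blast
  then show False using U.ord_eq_1[OF yyU(2)] y(2) by simp
qed

text \<open>The kernel of \<open>(x, z) \<mapsto> x\<close> on \<open>B\<close>; the characters of
  \<open>B\<close> that are trivial on it are the inflated ones.\<close>

definition N :: "('a \<times> 'a) set" where "N = {\<one>} \<times> pw r"

lemma N_sub_B: "N \<subseteq> B"
  using T_one by (auto simp: N_def B_iff)

lemma N_subgroup: "subgroup N \<Gamma>"
proof (rule SU.subgroupI)
  show "N \<subseteq> carrier \<Gamma>" using N_sub_B subgroup.subset[OF B_subgroup] by blast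
  show "N \<noteq> {}" using zero_in_pw by (auto simp: N_def)
  fix g assume g: "g \<in> N"
  then obtain y where y: "g = (\<one>, y)" "y \<in> pw r" by (auto simp: N_def)
  have "g \<in> carrier \<Gamma>" using g N_sub_B subgroup.subset[OF B_subgroup] by blast
  then show "inv\<^bsub>\<Gamma>\<^esub> g \<in> N" using y SU_inv pw_inv by (simp add: N_def)
  fix h assume h: "h \<in> N"
  then obtain w where w: "h = (\<one>, w)" "w \<in> pw r" by (auto simp: N_def)
  have "g \<otimes>\<^bsub>\<Gamma>\<^esub> h = (\<one>, w \<oplus> y)"
    using B_mult[of \<one> y \<one> w] g h N_sub_B y w pw_closed by (auto simp: subset_iff)
  then show "g \<otimes>\<^bsub>\<Gamma>\<^esub> h \<in> N" using y w pw_add by (simp add: N_def)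
qed

text \<open>Commutators with a torus element \<open>x\<close> multiply the coordinate of
  \<open>N\<close> by \<open>1 - x^2\<close>, which is bijective as soon as \<open>1 - x^2\<close>
  is a unit.\<close>

lemma commutator_N:
  assumes x: "x \<in> T" and y: "y \<in> pw r"
  shows "(\<one>, y) \<otimes>\<^bsub>\<Gamma>\<^esub> (x, \<zero>) \<otimes>\<^bsub>\<Gamma>\<^esub> inv\<^bsub>\<Gamma>\<^esub> (\<one>, y) \<otimes>\<^bsub>\<Gamma>\<^esub> inv\<^bsub>\<Gamma>\<^esub> (x, \<zero>) = (\<one>, y \<otimes> (\<one> \<ominus> x \<otimes> x))"
proof -
  have c: "x \<in> carrier E" "\<sigma> x \<in> carrier E" "y \<in> carrier E" "\<sigma> y \<in> carrier E"
    using T_closed[OF x] pw_closed[OF y] by auto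
  have B1: "(\<one>, y) \<in> B" "(x, \<zero>) \<in> B" using x y T_one zero_in_pw by (auto simp: B_iff)
  then have i: "inv\<^bsub>\<Gamma>\<^esub> (\<one>, y) = (\<one>, \<ominus> y)" "inv\<^bsub>\<Gamma>\<^esub> (x, \<zero>) = (\<sigma> x, \<zero>)"
    using SU_inv subgroup.subset[OF B_subgroup] by (auto simp: subset_iff)
  have yy: "y \<otimes> \<sigma> y = \<zero>" using pw_r_prod[OF y conj_pw[OF y]] .
  have "(\<one>, y) \<otimes>\<^bsub>\<Gamma>\<^esub> (x, \<zero>) = (x, y \<otimes> \<sigma> x)" using c by (simp add: SU_mult)
  moreover have "(x, y \<otimes> \<sigma> x) \<otimes>\<^bsub>\<Gamma>\<^esub> (\<one>, \<ominus> y) = (x, y \<otimes> \<sigma> x \<ominus> x \<otimes> y)"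
  proof -
    have "x \<otimes> \<one> \<oplus> y \<otimes> \<sigma> x \<otimes> (\<ominus> \<sigma> y) = x \<ominus> \<sigma> x \<otimes> (y \<otimes> \<sigma> y)" using c by algebra
    moreover have "x \<otimes> (\<ominus> y) \<oplus> y \<otimes> \<sigma> x \<otimes> \<one> = y \<otimes> \<sigma> x \<ominus> x \<otimes> y" using c by algebra
    ultimately show ?thesis using c yy by (simp add: SU_mult minus_eq)
  qed
  moreover have "(x, y \<otimes> \<sigma> x \<ominus> x \<otimes> y) \<otimes>\<^bsub>\<Gamma>\<^esub> (\<sigma> x, \<zero>) = (\<one>, y \<otimes> (\<one> \<ominus> x \<otimes> x))"
  proof -
    have "(y \<otimes> \<sigma> x \<ominus> x \<otimes> y) \<otimes> x = y \<otimes> (x \<otimes> \<sigma> x \<ominus> x \<otimes> x)" using c by algebra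
    then show ?thesis using c T_norm[OF x] by (simp add: SU_mult)
  qed
  ultimately show ?thesis unfolding i by simp
qed

text \<open>An element of \<open>T\<close> of prime order \<open>l\<close> dividing \<open>\<kappa> + 1\<close> acts on \<open>N\<close> without fixed points, and \<open>l\<close> does
  not divide the dimension of the module.\<close>

lemma linked_to_inflated:
  assumes card: "card (carrier \<Gamma>) = \<kappa> ^ (n - 1) * (\<kappa> - 1) * card B"
    and f: "minimal_idempotent (group_algebra \<Gamma>) f" and f1: "of_nat (card B) * f \<one>\<^bsub>\<Gamma>\<^esub> = 1"
  shows "\<exists>\<theta>\<in>chars. linked (group_algebra \<Gamma>) (character_idempotent B (inflate \<theta>)) f"
proof -
  have fa: "f \<in> SU.alg" "SU.conv f f = f" using f by (auto simp: SU.minimal_idempotent_iff)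
  \<comment> \<open>Such an \<open>l\<close> is odd because \<open>\<kappa>\<close> is even, it is
    prime to \<open>\<kappa>\<close>, and it cannot divide \<open>\<kappa> - 1\<close> without
    dividing 2. Hence it does not divide the dimension
    \<open>\<kappa> ^ (n - 1) * (\<kappa> - 1)\<close>.\<close>
  obtain l where l: "Factorial_Ring.prime l" "l dvd \<kappa> + 1" using prime_factor_nat[of "\<kappa> + 1"] kappa_gt_1 by auto
  have odd: "odd l" using l(2) even_kappa by (metis dvd_trans even_plus_one_iff)
  have cop: "coprime l \<kappa>"
  proof (rule coprimeI)
    fix c assume c: "c dvd l" "c dvd \<kappa>"
    have "c dvd \<kappa> + 1" using dvd_trans[OF c(1) l(2)] .
    then have "c dvd (\<kappa> + 1) - \<kappa>" using c(2) by (rule dvd_diff_nat)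
    then show "is_unit c" by simp
  qed
  have nd: "\<not> l dvd \<kappa> ^ (n - 1) * (\<kappa> - 1)"
  proof
    assume "l dvd \<kappa> ^ (n - 1) * (\<kappa> - 1)"
    moreover have "coprime l (\<kappa> ^ (n - 1))" using cop by simp
    ultimately have "l dvd \<kappa> - 1" using coprime_dvd_mult_right_iff by blast
    then have "l dvd (\<kappa> + 1) - (\<kappa> - 1)" using dvd_diff_nat[OF l(2)] by blast
    moreover have "(\<kappa> + 1) - (\<kappa> - 1) = 2" using kappa_gt_1 by simp
    ultimately have "l dvd 2" by simp
    then show False using odd l(1) by (metis primes_dvd_imp_eq two_is_prime_nat dvd_refl)
  qed
  obtain D where D: "subgroup D TG" "card D = l"
  proof -
    \<comment> \<open>Sylow's theorem is applied with exponent 1, so it yields a subgroup of order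
      exactly \<open>l\<close> whatever the power of \<open>l\<close> in
      \<open>card T\<close>.\<close>
    obtain m where m: "\<kappa> + 1 = l * m" using l(2) by blast
    then have "order TG = l ^ 1 * (\<kappa> ^ (n - 1) * m)" using card_T by (simp add: order_def)
    then show thesis using sylow_thm[OF l(1) TG.is_group, of 1] that finite_T by auto
  qed
  let ?D = "(\<lambda>x. (x, \<zero>)) ` D"
  have DT: "D \<subseteq> T" using subgroup.subset[OF D(1)] by simp
  have DB: "?D \<subseteq> B" using DT zero_in_pw by (auto simp: B_iff)
  have BG: "B \<subseteq> carrier \<Gamma>" using subgroup.subset[OF B_subgroup] .
  have sD: "subgroup ?D \<Gamma>"
  proof (rule SU.subgroupI)
    show "?D \<subseteq> carrier \<Gamma>" using DB BG by blast
    show "?D \<noteq> {}" using subgroup.one_closed[OF D(1)] by blast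
    fix a assume a: "a \<in> ?D"
    then obtain x where x: "x \<in> D" "a = (x, \<zero>)" by blast
    have xT: "x \<in> T" using x DT by blast
    have "a \<in> carrier \<Gamma>" using a DB BG by blast
    then have "inv\<^bsub>\<Gamma>\<^esub> a = (\<sigma> x, \<zero>)" using SU_inv x by simp
    moreover have "\<sigma> x \<in> D" using subgroup.m_inv_closed[OF D(1) x(1)] TG_inv[OF xT] by simp
    ultimately show "inv\<^bsub>\<Gamma>\<^esub> a \<in> ?D" by simp
    fix b assume "b \<in> ?D"
    then obtain x' where x': "x' \<in> D" "b = (x', \<zero>)" by blast
    have "a \<otimes>\<^bsub>\<Gamma>\<^esub> b = (x \<otimes> x', \<zero>)" using x x' DT T_closed by (simp add: SU_mult subset_iff)
    then show "a \<otimes>\<^bsub>\<Gamma>\<^esub> b \<in> ?D" using subgroup.m_closed[OF D(1) x(1) x'(1)] by simp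
  qed
  have cD: "card ?D = l" using D(2) by (subst card_image) (auto simp: inj_on_def)
  have bij: "bij_betw (\<lambda>g. g \<otimes>\<^bsub>\<Gamma>\<^esub> c \<otimes>\<^bsub>\<Gamma>\<^esub> inv\<^bsub>\<Gamma>\<^esub> g \<otimes>\<^bsub>\<Gamma>\<^esub> inv\<^bsub>\<Gamma>\<^esub> c) N N" if c: "c \<in> ?D" "c \<noteq> \<one>\<^bsub>\<Gamma>\<^esub>" for c
  proof -
    obtain x where x: "x \<in> D" "c = (x, \<zero>)" using c(1) by blast
    have x1: "x \<noteq> \<one>" using c(2) x(2) by (auto simp: SU_one)
    have xT: "x \<in> T" using x DT by blast
    let ?u = "\<one> \<ominus> x \<otimes> x"
    have u: "?u \<in> Units E" using one_minus_square_unit[OF l(1) odd cop D x(1) x1] .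
    have uc: "?u \<in> carrier E" using T_closed[OF xT] by simp
    let ?F = "\<lambda>g. g \<otimes>\<^bsub>\<Gamma>\<^esub> c \<otimes>\<^bsub>\<Gamma>\<^esub> inv\<^bsub>\<Gamma>\<^esub> g \<otimes>\<^bsub>\<Gamma>\<^esub> inv\<^bsub>\<Gamma>\<^esub> c"
    have F: "?F (\<one>, y) = (\<one>, y \<otimes> ?u)" if "y \<in> pw r" for y using commutator_N[OF xT that] x(2) by simp
    have "?F ` N \<subseteq> N" using F pw_mult(1) uc by (auto simp: N_def)
    moreover have "inj_on ?F N"
    proof (rule inj_onI)
      fix a b assume "a \<in> N" "b \<in> N" "?F a = ?F b"
      then obtain y w where yw: "a = (\<one>, y)" "b = (\<one>, w)" "y \<in> pw r" "w \<in> pw r" by (auto simp: N_def)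
      then have "y \<otimes> ?u = w \<otimes> ?u" using F \<open>?F a = ?F b\<close> by simp
      then have "?u \<otimes> y = ?u \<otimes> w" using uc yw pw_closed by (simp add: m_comm)
      then have "y = w" using Units_l_cancel[OF u] yw pw_closed by blast
      then show "a = b" using yw by simp
    qed
    moreover have "finite N" by (simp add: N_def finite_pw)
    ultimately show ?thesis by (simp add: bij_betw_def endo_inj_surj)
  qed
  let ?i = "\<lambda>x. if x \<in> N then 1 else (0::complex)"
  have "\<exists>g\<in>carrier \<Gamma>. SU.conv (SU.conv ?i (delta g)) f \<noteq> (\<lambda>x. 0)"
  proof (rule ccontr)
    assume "\<not> ?thesis"
    then have z: "\<And>g. g \<in> carrier \<Gamma> \<Longrightarrow> SU.conv (SU.conv ?i (delta g)) f = (\<lambda>x. 0)" by blast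
    \<comment> \<open>Without \<open>N\<close>-invariants the dimension would be a multiple of
      \<open>l\<close>; the value of \<open>f\<close> at the identity makes it the index of
      \<open>B\<close>.\<close>
    obtain m :: nat where m: "of_nat (card (carrier \<Gamma>)) * f \<one>\<^bsub>\<Gamma>\<^esub> = of_nat (card ?D * m)"
      by (rule SU.card_dvd_dimension[OF N_subgroup sD bij fa z])
    have "of_nat (card (carrier \<Gamma>)) * f \<one>\<^bsub>\<Gamma>\<^esub> = of_nat (\<kappa> ^ (n - 1) * (\<kappa> - 1)) * (of_nat (card B) * f \<one>\<^bsub>\<Gamma>\<^esub>)"
      unfolding card by (simp only: of_nat_mult mult.assoc)
    then have "(of_nat (\<kappa> ^ (n - 1) * (\<kappa> - 1)) :: complex) = of_nat (l * m)" using m f1 cD by simp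
    then have "\<kappa> ^ (n - 1) * (\<kappa> - 1) = l * m" by (simp only: of_nat_eq_iff)
    then show False using nd by simp
  qed
  then obtain g where g: "g \<in> carrier \<Gamma>" "SU.conv (SU.conv ?i (delta g)) f \<noteq> (\<lambda>x. 0)" by blast
  let ?k = "of_nat (card B) / of_nat (card T) :: complex"
  have B0: "of_nat (card B) \<noteq> (0::complex)" using SU.card_subgroup_pos[OF B_subgroup] by simp
  have T0: "of_nat (card T) \<noteq> (0::complex)" using T_one finite_T by auto
  \<comment> \<open>By character orthogonality on \<open>T\<close>, the indicator of
    \<open>N\<close> is a multiple of the sum of all inflated idempotents; one of them must then act
    nontrivially on the module.\<close>
  have ind: "?i = (\<lambda>x. \<Sum>\<theta>\<in>chars. ?k * character_idempotent B (inflate \<theta>) x)"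
  proof
    fix h :: "'a \<times> 'a"
    obtain x z where h: "h = (x, z)" by (cases h)
    show "?i h = (\<Sum>\<theta>\<in>chars. ?k * character_idempotent B (inflate \<theta>) h)"
    proof (cases "x \<in> T \<and> z \<in> pw r")
      case True
      have "(\<Sum>\<theta>\<in>chars. ?k * character_idempotent B (inflate \<theta>) h) = (\<Sum>\<theta>\<in>chars. inverse (of_nat (card T)) * \<theta> (\<sigma> x))"
        using True B0 T0 chars_conj by (intro sum.cong) (auto simp: character_idempotent_def inflate_def h field_simps)
      also have "\<dots> = inverse (of_nat (card T)) * (\<Sum>\<theta>\<in>chars. \<theta> (\<sigma> x))" by (simp add: sum_distrib_left)
      also have "(\<Sum>\<theta>\<in>chars. \<theta> (\<sigma> x)) = (if \<sigma> x = \<one> then of_nat (card T) else 0)"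
        using TG.sum_characters[of "\<sigma> x"] finite_T T_conj True by simp
      also have "\<sigma> x = \<one> \<longleftrightarrow> x = \<one>"
      proof
        assume "\<sigma> x = \<one>"
        then have "\<sigma> (\<sigma> x) = \<one>" by simp
        then show "x = \<one>" using conj_conj[of x] True T_closed[of x] by simp
      qed simp
      finally show ?thesis using True T0 by (simp add: h N_def)
    next
      case False
      then have "character_idempotent B (inflate \<theta>) h = 0" if "\<theta> \<in> chars" for \<theta>
        using characters_onD(3)[OF that] by (auto simp: character_idempotent_def inflate_def h)
      then show ?thesis using False T_one by (auto simp: h N_def)
    qed
  qed
  have "\<exists>\<theta>\<in>chars. SU.conv (SU.conv (character_idempotent B (inflate \<theta>)) (delta g)) f \<noteq> (\<lambda>x. 0)"
  proof (rule ccontr)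
    assume "\<not> ?thesis"
    then have "SU.conv (SU.conv ?i (delta g)) f = (\<lambda>x. 0)"
      unfolding ind SU.conv_sum_left by simp
    then show False using g(2) by simp
  qed
  then show ?thesis
    using SU.linked_iff[OF SU.character_idempotent_closed[OF B_subgroup inflate_character] fa(1)]
      SU.delta_closed[OF g(1)] by blast
qed

text \<open>The module of \<open>f\<close> is linked to some inflated \<open>\<theta>\<close>. Equal
  dimensions make the idempotent of \<open>\<theta>\<close> minimal, and in characteristic 2
  minimality excludes imprimitive and self-inverse \<open>\<theta>\<close>.\<close>

lemma minimal_idempotent_exhaustion:
  assumes char2: "\<one> \<oplus> \<one> = \<zero>" and r: "2 \<le> r"
    and card: "card (carrier \<Gamma>) = \<kappa> ^ (n - 1) * (\<kappa> - 1) * card B"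
    and f: "minimal_idempotent (group_algebra \<Gamma>) f" and f1: "of_nat (card B) * f \<one>\<^bsub>\<Gamma>\<^esub> = 1"
  shows "\<exists>\<chi>\<in>inflate ` {\<theta> \<in> prim. inverse_character \<theta> \<noteq> \<theta>}.
    minimal_idempotent (group_algebra \<Gamma>) (character_idempotent B \<chi>) \<and>
    linked (group_algebra \<Gamma>) (character_idempotent B \<chi>) f"
proof -
  obtain \<theta> where \<theta>: "\<theta> \<in> chars" "linked (group_algebra \<Gamma>) (character_idempotent B (inflate \<theta>)) f"
    using linked_to_inflated[OF card f f1] by blast
  let ?e = "character_idempotent B (inflate \<theta>)"
  note ch = inflate_character[OF \<theta>(1)]
  have "?e \<one>\<^bsub>\<Gamma>\<^esub> = f \<one>\<^bsub>\<Gamma>\<^esub>"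
    using f1 SU.character_idempotent_one[OF B_subgroup ch] by (metis inverse_unique mult.commute)
  then have m: "minimal_idempotent (group_algebra \<Gamma>) ?e"
    using SU.minimal_idempotent_of_linked[OF f SU.character_idempotent_closed[OF B_subgroup ch]
      SU.character_idempotent_idem[OF B_subgroup ch] \<theta>(2)] by blast
  then have "\<theta> \<in> prim" "inverse_character \<theta> \<noteq> \<theta>"
    using not_minimal_imprimitive[OF char2 r \<theta>(1)] not_minimal_self_inverse[OF char2 r \<theta>(1)] by blast+
  then show ?thesis using m \<theta>(2) by blast
qed

end

text \<open>The counting criterion is applied with all primitive characters on the side of
  \<open>E\<close> and with those that are not self-inverse on the side of \<open>E'\<close>. The
  group orders enter as assumptions because they are obtained through the isomorphism with
  \<open>SL2\<close>.\<close>

lemma SU_algebras_not_isomorphic: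
  assumes "unramified_ring E \<pi> n \<sigma> \<omega> r \<kappa>" "unramified_ring E' \<pi>' n \<sigma>' \<omega>' r \<kappa>"
    and two: "\<one>\<^bsub>E\<^esub> \<oplus>\<^bsub>E\<^esub> \<one>\<^bsub>E\<^esub> = \<pi> [^]\<^bsub>E\<^esub> e \<otimes>\<^bsub>E\<^esub> \<epsilon>" "\<epsilon> \<in> Units E" "\<sigma> \<epsilon> = \<epsilon>" "e < r"
    and char2: "\<one>\<^bsub>E'\<^esub> \<oplus>\<^bsub>E'\<^esub> \<one>\<^bsub>E'\<^esub> = \<zero>\<^bsub>E'\<^esub>" "2 \<le> r"
    and card: "card (carrier (SU E \<sigma>)) = \<kappa> ^ (n - 1) * (\<kappa> - 1) * (\<kappa> ^ (n - 1) * (\<kappa> + 1) * \<kappa> ^ n)"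
      "card (carrier (SU E' \<sigma>')) = \<kappa> ^ (n - 1) * (\<kappa> - 1) * (\<kappa> ^ (n - 1) * (\<kappa> + 1) * \<kappa> ^ n)"
  shows "\<not> complex_algebras_isomorphic (group_algebra (SU E \<sigma>)) (group_algebra (SU E' \<sigma>'))"
proof -
  interpret A: unramified_ring E \<pi> n \<sigma> \<omega> r \<kappa> by fact
  interpret C: unramified_ring E' \<pi>' n \<sigma>' \<omega>' r \<kappa> by fact
  have cB: "card A.B = \<kappa> ^ (n - 1) * (\<kappa> + 1) * \<kappa> ^ n" "card C.B = \<kappa> ^ (n - 1) * (\<kappa> + 1) * \<kappa> ^ n"
    using A.card_B A.card_T C.card_B C.card_T A.n_eq by simp_all
  let ?S = "{\<theta> \<in> C.prim. inverse_character \<theta> \<noteq> \<theta>}"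
  have finp: "finite A.prim" "finite C.prim"
    using A.finite_chars C.finite_chars by (auto simp: A.prim_def C.prim_def)
  show ?thesis
  proof (rule group_algebras_not_isomorphic[OF A.SU.finite_group_axioms C.SU.finite_group_axioms
        A.B_subgroup C.B_subgroup, of "A.inflate ` A.prim" "C.inflate ` ?S"])
    show "card (carrier A.\<Gamma>) * card C.B = card (carrier C.\<Gamma>) * card A.B"
      unfolding card cB ..
    show "finite (A.inflate ` A.prim)" "finite (C.inflate ` ?S)" using finp by auto
    show "A.inflate ` A.prim \<subseteq> characters_on A.\<Gamma> A.B" "C.inflate ` ?S \<subseteq> characters_on C.\<Gamma> C.B"
      using A.inflate_character C.inflate_character by (auto simp: A.prim_def C.prim_def)
    have self: "inverse_character \<theta> \<noteq> \<theta>" if "\<theta> \<in> A.prim" for \<theta>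
      using A.primitive_not_self_inverse[OF two that] .
    show "g \<in> A.B" if x: "\<chi> \<in> A.inflate ` A.prim" "g \<in> carrier A.\<Gamma>" "intertwines A.\<Gamma> A.B \<chi> \<chi> g" for \<chi> g
    proof -
      obtain \<theta> where t: "\<theta> \<in> A.prim" "\<chi> = A.inflate \<theta>" using x(1) by (rule imageE)
      show ?thesis using A.intertwines_primitive[OF t(1) t(1) x(2)] x(3) self[OF t(1)] t(2) by auto
    qed
    show "\<chi>' \<in> {\<chi>, inverse_character \<chi>}"
      if x: "\<chi> \<in> A.inflate ` A.prim" "\<chi>' \<in> A.inflate ` A.prim" "g \<in> carrier A.\<Gamma>" "intertwines A.\<Gamma> A.B \<chi> \<chi>' g"
      for \<chi> \<chi>' g
    proof -
      obtain \<theta> where t: "\<theta> \<in> A.prim" "\<chi> = A.inflate \<theta>" using x(1) by (rule imageE)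
      obtain \<theta>' where t': "\<theta>' \<in> A.prim" "\<chi>' = A.inflate \<theta>'" using x(2) by (rule imageE)
      have "\<theta>' = \<theta> \<or> \<theta>' = inverse_character \<theta>"
        using A.intertwines_primitive[OF t(1) t'(1) x(3)] x(4) t(2) t'(2) by auto
      then show ?thesis using t(2) t'(2) by (auto simp: A.inflate_inverse)
    qed
    show "inverse_character \<chi> \<in> C.inflate ` ?S \<and> inverse_character \<chi> \<noteq> \<chi>" if x: "\<chi> \<in> C.inflate ` ?S" for \<chi>
    proof -
      obtain \<theta> where t: "\<chi> = C.inflate \<theta>" "\<theta> \<in> ?S" using x by (rule imageE)
      have S: "inverse_character \<theta> \<in> ?S" using t(2) C.prim_inverse[of \<theta>] by auto
      have e: "inverse_character \<chi> = C.inflate (inverse_character \<theta>)" by (simp add: t(1) C.inflate_inverse)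
      have "inverse_character \<chi> \<in> C.inflate ` ?S" unfolding e using S by (rule imageI)
      moreover have "inverse_character \<chi> \<noteq> \<chi>"
        unfolding e unfolding t(1) C.inflate_inj using t(2) by simp
      ultimately show ?thesis by blast
    qed
    show "\<exists>g\<in>carrier C.\<Gamma>. intertwines C.\<Gamma> C.B \<chi> (inverse_character \<chi>) g" if x: "\<chi> \<in> C.inflate ` ?S" for \<chi>
    proof -
      obtain \<theta> where t: "\<chi> = C.inflate \<theta>" "\<theta> \<in> ?S" using x by (rule imageE)
      then have "\<theta> \<in> C.chars" by (simp add: C.prim_def)
      then show ?thesis
        unfolding t(1) C.inflate_inverse using C.intertwines_conj(1,3)[OF char2] by blast
    qed
    show "\<exists>\<chi>\<in>C.inflate ` ?S. minimal_idempotent (group_algebra C.\<Gamma>) (character_idempotent C.B \<chi>) \<and>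
          linked (group_algebra C.\<Gamma>) (character_idempotent C.B \<chi>) f"
      if "minimal_idempotent (group_algebra C.\<Gamma>) f" "of_nat (card C.B) * f \<one>\<^bsub>C.\<Gamma>\<^esub> = 1" for f
      using C.minimal_idempotent_exhaustion[OF char2 _ that] card(2) cB(2) by simp
    \<comment> \<open>Both rings have the same number of primitive characters; the self-inverse ones
      that exist for \<open>E'\<close> make the difference.\<close>
    have "card A.prim * \<kappa> = card C.prim * \<kappa>"
      using A.card_prim C.card_prim A.card_T C.card_T by simp
    then have "card C.prim = card A.prim" using A.kappa_gt_1 by simp
    moreover have "card ?S < card C.prim"
      using C.primitive_self_inverse_exists[OF char2] finp by (intro psubset_card_mono) auto
    moreover have "card (A.inflate ` A.prim) = card A.prim" "card (C.inflate ` ?S) = card ?S"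
      by (auto intro!: card_image simp: inj_on_def A.inflate_inj C.inflate_inj)
    ultimately show "card (C.inflate ` ?S) < card (A.inflate ` A.prim)" by simp
  qed
qed

section \<open>The isomorphism of \<open>SU\<close> and \<open>SL\<^sub>2\<close>\<close>

text \<open>The pair \<open>(u, v)\<close> stands for \<open>u + v \<omega>\<close>, where \<open>\<omega>\<^sup>2 = \<omega> + \<delta>\<close>.\<close>

definition quadratic_extension :: "('a, 'm) ring_scheme \<Rightarrow> 'a \<Rightarrow> ('a \<times> 'a) ring" where
  "quadratic_extension S \<delta> = \<lparr>
     carrier = carrier S \<times> carrier S,
     monoid.mult = (\<lambda>(u, v) (u', v'). (u \<otimes>\<^bsub>S\<^esub> u' \<oplus>\<^bsub>S\<^esub> \<delta> \<otimes>\<^bsub>S\<^esub> (v \<otimes>\<^bsub>S\<^esub> v'),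
       u \<otimes>\<^bsub>S\<^esub> v' \<oplus>\<^bsub>S\<^esub> v \<otimes>\<^bsub>S\<^esub> u' \<oplus>\<^bsub>S\<^esub> v \<otimes>\<^bsub>S\<^esub> v')),
     one = (\<one>\<^bsub>S\<^esub>, \<zero>\<^bsub>S\<^esub>),
     ring.zero = (\<zero>\<^bsub>S\<^esub>, \<zero>\<^bsub>S\<^esub>),
     ring.add = (\<lambda>(u, v) (u', v'). (u \<oplus>\<^bsub>S\<^esub> u', v \<oplus>\<^bsub>S\<^esub> v'))\<rparr>"

text \<open>The other root of \<open>X^2 - X - \<delta>\<close> is \<open>1 - \<omega>\<close>, so
  \<open>u + v \<omega>\<close> goes to \<open>(u + v) - v \<omega>\<close>.\<close>

definition quadratic_conj :: "('a, 'm) ring_scheme \<Rightarrow> 'a \<times> 'a \<Rightarrow> 'a \<times> 'a" where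
  "quadratic_conj S = (\<lambda>(u, v). (u \<oplus>\<^bsub>S\<^esub> v, \<ominus>\<^bsub>S\<^esub> v))"

text \<open>Irreducibility of \<open>X^2 - X - \<delta>\<close> over the residue field is stated as
  the absence of a root there. This polynomial stays separable in residue characteristic 2, so the
  same extension serves both rings.\<close>

locale artin_schreier = chain_ring S \<pi> n for S (structure) and \<pi> n +
  fixes \<delta> and r :: nat
  assumes delta_closed [simp]: "\<delta> \<in> carrier S"
    and irreducible: "x \<in> carrier S \<Longrightarrow> x \<otimes> x \<ominus> x \<ominus> \<delta> \<in> Units S"
    and residue_char: "\<one> \<oplus> \<one> \<in> pw 1"
    and n_eq: "n = 2 * r"
begin

abbreviation Q where "Q \<equiv> quadratic_extension S \<delta>"
abbreviation cj where "cj \<equiv> quadratic_conj S"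

lemma Q_simps: "carrier Q = carrier S \<times> carrier S"
  "(u, v) \<otimes>\<^bsub>Q\<^esub> (u', v') = (u \<otimes> u' \<oplus> \<delta> \<otimes> (v \<otimes> v'), u \<otimes> v' \<oplus> v \<otimes> u' \<oplus> v \<otimes> v')"
  "(u, v) \<oplus>\<^bsub>Q\<^esub> (u', v') = (u \<oplus> u', v \<oplus> v')"
  "\<one>\<^bsub>Q\<^esub> = (\<one>, \<zero>)" "\<zero>\<^bsub>Q\<^esub> = (\<zero>, \<zero>)"
  "cj (u, v) = (u \<oplus> v, \<ominus> v)"
  by (simp_all add: quadratic_extension_def quadratic_conj_def)

lemma Q_cring: "cring Q"
proof (rule cringI)
  show "abelian_group Q"
  proof (rule abelian_groupI)
    fix x assume "x \<in> carrier Q"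
    then obtain u v where "x = (u, v)" "u \<in> carrier S" "v \<in> carrier S" by (auto simp: Q_simps)
    then show "\<exists>y\<in>carrier Q. y \<oplus>\<^bsub>Q\<^esub> x = \<zero>\<^bsub>Q\<^esub>"
      by (intro bexI[of _ "(\<ominus> u, \<ominus> v)"]) (auto simp: Q_simps l_neg)
  qed (auto simp: Q_simps a_ac)
  show "Group.comm_monoid Q"
  proof (rule Group.comm_monoidI)
    fix x y z assume "x \<in> carrier Q" "y \<in> carrier Q" "z \<in> carrier Q"
    then obtain a b c d e f where e: "x = (a, b)" "y = (c, d)" "z = (e, f)" "a \<in> carrier S" "b \<in> carrier S"
      "c \<in> carrier S" "d \<in> carrier S" "e \<in> carrier S" "f \<in> carrier S" by (auto simp: Q_simps)
    have "(a \<otimes> c \<oplus> \<delta> \<otimes> (b \<otimes> d)) \<otimes> e \<oplus> \<delta> \<otimes> ((a \<otimes> d \<oplus> b \<otimes> c \<oplus> b \<otimes> d) \<otimes> f)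
      = a \<otimes> (c \<otimes> e \<oplus> \<delta> \<otimes> (d \<otimes> f)) \<oplus> \<delta> \<otimes> (b \<otimes> (c \<otimes> f \<oplus> d \<otimes> e \<oplus> d \<otimes> f))"
      "(a \<otimes> c \<oplus> \<delta> \<otimes> (b \<otimes> d)) \<otimes> f \<oplus> (a \<otimes> d \<oplus> b \<otimes> c \<oplus> b \<otimes> d) \<otimes> e \<oplus> (a \<otimes> d \<oplus> b \<otimes> c \<oplus> b \<otimes> d) \<otimes> f
      = a \<otimes> (c \<otimes> f \<oplus> d \<otimes> e \<oplus> d \<otimes> f) \<oplus> b \<otimes> (c \<otimes> e \<oplus> \<delta> \<otimes> (d \<otimes> f)) \<oplus> b \<otimes> (c \<otimes> f \<oplus> d \<otimes> e \<oplus> d \<otimes> f)"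
      using e(4-) delta_closed by algebra+
    then show "x \<otimes>\<^bsub>Q\<^esub> y \<otimes>\<^bsub>Q\<^esub> z = x \<otimes>\<^bsub>Q\<^esub> (y \<otimes>\<^bsub>Q\<^esub> z)" by (simp add: e(1-3) Q_simps)
  qed (auto simp: Q_simps m_comm a_comm)
  fix x y z assume "x \<in> carrier Q" "y \<in> carrier Q" "z \<in> carrier Q"
  then obtain a b c d e f where e: "x = (a, b)" "y = (c, d)" "z = (e, f)" "a \<in> carrier S" "b \<in> carrier S"
    "c \<in> carrier S" "d \<in> carrier S" "e \<in> carrier S" "f \<in> carrier S" by (auto simp: Q_simps)
  have "(a \<oplus> c) \<otimes> e \<oplus> \<delta> \<otimes> ((b \<oplus> d) \<otimes> f) = (a \<otimes> e \<oplus> \<delta> \<otimes> (b \<otimes> f)) \<oplus> (c \<otimes> e \<oplus> \<delta> \<otimes> (d \<otimes> f))"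
    "(a \<oplus> c) \<otimes> f \<oplus> (b \<oplus> d) \<otimes> e \<oplus> (b \<oplus> d) \<otimes> f
      = (a \<otimes> f \<oplus> b \<otimes> e \<oplus> b \<otimes> f) \<oplus> (c \<otimes> f \<oplus> d \<otimes> e \<oplus> d \<otimes> f)"
    using e(4-) delta_closed by algebra+
  then show "(x \<oplus>\<^bsub>Q\<^esub> y) \<otimes>\<^bsub>Q\<^esub> z = x \<otimes>\<^bsub>Q\<^esub> z \<oplus>\<^bsub>Q\<^esub> y \<otimes>\<^bsub>Q\<^esub> z" by (simp add: e(1-3) Q_simps)
qed

sublocale Q: cring Q by (rule Q_cring)

lemma Q_pow: "(\<pi>, \<zero>) [^]\<^bsub>Q\<^esub> (i::nat) = (\<pi> [^] i, \<zero>)"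
  by (induction i) (simp_all add: Q_simps)

text \<open>The inverse is the conjugate divided by the norm
  \<open>u^2 + u v - \<delta> v^2\<close>. If \<open>v\<close> is a unit, the norm is
  \<open>v^2\<close> times the value of the polynomial at \<open>- u / v\<close>; otherwise it is
  congruent to \<open>u^2\<close>.\<close>

lemma Q_unit:
  assumes x: "u \<in> carrier S" "v \<in> carrier S" and u: "u \<in> Units S \<or> v \<in> Units S"
  shows "(u, v) \<in> Units Q"
proof -
  let ?N = "u \<otimes> u \<oplus> u \<otimes> v \<ominus> \<delta> \<otimes> (v \<otimes> v)"
  have N: "?N \<in> Units S"
  proof (cases "v \<in> Units S")
    case True
    have ic: "inv v \<in> carrier S" using True by simp
    let ?x = "\<ominus> (u \<otimes> inv v)"
    have xc: "?x \<in> carrier S" using x ic by simp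
    have vu: "v \<otimes> inv v = \<one>" using True by simp
    have "(v \<otimes> v) \<otimes> (?x \<otimes> ?x \<ominus> ?x \<ominus> \<delta>) = (u \<otimes> u) \<otimes> ((v \<otimes> inv v) \<otimes> (v \<otimes> inv v)) \<oplus> u \<otimes> v \<otimes> (v \<otimes> inv v) \<ominus> \<delta> \<otimes> (v \<otimes> v)"
      using x ic delta_closed by algebra
    also have "\<dots> = ?N" unfolding vu using x by simp
    finally have "(v \<otimes> v) \<otimes> (?x \<otimes> ?x \<ominus> ?x \<ominus> \<delta>) = ?N" .
    moreover have "(v \<otimes> v) \<otimes> (?x \<otimes> ?x \<ominus> ?x \<ominus> \<delta>) \<in> Units S"
      using irreducible[OF xc] True by (intro Units_m_closed) auto
    ultimately show ?thesis by simp
  next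
    case False
    then have uu: "u \<in> Units S" using u by simp
    have v1: "v \<in> pw 1" using False unit_iff x by simp
    have "v \<otimes> (u \<ominus> \<delta> \<otimes> v) \<in> pw 1" using pw_mult(1)[OF v1] x by simp
    then have "u \<otimes> u \<oplus> v \<otimes> (u \<ominus> \<delta> \<otimes> v) \<in> Units S" using uu by (intro unit_add_pw) auto
    moreover have "u \<otimes> u \<oplus> v \<otimes> (u \<ominus> \<delta> \<otimes> v) = ?N" using x delta_closed by algebra
    ultimately show ?thesis by simp
  qed
  have Nc: "?N \<in> carrier S" "inv ?N \<in> carrier S" using N by auto
  have "u \<otimes> (u \<oplus> v) \<oplus> \<delta> \<otimes> (v \<otimes> (\<ominus> v)) = ?N" "u \<otimes> (\<ominus> v) \<oplus> v \<otimes> (u \<oplus> v) \<oplus> v \<otimes> (\<ominus> v) = \<zero>"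
    using x delta_closed by algebra+
  then have "(u, v) \<otimes>\<^bsub>Q\<^esub> (u \<oplus> v, \<ominus> v) = (?N, \<zero>)" by (simp add: Q_simps)
  then have "((u, v) \<otimes>\<^bsub>Q\<^esub> (u \<oplus> v, \<ominus> v)) \<otimes>\<^bsub>Q\<^esub> (inv ?N, \<zero>) = \<one>\<^bsub>Q\<^esub>"
    using N Nc by (simp add: Q_simps)
  then have "(u, v) \<otimes>\<^bsub>Q\<^esub> ((u \<oplus> v, \<ominus> v) \<otimes>\<^bsub>Q\<^esub> (inv ?N, \<zero>)) = \<one>\<^bsub>Q\<^esub>"
    using x Nc by (subst (asm) Q.m_assoc) (auto simp: Q_simps)
  moreover have "(u \<oplus> v, \<ominus> v) \<otimes>\<^bsub>Q\<^esub> (inv ?N, \<zero>) \<in> carrier Q" using x Nc by (auto simp: Q_simps)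
  moreover have "(u, v) \<in> carrier Q" using x by (simp add: Q_simps)
  ultimately show ?thesis unfolding Units_def using Q.m_comm by fastforce
qed

sublocale Q: chain_ring Q "(\<pi>, \<zero>)" n
proof (unfold_locales)
  show "finite (carrier Q)" using finite_carrier by (simp add: Q_simps)
  show "(\<pi>, \<zero>) \<in> carrier Q" by (simp add: Q_simps)
  show "(\<pi>, \<zero>) [^]\<^bsub>Q\<^esub> n = \<zero>\<^bsub>Q\<^esub>" using pi_pow_n by (simp add: Q_pow) (simp add: Q_simps)
  show "(\<pi>, \<zero>) [^]\<^bsub>Q\<^esub> (n - 1) \<noteq> \<zero>\<^bsub>Q\<^esub>" using pi_pow_pred by (simp add: Q_pow) (simp add: Q_simps)
  show "0 < n" by (rule n_pos)
  fix x assume "x \<in> carrier Q"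
  then obtain u v where x: "x = (u, v)" "u \<in> carrier S" "v \<in> carrier S" by (auto simp: Q_simps)
  show "x \<in> Units Q \<or> (\<exists>y\<in>carrier Q. x = (\<pi>, \<zero>) \<otimes>\<^bsub>Q\<^esub> y)"
  proof (cases "u \<in> Units S \<or> v \<in> Units S")
    case False
    then obtain a b where "a \<in> carrier S" "u = \<pi> \<otimes> a" "b \<in> carrier S" "v = \<pi> \<otimes> b"
      using unit_or_multiple x by blast
    then have "x = (\<pi>, \<zero>) \<otimes>\<^bsub>Q\<^esub> (a, b)" "(a, b) \<in> carrier Q" using x by (simp_all add: Q_simps)
    then show ?thesis by blast
  qed (use Q_unit x in blast)
qed

lemma Q_pw: "Q.pw i = pw i \<times> pw i"
proof -
  have "(\<pi> [^] i, \<zero>) \<otimes>\<^bsub>Q\<^esub> (a, b) = (\<pi> [^] i \<otimes> a, \<pi> [^] i \<otimes> b)" if "a \<in> carrier S" "b \<in> carrier S" for a b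
    using that by (simp add: Q_simps)
  then show ?thesis
    unfolding Q.pw_def pw_def Q_pow by (force simp: Q_simps(1) image_iff)
qed

lemma cj_fixed: "u \<in> carrier S \<Longrightarrow> v \<in> carrier S \<Longrightarrow> cj (u, v) = (u, v) \<longleftrightarrow> v = \<zero>"
  using add.l_cancel[of u v \<zero>] by (auto simp: Q_simps)

lemma Q_fixed_units: "{x \<in> Units Q. cj x = x} = Units S \<times> {\<zero>}"
proof (intro equalityI subsetI)
  fix x assume x: "x \<in> {x \<in> Units Q. cj x = x}"
  then have xc: "x \<in> carrier Q" by auto
  then obtain u v where e: "x = (u, v)" "u \<in> carrier S" "v \<in> carrier S" by (auto simp: Q_simps)
  then have v: "v = \<zero>" using x cj_fixed by simp
  have "u \<notin> pw 1"
  proof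
    assume "u \<in> pw 1"
    then have "x \<in> Q.pw 1" using e v zero_in_pw by (simp add: Q_pw)
    then show False using x Q.unit_iff[OF xc] by simp
  qed
  then show "x \<in> Units S \<times> {\<zero>}" using unit_iff e v by simp
next
  fix x assume "x \<in> Units S \<times> {\<zero>}"
  then obtain u where u: "u \<in> Units S" "u \<in> carrier S" "x = (u, \<zero>)" by auto
  then show "x \<in> {x \<in> Units Q. cj x = x}" using Q_unit[of u \<zero>] cj_fixed[of u \<zero>] by simp
qed

text \<open>The fixed ring of \<open>cj\<close> is the copy of \<open>S\<close> in the first
  coordinate, so \<open>\<kappa>\<close> is the residue field order \<open>q\<close> of
  \<open>S\<close>. The element \<open>\<omega>\<close> has trace 1 because it is a root of
  \<open>X^2 - X - \<delta>\<close>.\<close>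

lemma unramified_Q: "unramified_ring Q (\<pi>, \<zero>) n cj (\<zero>, \<one>) r q"
proof (unfold_locales)
  show "cj \<in> ring_hom Q Q"
  proof (rule ring_hom_memI)
    fix x y assume "x \<in> carrier Q" "y \<in> carrier Q"
    then obtain a b c d where e: "x = (a, b)" "y = (c, d)" "a \<in> carrier S" "b \<in> carrier S"
      "c \<in> carrier S" "d \<in> carrier S" by (auto simp: Q_simps)
    show "cj x \<in> carrier Q" using e by (simp add: Q_simps)
    have "a \<otimes> c \<oplus> \<delta> \<otimes> (b \<otimes> d) \<oplus> (a \<otimes> d \<oplus> b \<otimes> c \<oplus> b \<otimes> d) = (a \<oplus> b) \<otimes> (c \<oplus> d) \<oplus> \<delta> \<otimes> (\<ominus> b \<otimes> \<ominus> d)"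
      "\<ominus> (a \<otimes> d \<oplus> b \<otimes> c \<oplus> b \<otimes> d) = (a \<oplus> b) \<otimes> (\<ominus> d) \<oplus> (\<ominus> b) \<otimes> (c \<oplus> d) \<oplus> (\<ominus> b) \<otimes> (\<ominus> d)"
      using e(3-) delta_closed by algebra+
    then show "cj (x \<otimes>\<^bsub>Q\<^esub> y) = cj x \<otimes>\<^bsub>Q\<^esub> cj y" by (simp add: e(1,2) Q_simps)
    have "a \<oplus> c \<oplus> (b \<oplus> d) = a \<oplus> b \<oplus> (c \<oplus> d)" "\<ominus> (b \<oplus> d) = \<ominus> b \<oplus> \<ominus> d" using e(3-) by algebra+
    then show "cj (x \<oplus>\<^bsub>Q\<^esub> y) = cj x \<oplus>\<^bsub>Q\<^esub> cj y" by (simp add: e(1,2) Q_simps)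
  qed (simp add: Q_simps)
  show "cj (cj x) = x" if "x \<in> carrier Q" for x
    using that by (cases x) (auto simp: Q_simps a_assoc r_neg)
  show "cj (\<pi>, \<zero>) = (\<pi>, \<zero>)" by (simp add: Q_simps)
  show "(\<zero>, \<one>) \<in> carrier Q" by (simp add: Q_simps)
  show "(\<zero>, \<one>) \<oplus>\<^bsub>Q\<^esub> cj (\<zero>, \<one>) = \<one>\<^bsub>Q\<^esub>" by (simp add: Q_simps r_neg)
  show "n = 2 * r" by (rule n_eq)
  show "\<one>\<^bsub>Q\<^esub> \<oplus>\<^bsub>Q\<^esub> \<one>\<^bsub>Q\<^esub> \<in> Q.pw 1" using residue_char zero_in_pw by (simp add: Q_pw) (simp add: Q_simps)
  show "Q.q = q ^ 2" by (simp add: Q.q_def q_def Q_pw card_cartesian_product power2_eq_square)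
  show "card {x \<in> Units Q. cj x = x} = q ^ n - q ^ (n - 1)"
    by (simp add: Q_fixed_units card_cartesian_product card_Units)
  have "{x \<in> Q.pw (n - 1). cj x = x} = pw (n - 1) \<times> {\<zero>}"
  proof (rule Set.set_eqI)
    fix x :: "'a \<times> 'a"
    obtain u v where x: "x = (u, v)" by (cases x)
    show "x \<in> {x \<in> Q.pw (n - 1). cj x = x} \<longleftrightarrow> x \<in> pw (n - 1) \<times> {\<zero>}"
      using cj_fixed[of u v] zero_in_pw pw_closed[of u "n - 1"] pw_closed[of v "n - 1"]
      by (auto simp: x Q_pw)
  qed
  then show "card {x \<in> Q.pw (n - 1). cj x = x} = q" by (simp add: card_cartesian_product q_def)
qed

end

section \<open>The order of the special linear group\<close>

context chain_ring
begin

lemma SL2_iff: "(a, b, c, d) \<in> carrier (SL2 S) \<longleftrightarrow>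
    a \<in> carrier S \<and> b \<in> carrier S \<and> c \<in> carrier S \<and> d \<in> carrier S \<and> a \<otimes> d \<ominus> b \<otimes> c = \<one>"
  by (simp add: SL2_def)

lemma SL2_finite_group: "finite_group (SL2 S)"
proof -
  have "carrier (SL2 S) \<subseteq> carrier S \<times> carrier S \<times> carrier S \<times> carrier S" by (auto simp: SL2_def)
  then have "finite (carrier (SL2 S))" by (rule finite_subset) (simp add: finite_carrier)
  then show ?thesis using SL2_group by (simp add: finite_group_def finite_group_axioms_def)
qed

text \<open>If \<open>a\<close> is a unit, \<open>b\<close> and \<open>c\<close> are free and
  \<open>d\<close> is determined.\<close>

lemma card_SL2_unit: "card {g \<in> carrier (SL2 S). fst g \<in> Units S} = card (Units S) * (q ^ n * q ^ n)"
proof -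
  let ?f = "\<lambda>(a, b, c). (a, b, c, inv a \<otimes> (\<one> \<oplus> b \<otimes> c))"
  have "bij_betw ?f (Units S \<times> carrier S \<times> carrier S) {g \<in> carrier (SL2 S). fst g \<in> Units S}"
  proof (rule bij_betw_byWitness[of _ "\<lambda>(a, b, c, d). (a, b, c)"])
    show "\<forall>x\<in>Units S \<times> carrier S \<times> carrier S. (case ?f x of (a, b, c, d) \<Rightarrow> (a, b, c)) = x" by auto
    show "\<forall>g\<in>{g \<in> carrier (SL2 S). fst g \<in> Units S}. ?f (case g of (a, b, c, d) \<Rightarrow> (a, b, c)) = g"
    proof
      fix g assume g: "g \<in> {g \<in> carrier (SL2 S). fst g \<in> Units S}"
      obtain a b c d where e: "g = (a, b, c, d)" by (cases g)
      have x: "a \<in> carrier S" "b \<in> carrier S" "c \<in> carrier S" "d \<in> carrier S"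
        "a \<otimes> d \<ominus> b \<otimes> c = \<one>" "a \<in> Units S" "inv a \<in> carrier S" using g by (auto simp: e SL2_iff)
      have "\<one> \<oplus> b \<otimes> c = a \<otimes> d" unfolding x(5)[symmetric] using x(1-4) by algebra
      then have "inv a \<otimes> (\<one> \<oplus> b \<otimes> c) = d" using x by (simp add: m_assoc[symmetric])
      then show "?f (case g of (a, b, c, d) \<Rightarrow> (a, b, c)) = g" by (simp add: e)
    qed
    show "?f ` (Units S \<times> carrier S \<times> carrier S) \<subseteq> {g \<in> carrier (SL2 S). fst g \<in> Units S}"
    proof (rule image_subsetI)
      fix y assume y: "y \<in> Units S \<times> carrier S \<times> carrier S"
      obtain a b c where e: "y = (a, b, c)" by (cases y)
      have x: "a \<in> Units S" "b \<in> carrier S" "c \<in> carrier S" using y by (auto simp: e)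
      then have ac: "a \<in> carrier S" "inv a \<in> carrier S" by auto
      have "a \<otimes> (inv a \<otimes> (\<one> \<oplus> b \<otimes> c)) = \<one> \<oplus> b \<otimes> c" using x ac by (simp add: m_assoc[symmetric])
      moreover have "\<one> \<oplus> b \<otimes> c \<ominus> b \<otimes> c = \<one>" using x by algebra
      ultimately show "?f y \<in> {g \<in> carrier (SL2 S). fst g \<in> Units S}"
        using x ac by (simp add: e SL2_iff)
    qed
    show "(\<lambda>(a, b, c, d). (a, b, c)) ` {g \<in> carrier (SL2 S). fst g \<in> Units S} \<subseteq> Units S \<times> carrier S \<times> carrier S"
      by (auto simp: SL2_iff)
  qed
  then have "card {g \<in> carrier (SL2 S). fst g \<in> Units S} = card (Units S \<times> carrier S \<times> carrier S)"
    by (rule bij_betw_same_card[THEN sym])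
  then show ?thesis by (simp add: card_cartesian_product card_carrier)
qed

text \<open>If \<open>a\<close> is not a unit, the determinant forces \<open>b\<close> to be one;
  then \<open>a\<close> and \<open>d\<close> are free and \<open>c\<close> is determined.\<close>

lemma card_SL2_nonunit: "card {g \<in> carrier (SL2 S). fst g \<in> pw 1} = q ^ (n - 1) * (card (Units S) * q ^ n)"
proof -
  let ?f = "\<lambda>(a, b, d). (a, b, inv b \<otimes> (a \<otimes> d \<ominus> \<one>), d)"
  have "bij_betw ?f (pw 1 \<times> Units S \<times> carrier S) {g \<in> carrier (SL2 S). fst g \<in> pw 1}"
  proof (rule bij_betw_byWitness[of _ "\<lambda>(a, b, c, d). (a, b, d)"])
    have bu: "b \<in> Units S" if g: "(a, b, c, d) \<in> carrier (SL2 S)" "a \<in> pw 1" for a b c d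
    proof -
      have x: "a \<in> carrier S" "b \<in> carrier S" "c \<in> carrier S" "d \<in> carrier S"
        "a \<otimes> d \<ominus> b \<otimes> c = \<one>" using g by (auto simp: SL2_iff)
      have "b \<notin> pw 1"
      proof
        assume "b \<in> pw 1"
        then have "a \<otimes> d \<ominus> b \<otimes> c \<in> pw 1" using pw_minus[OF pw_mult(1)[OF g(2) x(4)] pw_mult(1)] x(3) by blast
        then show False using x(5) unit_iff[OF one_closed] by simp
      qed
      then show ?thesis using unit_iff[OF x(2)] by simp
    qed
    show "\<forall>x\<in>pw 1 \<times> Units S \<times> carrier S. (case ?f x of (a, b, c, d) \<Rightarrow> (a, b, d)) = x" by auto
    show "\<forall>g\<in>{g \<in> carrier (SL2 S). fst g \<in> pw 1}. ?f (case g of (a, b, c, d) \<Rightarrow> (a, b, d)) = g"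
    proof
      fix g assume g: "g \<in> {g \<in> carrier (SL2 S). fst g \<in> pw 1}"
      obtain a b c d where e: "g = (a, b, c, d)" by (cases g)
      have x: "a \<in> carrier S" "b \<in> carrier S" "c \<in> carrier S" "d \<in> carrier S"
        "a \<otimes> d \<ominus> b \<otimes> c = \<one>" using g by (auto simp: e SL2_iff)
      have "b \<in> Units S" using bu[of a b c d] g by (simp add: e)
      then have b: "b \<in> Units S" "inv b \<in> carrier S" by auto
      have "a \<otimes> d \<ominus> \<one> = b \<otimes> c" unfolding x(5)[symmetric] using x(1-4) by algebra
      then have "inv b \<otimes> (a \<otimes> d \<ominus> \<one>) = c" using x b by (simp add: m_assoc[symmetric])
      then show "?f (case g of (a, b, c, d) \<Rightarrow> (a, b, d)) = g" by (simp add: e)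
    qed
    show "?f ` (pw 1 \<times> Units S \<times> carrier S) \<subseteq> {g \<in> carrier (SL2 S). fst g \<in> pw 1}"
    proof (rule image_subsetI)
      fix y assume y: "y \<in> pw 1 \<times> Units S \<times> carrier S"
      obtain a b d where e: "y = (a, b, d)" by (cases y)
      have x: "a \<in> pw 1" "b \<in> Units S" "d \<in> carrier S" using y by (auto simp: e)
      then have c: "a \<in> carrier S" "b \<in> carrier S" "inv b \<in> carrier S" using pw_closed by auto
      have "b \<otimes> (inv b \<otimes> (a \<otimes> d \<ominus> \<one>)) = a \<otimes> d \<ominus> \<one>" using x c by (simp add: m_assoc[symmetric])
      moreover have "a \<otimes> d \<ominus> (a \<otimes> d \<ominus> \<one>) = \<one>" using x c by algebra
      ultimately show "?f y \<in> {g \<in> carrier (SL2 S). fst g \<in> pw 1}"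
        using x c by (simp add: e SL2_iff)
    qed
    show "(\<lambda>(a, b, c, d). (a, b, d)) ` {g \<in> carrier (SL2 S). fst g \<in> pw 1} \<subseteq> pw 1 \<times> Units S \<times> carrier S"
      using bu by (auto simp: SL2_iff)
  qed
  then have "card {g \<in> carrier (SL2 S). fst g \<in> pw 1} = card (pw 1 \<times> Units S \<times> carrier S)"
    by (rule bij_betw_same_card[THEN sym])
  then show ?thesis using card_pw[of 1] n_pos by (simp add: card_cartesian_product card_carrier)
qed

text \<open>The factors are arranged as needed later: the index of \<open>B\<close>, then the orders
  of \<open>T\<close> and of \<open>pw r\<close> in the quadratic extension.\<close>

lemma card_SL2: "card (carrier (SL2 S)) = q ^ (n - 1) * (q - 1) * (q ^ (n - 1) * (q + 1) * q ^ n)"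
proof -
  let ?A = "{g \<in> carrier (SL2 S). fst g \<in> Units S}" and ?C = "{g \<in> carrier (SL2 S). fst g \<in> pw 1}"
  have fin: "finite (carrier (SL2 S))" using SL2_finite_group by (simp add: finite_group_def finite_group_axioms_def)
  have "fst g \<in> carrier S" if "g \<in> carrier (SL2 S)" for g using that by (cases g) (simp add: SL2_iff)
  then have un: "carrier (SL2 S) = ?A \<union> ?C" and dis: "?A \<inter> ?C = {}" using unit_iff by auto
  have "card (carrier (SL2 S)) = card ?A + card ?C"
    by (subst un, rule card_Un_disjoint) (use fin dis in auto)
  also have "\<dots> = card (Units S) * (q ^ n * q ^ n) + q ^ (n - 1) * (card (Units S) * q ^ n)"
    unfolding card_SL2_unit card_SL2_nonunit ..
  finally have *: "card (carrier (SL2 S)) = card (Units S) * (q ^ n * q ^ n) + q ^ (n - 1) * (card (Units S) * q ^ n)" .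
  have "card (Units S) = q ^ (n - 1) * (q - 1)"
  proof -
    have "q ^ (n - 1) * (q - 1) = q * q ^ (n - 1) - q ^ (n - 1)" by (metis diff_mult_distrib mult_1 mult.commute)
    then show ?thesis unfolding card_Units using power_Suc[of q "n - 1"] n_pos by simp
  qed
  moreover have "q ^ n = q ^ (n - 1) * q" using power_Suc[of q "n - 1"] n_pos by (simp add: mult.commute)
  ultimately show ?thesis unfolding * by (simp add: algebra_simps)
qed

end

section \<open>The matrix realisation of the unitary group\<close>

context artin_schreier
begin

interpretation U: unramified_ring Q "(\<pi>, \<zero>)" n cj "(\<zero>, \<one>)" r q by (rule unramified_Q)

text \<open>\<open>x + z j\<close> acts on \<open>Q = S \<oplus> S \<omega>\<close> by \<open>s \<mapsto> x s + z \<sigma>(s)\<close>; this is its matrix in the basis \<open>1, \<omega>\<close>.\<close>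

definition mat_of :: "('a \<times> 'a) \<times> ('a \<times> 'a) \<Rightarrow> 'a \<times> 'a \<times> 'a \<times> 'a" where
  "mat_of = (\<lambda>((u, v), (u', v')). (u \<oplus> u', \<delta> \<otimes> v \<oplus> u' \<ominus> \<delta> \<otimes> v', v \<oplus> v', u \<oplus> v \<ominus> u'))"

text \<open>The determinant of the matrix is the norm of \<open>x\<close> minus the norm of
  \<open>z\<close>.\<close>

lemma SU_Q_iff:
  assumes c: "u \<in> carrier S" "v \<in> carrier S" "u' \<in> carrier S" "v' \<in> carrier S"
  shows "((u, v), (u', v')) \<in> carrier (SU Q cj) \<longleftrightarrow>
    (u \<oplus> u') \<otimes> (u \<oplus> v \<ominus> u') \<ominus> (\<delta> \<otimes> v \<oplus> u' \<ominus> \<delta> \<otimes> v') \<otimes> (v \<oplus> v') = \<one>"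
proof -
  have neg: "\<ominus>\<^bsub>Q\<^esub> (a, b) = (\<ominus> a, \<ominus> b)" if "a \<in> carrier S" "b \<in> carrier S" for a b
    using that by (intro Q.minus_equality) (auto simp: Q_simps l_neg)
  have N: "(a, b) \<otimes>\<^bsub>Q\<^esub> cj (a, b) = (a \<otimes> a \<oplus> a \<otimes> b \<ominus> \<delta> \<otimes> (b \<otimes> b), \<zero>)"
    if "a \<in> carrier S" "b \<in> carrier S" for a b
  proof -
    have "a \<otimes> (a \<oplus> b) \<oplus> \<delta> \<otimes> (b \<otimes> (\<ominus> b)) = a \<otimes> a \<oplus> a \<otimes> b \<ominus> \<delta> \<otimes> (b \<otimes> b)"
      "a \<otimes> (\<ominus> b) \<oplus> b \<otimes> (a \<oplus> b) \<oplus> b \<otimes> (\<ominus> b) = \<zero>" using that delta_closed by algebra+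
    then show ?thesis by (simp add: Q_simps)
  qed
  have "(u, v) \<otimes>\<^bsub>Q\<^esub> cj (u, v) \<ominus>\<^bsub>Q\<^esub> (u', v') \<otimes>\<^bsub>Q\<^esub> cj (u', v')
    = ((u \<otimes> u \<oplus> u \<otimes> v \<ominus> \<delta> \<otimes> (v \<otimes> v)) \<oplus> \<ominus> (u' \<otimes> u' \<oplus> u' \<otimes> v' \<ominus> \<delta> \<otimes> (v' \<otimes> v')), \<zero>)"
    unfolding N[OF c(1,2)] N[OF c(3,4)] a_minus_def[of Q] using c by (simp add: neg) (simp add: Q_simps)
  moreover have "(u \<otimes> u \<oplus> u \<otimes> v \<ominus> \<delta> \<otimes> (v \<otimes> v)) \<oplus> \<ominus> (u' \<otimes> u' \<oplus> u' \<otimes> v' \<ominus> \<delta> \<otimes> (v' \<otimes> v'))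
    = (u \<oplus> u') \<otimes> (u \<oplus> v \<ominus> u') \<ominus> (\<delta> \<otimes> v \<oplus> u' \<ominus> \<delta> \<otimes> v') \<otimes> (v \<oplus> v')"
    using c delta_closed by algebra
  ultimately show ?thesis using c by (simp add: U.SU_carrier) (simp add: Q_simps)
qed

definition act :: "'a \<times> 'a \<times> 'a \<times> 'a \<Rightarrow> 'a \<times> 'a \<Rightarrow> 'a \<times> 'a" where
  "act = (\<lambda>(a, b, c, d) (s, t). (a \<otimes> s \<oplus> b \<otimes> t, c \<otimes> s \<oplus> d \<otimes> t))"

lemma act_mat_of:
  assumes "x \<in> carrier Q" "z \<in> carrier Q" "y \<in> carrier Q"
  shows "act (mat_of (x, z)) y = x \<otimes>\<^bsub>Q\<^esub> y \<oplus>\<^bsub>Q\<^esub> z \<otimes>\<^bsub>Q\<^esub> cj y"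
proof -
  obtain u v u' v' s t where e: "x = (u, v)" "z = (u', v')" "y = (s, t)"
    and c: "u \<in> carrier S" "v \<in> carrier S" "u' \<in> carrier S" "v' \<in> carrier S" "s \<in> carrier S" "t \<in> carrier S"
    using assms by (auto simp: Q_simps(1))
  have "(u \<oplus> u') \<otimes> s \<oplus> (\<delta> \<otimes> v \<oplus> u' \<ominus> \<delta> \<otimes> v') \<otimes> t
      = u \<otimes> s \<oplus> \<delta> \<otimes> (v \<otimes> t) \<oplus> (u' \<otimes> (s \<oplus> t) \<oplus> \<delta> \<otimes> (v' \<otimes> \<ominus> t))"
    "(v \<oplus> v') \<otimes> s \<oplus> (u \<oplus> v \<ominus> u') \<otimes> t
      = u \<otimes> t \<oplus> v \<otimes> s \<oplus> v \<otimes> t \<oplus> (u' \<otimes> \<ominus> t \<oplus> v' \<otimes> (s \<oplus> t) \<oplus> v' \<otimes> \<ominus> t)"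
    using c delta_closed by algebra+
  then show ?thesis by (simp add: e act_def mat_of_def Q_simps)
qed

lemma act_mult:
  assumes "a \<in> carrier S" "b \<in> carrier S" "c \<in> carrier S" "d \<in> carrier S"
    "a' \<in> carrier S" "b' \<in> carrier S" "c' \<in> carrier S" "d' \<in> carrier S" "s \<in> carrier S" "t \<in> carrier S"
  shows "act ((a, b, c, d) \<otimes>\<^bsub>SL2 S\<^esub> (a', b', c', d')) (s, t) = act (a, b, c, d) (act (a', b', c', d') (s, t))"
proof -
  have "(p \<otimes> a' \<oplus> k \<otimes> c') \<otimes> s \<oplus> (p \<otimes> b' \<oplus> k \<otimes> d') \<otimes> t = p \<otimes> (a' \<otimes> s \<oplus> b' \<otimes> t) \<oplus> k \<otimes> (c' \<otimes> s \<oplus> d' \<otimes> t)"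
    if "p \<in> carrier S" "k \<in> carrier S" for p k using that assms by algebra
  then show ?thesis using assms by (simp add: act_def SL2_def)
qed

lemma act_inject:
  assumes "a \<in> carrier S" "b \<in> carrier S" "c \<in> carrier S" "d \<in> carrier S"
    "a' \<in> carrier S" "b' \<in> carrier S" "c' \<in> carrier S" "d' \<in> carrier S"
    and eq: "act (a, b, c, d) (\<one>, \<zero>) = act (a', b', c', d') (\<one>, \<zero>)"
      "act (a, b, c, d) (\<zero>, \<one>) = act (a', b', c', d') (\<zero>, \<one>)"
  shows "(a, b, c, d) = (a', b', c', d')"
  using assms by (simp add: act_def)

lemma SU_Q_carrierD: "(x, z) \<in> carrier (SU Q cj) \<Longrightarrow> x \<in> carrier Q \<and> z \<in> carrier Q"
  by (simp add: U.SU_carrier)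

lemma mat_of_closed:
  assumes "g \<in> carrier (SU Q cj)"
  shows "mat_of g \<in> carrier (SL2 S)"
proof -
  obtain u v u' v' where e: "g = ((u, v), (u', v'))" by (metis surj_pair)
  have c: "u \<in> carrier S" "v \<in> carrier S" "u' \<in> carrier S" "v' \<in> carrier S"
    using assms by (auto simp: e U.SU_carrier Q_simps(1))
  show ?thesis using assms SU_Q_iff[OF c] c by (simp add: e mat_of_def SL2_iff)
qed

text \<open>A matrix is determined by its action on the basis \<open>1, \<omega>\<close>, and
  composing two maps \<open>s \<mapsto> x s + z \<sigma>(s)\<close> reproduces the product of
  \<open>SU\<close>.\<close>

lemma mat_of_hom: "mat_of \<in> hom (SU Q cj) (SL2 S)"
proof (rule homI[OF mat_of_closed])
  fix g h assume g: "g \<in> carrier (SU Q cj)" and h: "h \<in> carrier (SU Q cj)"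
  obtain x z x' z' where e: "g = (x, z)" "h = (x', z')" by (metis surj_pair)
  have c: "x \<in> carrier Q" "z \<in> carrier Q" "x' \<in> carrier Q" "z' \<in> carrier Q"
    using g h SU_Q_carrierD by (auto simp: e)
  have cc: "cj y \<in> carrier Q" if "y \<in> carrier Q" for y using that by simp
  obtain a b c1 d where m: "mat_of g = (a, b, c1, d)" by (cases "mat_of g")
  obtain a' b' c' d' where m': "mat_of h = (a', b', c', d')" by (cases "mat_of h")
  obtain a'' b'' c'' d'' where m'': "mat_of (g \<otimes>\<^bsub>SU Q cj\<^esub> h) = (a'', b'', c'', d'')"
    by (cases "mat_of (g \<otimes>\<^bsub>SU Q cj\<^esub> h)")
  have mc: "a \<in> carrier S" "b \<in> carrier S" "c1 \<in> carrier S" "d \<in> carrier S"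
    "a' \<in> carrier S" "b' \<in> carrier S" "c' \<in> carrier S" "d' \<in> carrier S"
    "a'' \<in> carrier S" "b'' \<in> carrier S" "c'' \<in> carrier S" "d'' \<in> carrier S"
    using mat_of_closed[OF g] mat_of_closed[OF h] mat_of_closed[OF U.SU.m_closed[OF g h]]
    by (auto simp: m m' m'' SL2_iff)
  have act: "act (mat_of (g \<otimes>\<^bsub>SU Q cj\<^esub> h)) y = act (mat_of g \<otimes>\<^bsub>SL2 S\<^esub> mat_of h) y" if y: "y \<in> carrier Q" for y
  proof -
    have id: "(x \<otimes>\<^bsub>Q\<^esub> x' \<oplus>\<^bsub>Q\<^esub> z \<otimes>\<^bsub>Q\<^esub> k') \<otimes>\<^bsub>Q\<^esub> y \<oplus>\<^bsub>Q\<^esub> (x \<otimes>\<^bsub>Q\<^esub> z' \<oplus>\<^bsub>Q\<^esub> z \<otimes>\<^bsub>Q\<^esub> k) \<otimes>\<^bsub>Q\<^esub> l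
      = x \<otimes>\<^bsub>Q\<^esub> (x' \<otimes>\<^bsub>Q\<^esub> y \<oplus>\<^bsub>Q\<^esub> z' \<otimes>\<^bsub>Q\<^esub> l) \<oplus>\<^bsub>Q\<^esub> z \<otimes>\<^bsub>Q\<^esub> (k \<otimes>\<^bsub>Q\<^esub> l \<oplus>\<^bsub>Q\<^esub> k' \<otimes>\<^bsub>Q\<^esub> y)"
      if "k \<in> carrier Q" "k' \<in> carrier Q" "l \<in> carrier Q" for k k' l
      using that c y by algebra
    obtain s t where st: "y = (s, t)" "s \<in> carrier S" "t \<in> carrier S" using y by (auto simp: Q_simps(1))
    have h2: "x' \<otimes>\<^bsub>Q\<^esub> y \<oplus>\<^bsub>Q\<^esub> z' \<otimes>\<^bsub>Q\<^esub> cj y \<in> carrier Q" using c y cc[OF y] by simp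
    have "act (mat_of (g \<otimes>\<^bsub>SU Q cj\<^esub> h)) y
      = (x \<otimes>\<^bsub>Q\<^esub> x' \<oplus>\<^bsub>Q\<^esub> z \<otimes>\<^bsub>Q\<^esub> cj z') \<otimes>\<^bsub>Q\<^esub> y \<oplus>\<^bsub>Q\<^esub> (x \<otimes>\<^bsub>Q\<^esub> z' \<oplus>\<^bsub>Q\<^esub> z \<otimes>\<^bsub>Q\<^esub> cj x') \<otimes>\<^bsub>Q\<^esub> cj y"
      unfolding e U.SU_mult using c y cc by (intro act_mat_of) auto
    also have "\<dots> = x \<otimes>\<^bsub>Q\<^esub> (x' \<otimes>\<^bsub>Q\<^esub> y \<oplus>\<^bsub>Q\<^esub> z' \<otimes>\<^bsub>Q\<^esub> cj y)
        \<oplus>\<^bsub>Q\<^esub> z \<otimes>\<^bsub>Q\<^esub> cj (x' \<otimes>\<^bsub>Q\<^esub> y \<oplus>\<^bsub>Q\<^esub> z' \<otimes>\<^bsub>Q\<^esub> cj y)"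
      using id[OF cc[OF c(3)] cc[OF c(4)] cc[OF y]] c y cc by simp
    also have "\<dots> = act (mat_of g) (act (mat_of h) y)"
      unfolding e using act_mat_of[OF c(3,4) y] act_mat_of[OF c(1,2) h2] by simp
    also have "\<dots> = act (mat_of g \<otimes>\<^bsub>SL2 S\<^esub> mat_of h) y"
      unfolding m m' st(1) using act_mult mc st(2,3) by simp
    finally show ?thesis .
  qed
  have e1: "(\<one>, \<zero>) \<in> carrier Q" "(\<zero>, \<one>) \<in> carrier Q" by (simp_all add: Q_simps(1))
  obtain a3 b3 c3 d3 where m3: "mat_of g \<otimes>\<^bsub>SL2 S\<^esub> mat_of h = (a3, b3, c3, d3)"
    by (cases "mat_of g \<otimes>\<^bsub>SL2 S\<^esub> mat_of h")
  have "a3 \<in> carrier S \<and> b3 \<in> carrier S \<and> c3 \<in> carrier S \<and> d3 \<in> carrier S"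
    using m3 mc unfolding m m' by (auto simp: SL2_def)
  then show "mat_of (g \<otimes>\<^bsub>SU Q cj\<^esub> h) = mat_of g \<otimes>\<^bsub>SL2 S\<^esub> mat_of h"
    unfolding m3 m'' using act[OF e1(1)] act[OF e1(2)] unfolding m3 m''
    by (intro act_inject) (use mc in auto)
qed

text \<open>The map is linear in the four coordinates. For a difference of two preimages the
  equations reduce to \<open>a = 2 \<delta> b\<close> and \<open>b = -2 a\<close>, so
  \<open>a\<close> is killed by the discriminant \<open>1 + 4 \<delta>\<close>, a unit because 2
  lies in \<open>pw 1\<close>.\<close>

lemma mat_of_inject:
  assumes "g \<in> carrier Q \<times> carrier Q" "h \<in> carrier Q \<times> carrier Q" "mat_of g = mat_of h"
  shows "g = h"
proof -
  obtain u v u' v' where e: "g = ((u, v), (u', v'))" by (metis surj_pair)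
  obtain s t s' t' where e': "h = ((s, t), (s', t'))" by (metis surj_pair)
  have c: "u \<in> carrier S" "v \<in> carrier S" "u' \<in> carrier S" "v' \<in> carrier S"
    "s \<in> carrier S" "t \<in> carrier S" "s' \<in> carrier S" "t' \<in> carrier S"
    using assms by (auto simp: e e' Q_simps(1))
  have m: "u \<oplus> u' = s \<oplus> s'" "\<delta> \<otimes> v \<oplus> u' \<ominus> \<delta> \<otimes> v' = \<delta> \<otimes> t \<oplus> s' \<ominus> \<delta> \<otimes> t'"
    "v \<oplus> v' = t \<oplus> t'" "u \<oplus> v \<ominus> u' = s \<oplus> t \<ominus> s'"
    using assms(3) by (simp_all add: e e' mat_of_def)
  \<comment> \<open>The differences in the second component; by the first and third matrix entries
    those in the first component are \<open>-a\<close> and \<open>-b\<close>.\<close>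
  define a b where "a = u' \<ominus> s'" and "b = v' \<ominus> t'"
  have ab: "a \<in> carrier S" "b \<in> carrier S" using c by (simp_all add: a_def b_def)
  have s1: "u = s \<ominus> a" "v = t \<ominus> b" "u' = s' \<oplus> a" "v' = t' \<oplus> b"
  proof -
    have "u = (u \<oplus> u') \<ominus> u'" "v = (v \<oplus> v') \<ominus> v'" using c by algebra+
    then have uv: "u = (s \<oplus> s') \<ominus> u'" "v = (t \<oplus> t') \<ominus> v'" unfolding m by auto
    show "u = s \<ominus> a" by (subst uv(1), unfold a_def) (use c in algebra)
    show "v = t \<ominus> b" by (subst uv(2), unfold b_def) (use c in algebra)
    show "u' = s' \<oplus> a" "v' = t' \<oplus> b" unfolding a_def b_def using c by algebra+
  qed
  have 2: "a = (\<one> \<oplus> \<one>) \<otimes> (\<delta> \<otimes> b)"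
  proof -
    have "\<delta> \<otimes> (t \<ominus> b) \<oplus> (s' \<oplus> a) \<ominus> \<delta> \<otimes> (t' \<oplus> b) = \<delta> \<otimes> t \<oplus> s' \<ominus> \<delta> \<otimes> t'"
      using m(2) unfolding s1 .
    moreover have "\<delta> \<otimes> (t \<ominus> b) \<oplus> (s' \<oplus> a) \<ominus> \<delta> \<otimes> (t' \<oplus> b) = (\<delta> \<otimes> t \<oplus> s' \<ominus> \<delta> \<otimes> t') \<oplus> (a \<ominus> (\<one> \<oplus> \<one>) \<otimes> (\<delta> \<otimes> b))"
      using c ab delta_closed by algebra
    ultimately have "a \<ominus> (\<one> \<oplus> \<one>) \<otimes> (\<delta> \<otimes> b) = \<zero>"
      using add.l_cancel[of "\<delta> \<otimes> t \<oplus> s' \<ominus> \<delta> \<otimes> t'" "a \<ominus> (\<one> \<oplus> \<one>) \<otimes> (\<delta> \<otimes> b)" \<zero>] c ab by simp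
    then show ?thesis using ab by simp
  qed
  have 1: "b = \<ominus> ((\<one> \<oplus> \<one>) \<otimes> a)"
  proof -
    have "s \<ominus> a \<oplus> (t \<ominus> b) \<ominus> (s' \<oplus> a) = s \<oplus> t \<ominus> s'" using m(4) unfolding s1 .
    moreover have "s \<ominus> a \<oplus> (t \<ominus> b) \<ominus> (s' \<oplus> a) = (s \<oplus> t \<ominus> s') \<oplus> (\<ominus> ((\<one> \<oplus> \<one>) \<otimes> a) \<ominus> b)"
      using c ab by algebra
    ultimately have "\<ominus> ((\<one> \<oplus> \<one>) \<otimes> a) \<ominus> b = \<zero>"
      using add.l_cancel[of "s \<oplus> t \<ominus> s'" "\<ominus> ((\<one> \<oplus> \<one>) \<otimes> a) \<ominus> b" \<zero>] c ab by simp
    then show ?thesis using ab by simp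
  qed
  have "a \<otimes> (\<one> \<oplus> (\<one> \<oplus> \<one>) \<otimes> (\<delta> \<otimes> (\<one> \<oplus> \<one>))) = a \<ominus> (\<one> \<oplus> \<one>) \<otimes> (\<delta> \<otimes> (\<ominus> ((\<one> \<oplus> \<one>) \<otimes> a)))"
    using ab delta_closed by algebra
  also have "\<dots> = \<zero>" unfolding 1[symmetric] 2[symmetric] using ab by (simp add: minus_eq r_neg)
  finally have z: "a \<otimes> (\<one> \<oplus> (\<one> \<oplus> \<one>) \<otimes> (\<delta> \<otimes> (\<one> \<oplus> \<one>))) = \<zero>" .
  have "(\<one> \<oplus> \<one>) \<otimes> (\<delta> \<otimes> (\<one> \<oplus> \<one>)) \<in> pw 1" using pw_mult(1)[OF residue_char] by simp
  then have w: "\<one> \<oplus> (\<one> \<oplus> \<one>) \<otimes> (\<delta> \<otimes> (\<one> \<oplus> \<one>)) \<in> Units S" (is "?w \<in> _")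
    using unit_add_pw[OF Units_one_closed] by simp
  then have wc: "?w \<in> carrier S" "inv ?w \<in> carrier S" by auto
  have "a = a \<otimes> ?w \<otimes> inv ?w" unfolding m_assoc[OF ab(1) wc] using w ab by simp
  then have a0: "a = \<zero>" unfolding z using wc by simp
  then have b0: "b = \<zero>" using 1 by simp
  show ?thesis using s1 c unfolding a0 b0 by (simp add: e e' minus_eq)
qed

text \<open>Injectivity and equal cardinalities make \<open>mat_of\<close> a bijection from all
  pairs to all matrices; the determinant identity cuts out the two groups.\<close>

lemma mat_of_iso: "mat_of \<in> iso (SU Q cj) (SL2 S)"
proof -
  let ?D = "carrier Q \<times> carrier Q" and ?C = "carrier S \<times> carrier S \<times> carrier S \<times> carrier S"
  have inj: "inj_on mat_of ?D" by (rule inj_onI) (rule mat_of_inject)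
  have "mat_of ` ?D \<subseteq> ?C" by (auto simp: mat_of_def Q_simps(1))
  moreover have "card (mat_of ` ?D) = card ?C"
    unfolding card_image[OF inj] by (simp add: card_cartesian_product Q_simps(1))
  moreover have "finite ?C" using finite_carrier by simp
  ultimately have img: "mat_of ` ?D = ?C" by (intro card_subset_eq)
  have "mat_of ` carrier (SU Q cj) = carrier (SL2 S)"
  proof (intro equalityI subsetI)
    fix m assume m: "m \<in> carrier (SL2 S)"
    then have "m \<in> ?C" by (cases m) (simp add: SL2_iff)
    then obtain g where g: "g \<in> ?D" "m = mat_of g" using img by blast
    obtain u v u' v' where e: "g = ((u, v), (u', v'))" by (metis surj_pair)
    have c: "u \<in> carrier S" "v \<in> carrier S" "u' \<in> carrier S" "v' \<in> carrier S"
      using g by (auto simp: e Q_simps(1))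
    have "g \<in> carrier (SU Q cj)" using m SU_Q_iff[OF c] by (simp add: g(2) e mat_of_def SL2_iff)
    then show "m \<in> mat_of ` carrier (SU Q cj)" using g(2) by blast
  qed (use mat_of_closed in auto)
  moreover have "inj_on mat_of (carrier (SU Q cj))"
    by (rule inj_on_subset[OF inj]) (auto simp: U.SU_carrier)
  ultimately show ?thesis using mat_of_hom by (simp add: iso_def bij_betw_def)
qed

lemma SU_Q_algebra_iso:
  "complex_algebras_isomorphic (group_algebra (SU Q cj)) (group_algebra (SL2 S))"
  "complex_algebras_isomorphic (group_algebra (SL2 S)) (group_algebra (SU Q cj))"
  using group_iso_imp_algebras_isomorphic[OF U.SU.finite_group_axioms SL2_finite_group mat_of_iso]
    group_iso_imp_algebras_isomorphic[OF SL2_finite_group U.SU.finite_group_axioms U.SU.iso_set_sym[OF mat_of_iso]]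
  by auto

lemma card_SU_Q: "card (carrier (SU Q cj)) = q ^ (n - 1) * (q - 1) * (q ^ (n - 1) * (q + 1) * q ^ n)"
  using bij_betw_same_card[of mat_of] mat_of_iso card_SL2 by (auto simp: iso_def)

end

section \<open>Choice of the quadratic extension and the comparison over finite chain rings\<close>

lemma card_image_eq_card_image:
  assumes "\<And>x y. x \<in> A \<Longrightarrow> y \<in> A \<Longrightarrow> f x = f y \<longleftrightarrow> g x = g y"
  shows "card (f ` A) = card (g ` A)"
proof (rule bij_betw_same_card)
  let ?h = "\<lambda>v. g (inv_into A f v)"
  have h: "?h (f x) = g x" if "x \<in> A" for x
    using assms[of "inv_into A f (f x)" x] inv_into_into[of "f x" f A] f_inv_into_f[of "f x" f A] that by blast
  show "bij_betw ?h (f ` A) (g ` A)"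
  proof (rule bij_betw_imageI)
    show "inj_on ?h (f ` A)" using h assms by (auto simp: inj_on_def)
    show "?h ` f ` A = g ` A" using h by (auto simp: image_image cong: image_cong)
  qed
qed

lemma (in ideal) carrier_quotient: "carrier (R Quot I) = (\<lambda>x. I +> x) ` carrier R"
  by (auto simp: FactRing_def A_RCOSETS_def')

lemma (in ideal) coset_eq_iff: "x \<in> carrier R \<Longrightarrow> y \<in> carrier R \<Longrightarrow> I +> x = I +> y \<longleftrightarrow> x \<ominus> y \<in> I"
  using quotient_eq_iff_same_a_r_cos[OF is_ideal] by simp

lemma (in chain_ring) pw_ideal: "ideal (pw 1) S"
proof (rule idealI)
  show "ring S" by (rule ring_axioms)
  show "subgroup (pw 1) (add_monoid S)"
  proof (rule add.subgroupI)
    show "pw 1 \<noteq> {}" using zero_in_pw by blast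
  qed (use pw_subset pw_add pw_inv in \<open>auto simp: a_inv_def\<close>)
qed (use pw_mult in auto)

text \<open>Since \<open>x\<^sup>2 - x\<close> vanishes at 0 and 1, it is not surjective on the residue field.\<close>

lemma (in chain_ring) artin_schreier_exists:
  obtains \<delta> where "\<delta> \<in> carrier S" "\<And>x. x \<in> carrier S \<Longrightarrow> x \<otimes> x \<ominus> x \<ominus> \<delta> \<in> Units S"
proof -
  interpret I: ideal "pw 1" S by (rule pw_ideal)
  define C where "C = (\<lambda>x. pw 1 +> x) ` carrier S"
  define \<phi> where "\<phi> = (\<lambda>x. pw 1 +> (x \<otimes> x \<ominus> x))"
  have fC: "finite C" using finite_carrier by (simp add: C_def)
  \<comment> \<open>The map \<open>c \<mapsto> c^2 - c\<close> on residue classes, computed on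
    chosen representatives.\<close>
  define f where "f c = \<phi> (inv_into (carrier S) (\<lambda>x. pw 1 +> x) c)" for c
  have f: "f (pw 1 +> x) = \<phi> x" if x: "x \<in> carrier S" for x
  proof -
    let ?y = "inv_into (carrier S) (\<lambda>x. pw 1 +> x) (pw 1 +> x)"
    have y: "?y \<in> carrier S" "pw 1 +> ?y = pw 1 +> x"
      using inv_into_into[of "pw 1 +> x" "\<lambda>x. pw 1 +> x" "carrier S"]
        f_inv_into_f[of "pw 1 +> x" "\<lambda>x. pw 1 +> x" "carrier S"] x by blast+
    then have "?y \<ominus> x \<in> pw 1" using I.coset_eq_iff x by simp
    \<comment> \<open>This product is \<open>(y^2 - y) - (x^2 - x)\<close>, so the class of the
      value does not depend on the representative.\<close>
    then have "(?y \<ominus> x) \<otimes> (?y \<oplus> x \<ominus> \<one>) \<in> pw 1" using pw_mult(1) y x by simp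
    moreover have "(?y \<ominus> x) \<otimes> (?y \<oplus> x \<ominus> \<one>) = (?y \<otimes> ?y \<ominus> ?y) \<ominus> (x \<otimes> x \<ominus> x)" using y(1) x by algebra
    ultimately show ?thesis using I.coset_eq_iff y x by (simp add: f_def \<phi>_def)
  qed
  have "f ` C \<subseteq> C" using f by (auto simp: C_def \<phi>_def)
  moreover have "f ` C \<noteq> C"
  proof
    assume "f ` C = C"
    then have inj: "inj_on f C" using fC by (intro eq_card_imp_inj_on) simp_all
    have "f (pw 1 +> \<zero>) = f (pw 1 +> \<one>)" using f by (simp add: \<phi>_def minus_eq r_neg)
    then have "pw 1 +> \<one> = pw 1 +> \<zero>" using inj by (simp add: inj_on_def C_def)
    then have "\<one> \<ominus> \<zero> \<in> pw 1" using I.coset_eq_iff by simp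
    then show False using unit_iff[OF one_closed] by (simp add: minus_eq)
  qed
  ultimately obtain \<delta> where d: "\<delta> \<in> carrier S" "pw 1 +> \<delta> \<notin> f ` C" by (auto simp: C_def)
  have "x \<otimes> x \<ominus> x \<ominus> \<delta> \<in> Units S" if x: "x \<in> carrier S" for x
  proof (rule ccontr)
    assume "x \<otimes> x \<ominus> x \<ominus> \<delta> \<notin> Units S"
    then have "x \<otimes> x \<ominus> x \<ominus> \<delta> \<in> pw 1" using unit_iff x d(1) by simp
    then have "pw 1 +> (x \<otimes> x \<ominus> x) = pw 1 +> \<delta>" using I.coset_eq_iff x d(1) by simp
    then have "pw 1 +> \<delta> = f (pw 1 +> x)" using f[OF x] by (simp add: \<phi>_def)
    then show False using d(2) x by (auto simp: C_def)
  qed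
  then show thesis using that d(1) by blast
qed

text \<open>The constants \<open>\<delta>\<close> for the two rings are chosen independently; the
  comparison of the unitary groups depends on the rings only through equal \<open>q\<close> and
  \<open>n\<close> and through the behaviour of 2.\<close>

lemma SL2_algebras_not_isomorphic:
  assumes "chain_ring S \<pi> n" "chain_ring S' \<pi>' n" and n: "n = 2 * r" "2 \<le> r"
    and q: "chain_ring.q S \<pi> n = chain_ring.q S' \<pi>' n"
    and res: "\<one>\<^bsub>S\<^esub> \<oplus>\<^bsub>S\<^esub> \<one>\<^bsub>S\<^esub> \<in> chain_ring.pw S \<pi> 1"
    and two: "\<one>\<^bsub>S\<^esub> \<oplus>\<^bsub>S\<^esub> \<one>\<^bsub>S\<^esub> = \<pi> [^]\<^bsub>S\<^esub> e \<otimes>\<^bsub>S\<^esub> \<epsilon>" "\<epsilon> \<in> Units S" "e < r"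
    and char2: "\<one>\<^bsub>S'\<^esub> \<oplus>\<^bsub>S'\<^esub> \<one>\<^bsub>S'\<^esub> = \<zero>\<^bsub>S'\<^esub>"
  shows "\<not> complex_algebras_isomorphic (group_algebra (SL2 S)) (group_algebra (SL2 S'))"
proof
  interpret S: chain_ring S \<pi> n by fact
  interpret S': chain_ring S' \<pi>' n by fact
  obtain \<delta> where d: "\<delta> \<in> carrier S" "\<And>x. x \<in> carrier S \<Longrightarrow> x \<otimes>\<^bsub>S\<^esub> x \<ominus>\<^bsub>S\<^esub> x \<ominus>\<^bsub>S\<^esub> \<delta> \<in> Units S"
    by (rule S.artin_schreier_exists) (rule that)
  obtain \<delta>' where d': "\<delta>' \<in> carrier S'" "\<And>x. x \<in> carrier S' \<Longrightarrow> x \<otimes>\<^bsub>S'\<^esub> x \<ominus>\<^bsub>S'\<^esub> x \<ominus>\<^bsub>S'\<^esub> \<delta>' \<in> Units S'"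
    by (rule S'.artin_schreier_exists) (rule that)
  interpret A: artin_schreier S \<pi> n \<delta> r by unfold_locales (use d res n in auto)
  have "\<one>\<^bsub>S'\<^esub> \<oplus>\<^bsub>S'\<^esub> \<one>\<^bsub>S'\<^esub> \<in> S'.pw 1" using char2 S'.zero_in_pw by simp
  then interpret A': artin_schreier S' \<pi>' n \<delta>' r by unfold_locales (use d' n in auto)
  assume iso: "complex_algebras_isomorphic (group_algebra (SL2 S)) (group_algebra (SL2 S'))"
  have "\<not> complex_algebras_isomorphic (group_algebra (SU A.Q A.cj)) (group_algebra (SU A'.Q A'.cj))"
  proof (rule SU_algebras_not_isomorphic[OF A.unramified_Q A'.unramified_Q[folded q], where e = e])
    have ec: "\<epsilon> \<in> carrier S" using two(2) by auto
    show "\<one>\<^bsub>A.Q\<^esub> \<oplus>\<^bsub>A.Q\<^esub> \<one>\<^bsub>A.Q\<^esub> = (\<pi>, \<zero>\<^bsub>S\<^esub>) [^]\<^bsub>A.Q\<^esub> e \<otimes>\<^bsub>A.Q\<^esub> (\<epsilon>, \<zero>\<^bsub>S\<^esub>)"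
      unfolding A.Q_pow using ec two(1) by (simp add: A.Q_simps)
    show "(\<epsilon>, \<zero>\<^bsub>S\<^esub>) \<in> Units A.Q" using A.Q_unit ec two(2) by simp
    show "A.cj (\<epsilon>, \<zero>\<^bsub>S\<^esub>) = (\<epsilon>, \<zero>\<^bsub>S\<^esub>)" using A.cj_fixed ec by simp
    show "\<one>\<^bsub>A'.Q\<^esub> \<oplus>\<^bsub>A'.Q\<^esub> \<one>\<^bsub>A'.Q\<^esub> = \<zero>\<^bsub>A'.Q\<^esub>" using char2 by (simp add: A'.Q_simps)
  qed (use two n A.card_SU_Q A'.card_SU_Q q in simp_all)
  moreover have "complex_algebras_isomorphic (group_algebra (SU A.Q A.cj)) (group_algebra (SU A'.Q A'.cj))"
    using complex_algebras_isomorphic_trans[OF complex_algebras_isomorphic_trans[OF A.SU_Q_algebra_iso(1) iso]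
        A'.SU_Q_algebra_iso(2)] .
  ultimately show False by simp
qed

section \<open>Quotients of discrete valuation rings\<close>

lemma (in cring) ideal_prod_principal:
  assumes a: "a \<in> carrier R" and b: "b \<in> carrier R"
  shows "ideal_prod R (PIdl a) (PIdl b) = PIdl (a \<otimes> b)"
proof (intro equalityI subsetI)
  fix x assume "x \<in> ideal_prod R (PIdl a) (PIdl b)"
  then show "x \<in> PIdl (a \<otimes> b)"
  proof induction
    case (prod i j)
    then obtain s t where "s \<in> carrier R" "t \<in> carrier R" "i = s \<otimes> a" "j = t \<otimes> b"
      unfolding cgenideal_def by blast
    then have "i \<otimes> j = (s \<otimes> t) \<otimes> (a \<otimes> b)" "s \<otimes> t \<in> carrier R" using a b by (simp_all add: m_ac)
    then show ?case unfolding cgenideal_def by blast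
  next
    case (sum s1 s2)
    then show ?case
      using additive_subgroup.a_closed[OF ideal.axioms(1)[OF cgenideal_ideal[of "a \<otimes> b"]]] a b by simp
  qed
next
  fix x assume "x \<in> PIdl (a \<otimes> b)"
  then obtain s where s: "s \<in> carrier R" "x = s \<otimes> (a \<otimes> b)" unfolding cgenideal_def by blast
  then have "x = (s \<otimes> a) \<otimes> (\<one> \<otimes> b)" using a b by (simp add: m_assoc)
  moreover have "s \<otimes> a \<in> PIdl a" "\<one> \<otimes> b \<in> PIdl b" using s(1) unfolding cgenideal_def by blast+
  ultimately show "x \<in> ideal_prod R (PIdl a) (PIdl b)" using ideal_prod.prod by metis
qed

lemma (in cring) ideal_power_principal:
  assumes a: "a \<in> carrier R"
  shows "ideal_power R (PIdl a) n = PIdl (a [^] n)"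
proof (induction n)
  case 0
  have "PIdl \<one> = carrier R" unfolding cgenideal_def by force
  then show ?case by (simp add: ideals_set_def)
next
  case (Suc n)
  have "ideal_power R (PIdl a) (Suc n) = ideal_prod R (ideal_power R (PIdl a) n) (PIdl a)"
    by (simp add: ideals_set_def nat_pow_def)
  then show ?case using ideal_prod_principal[of "a [^] n" a] a by (simp add: Suc)
qed

lemma (in discrete_valuation_ring) uniformizer:
  obtains \<pi> where "\<pi> \<in> carrier R" "\<pp> = PIdl \<pi>" "\<pi> \<noteq> \<zero>" "\<pi> \<notin> Units R"
proof -
  obtain \<pi> where p: "\<pi> \<in> carrier R" "\<pp> = PIdl \<pi>" using exists_gen[OF is_ideal] by blast
  have "\<pi> \<noteq> \<zero>"
  proof
    assume "\<pi> = \<zero>"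
    then have "\<pp> = {\<zero>}" unfolding p(2) cgenideal_def by (auto intro!: exI[of _ \<zero>])
    then show False using maximalideal_nonzero by simp
  qed
  moreover have "\<pi> \<notin> Units R"
  proof
    assume "\<pi> \<in> Units R"
    then have "\<one> = inv \<pi> \<otimes> \<pi>" "inv \<pi> \<in> carrier R" by auto
    then have "\<one> \<in> \<pp>" unfolding p(2) cgenideal_def by blast
    then show False using one_imp_carrier I_notcarr by simp
  qed
  ultimately show thesis using that p by blast
qed

context discrete_valuation_ring
begin

context
  fixes \<pi> and n :: nat
  assumes \<pi>: "\<pi> \<in> carrier R" "\<pp> = PIdl \<pi>" "\<pi> \<noteq> \<zero>" "\<pi> \<notin> Units R"
    and n: "0 < n" and finite_residue: "finite (carrier (R Quot \<pp>))"
begin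

abbreviation J where "J \<equiv> ideal_power R \<pp> n"
abbreviation S where "S \<equiv> R Quot J"

lemma J_eq: "J = PIdl (\<pi> [^] n)"
  using ideal_power_principal \<pi> by simp

lemma J_ideal: "ideal J R"
  unfolding J_eq using cgenideal_ideal \<pi>(1) by simp

lemma quotient_hom: "ring_hom_cring R S ((+>) J)"
  using ideal.rcos_ring_hom_cring[OF J_ideal is_cring] .

interpretation J: ideal J R by (rule J_ideal)
interpretation h: ring_hom_cring R S "(+>) J" by (rule quotient_hom)

lemma J_iff: "x \<in> J \<longleftrightarrow> (\<exists>y\<in>carrier R. x = y \<otimes> \<pi> [^] n)"
  unfolding J_eq cgenideal_def by blast

lemma p_iff: "x \<in> \<pp> \<longleftrightarrow> (\<exists>y\<in>carrier R. x = y \<otimes> \<pi>)"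
  unfolding \<pi>(2) cgenideal_def by blast

lemma hom_pow: "(J +> \<pi>) [^]\<^bsub>S\<^esub> (i::nat) = J +> (\<pi> [^] i)"
  by (induction i) (use \<pi>(1) in simp_all)

lemma pi_pow_nonzero: "\<pi> [^] (i::nat) \<noteq> \<zero>"
  by (induction i) (use \<pi>(1,3) integral in auto)

lemma hom_eq_zero_iff: "x \<in> carrier R \<Longrightarrow> J +> x = \<zero>\<^bsub>S\<^esub> \<longleftrightarrow> x \<in> J"
proof -
  assume x: "x \<in> carrier R"
  have z: "\<zero> \<in> carrier R" by simp
  have "J +> x = J +> \<zero> \<longleftrightarrow> x \<ominus> \<zero> \<in> J" using J.coset_eq_iff[OF x z] .
  then show ?thesis using x by (simp add: minus_eq)
qed

text \<open>Cancellation of \<open>\<pi>^(n-1)\<close> in the domain; this identifies the socle of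
  the quotient with the residue field.\<close>

lemma pi_pow_mult_in_J_iff:
  assumes x: "x \<in> carrier R"
  shows "\<pi> [^] (n - 1) \<otimes> x \<in> J \<longleftrightarrow> x \<in> \<pp>"
proof -
  have nz: "\<pi> [^] (n - 1) \<noteq> \<zero>" by (rule pi_pow_nonzero)
  have s: "\<pi> [^] n = \<pi> [^] (n - 1) \<otimes> \<pi>" using nat_pow_Suc[of \<pi> "n - 1"] n by simp
  have "\<pi> [^] (n - 1) \<otimes> x = y \<otimes> \<pi> [^] n \<longleftrightarrow> x = y \<otimes> \<pi>" if y: "y \<in> carrier R" for y
  proof -
    have "y \<otimes> \<pi> [^] n = \<pi> [^] (n - 1) \<otimes> (y \<otimes> \<pi>)" unfolding s using y \<pi>(1) by (simp add: m_ac)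
    then show ?thesis using m_lcancel[OF nz, of x "y \<otimes> \<pi>"] x y \<pi>(1) by simp
  qed
  then show ?thesis unfolding J_iff p_iff by blast
qed

text \<open>Repeated division by \<open>\<pi>\<close>, with remainders from a finite set
  \<open>D\<close> of representatives of the residue classes, gives digit expansions of length
  \<open>k\<close>. It is used for the finiteness of the quotient.\<close>

lemma finite_approximation: "\<exists>F. finite F \<and> F \<subseteq> carrier R \<and> (\<forall>x\<in>carrier R. \<exists>y\<in>F. \<exists>z\<in>carrier R. x = y \<oplus> z \<otimes> \<pi> [^] (k::nat))"
proof (induction k)
  case 0
  have "x = \<zero> \<oplus> x \<otimes> \<pi> [^] (0::nat)" if "x \<in> carrier R" for x using that by simp
  then show ?case by (intro exI[of _ "{\<zero>}"]) auto
next
  case (Suc k)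
  then obtain F where F: "finite F" "F \<subseteq> carrier R"
    "\<forall>x\<in>carrier R. \<exists>y\<in>F. \<exists>z\<in>carrier R. x = y \<oplus> z \<otimes> \<pi> [^] k" by blast
  define D where "D = (\<lambda>c. inv_into (carrier R) (\<lambda>x. \<pp> +> x) c) ` carrier (R Quot \<pp>)"
  have D: "finite D" "D \<subseteq> carrier R"
    using finite_residue inv_into_into[of _ "\<lambda>x. \<pp> +> x" "carrier R"] by (auto simp: D_def carrier_quotient)
  let ?F = "(\<lambda>(d, f). d \<oplus> f \<otimes> \<pi>) ` (D \<times> F)"
  have "\<exists>y\<in>?F. \<exists>z\<in>carrier R. x = y \<oplus> z \<otimes> \<pi> [^] Suc k" if x: "x \<in> carrier R" for x
  proof -
    define d where "d = inv_into (carrier R) (\<lambda>x. \<pp> +> x) (\<pp> +> x)"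
    have d: "d \<in> D" "d \<in> carrier R" using x D(2) by (auto simp: D_def d_def carrier_quotient)
    have "\<pp> +> d = \<pp> +> x" unfolding d_def using x by (intro f_inv_into_f) blast
    then have "x \<ominus> d \<in> \<pp>" using coset_eq_iff x d by metis
    then obtain w where w: "w \<in> carrier R" "x \<ominus> d = w \<otimes> \<pi>" using p_iff by blast
    obtain f z where f: "f \<in> F" "z \<in> carrier R" "w = f \<oplus> z \<otimes> \<pi> [^] k" using F(3) w(1) by blast
    have fc: "f \<in> carrier R" using f(1) F(2) by blast
    have "x = d \<oplus> (x \<ominus> d)" using x d by algebra
    also have "\<dots> = d \<oplus> f \<otimes> \<pi> \<oplus> z \<otimes> \<pi> [^] Suc k"
      unfolding w(2) f(3) using d fc f(2) \<pi>(1) by (simp add: l_distr m_assoc a_assoc)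
    finally have "x = d \<oplus> f \<otimes> \<pi> \<oplus> z \<otimes> \<pi> [^] Suc k" .
    moreover have "d \<oplus> f \<otimes> \<pi> \<in> ?F" using d f by force
    ultimately show ?thesis using f(2) by blast
  qed
  moreover have "finite ?F" "?F \<subseteq> carrier R" using D F(1,2) \<pi>(1) by auto
  ultimately show ?case by blast
qed

lemma quotient_chain_ring: "chain_ring S (J +> \<pi>) n"
proof (unfold_locales)
  show "J +> \<pi> \<in> carrier S" using \<pi>(1) by simp
  show "0 < n" by (rule n)
  show "(J +> \<pi>) [^]\<^bsub>S\<^esub> n = \<zero>\<^bsub>S\<^esub>"
  proof -
    have c: "\<pi> [^] n \<in> carrier R" using \<pi>(1) by simp
    have "\<pi> [^] n = \<one> \<otimes> \<pi> [^] n" using c by simp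
    then have "\<pi> [^] n \<in> J" unfolding J_iff by blast
    then show ?thesis unfolding hom_pow using hom_eq_zero_iff[OF c] by simp
  qed
  show "(J +> \<pi>) [^]\<^bsub>S\<^esub> (n - 1) \<noteq> \<zero>\<^bsub>S\<^esub>"
  proof
    assume "(J +> \<pi>) [^]\<^bsub>S\<^esub> (n - 1) = \<zero>\<^bsub>S\<^esub>"
    then have "J +> (\<pi> [^] (n - 1)) = \<zero>\<^bsub>S\<^esub>" unfolding hom_pow .
    moreover have c: "\<pi> [^] (n - 1) \<in> carrier R" using \<pi>(1) by (rule nat_pow_closed)
    ultimately have "\<pi> [^] (n - 1) \<in> J" using hom_eq_zero_iff[OF c] by blast
    then have "\<pi> [^] (n - 1) \<otimes> \<one> \<in> J" unfolding r_one[OF c] .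
    then have "\<one> \<in> \<pp>" using pi_pow_mult_in_J_iff[of \<one>] by blast
    then show False using one_imp_carrier I_notcarr by simp
  qed
  obtain F where F: "finite F" "F \<subseteq> carrier R" "\<forall>x\<in>carrier R. \<exists>y\<in>F. \<exists>z\<in>carrier R. x = y \<oplus> z \<otimes> \<pi> [^] n"
    using finite_approximation[of n] by (elim exE conjE)
  have "carrier S \<subseteq> (+>) J ` F"
  proof
    fix c assume "c \<in> carrier S"
    then obtain x where x: "x \<in> carrier R" "c = J +> x" using J.carrier_quotient by auto
    obtain y z where y: "y \<in> F" "z \<in> carrier R" "x = y \<oplus> z \<otimes> \<pi> [^] n" using F(3) x(1) by blast
    have yc: "y \<in> carrier R" using y(1) F(2) by blast
    have pc: "\<pi> [^] n \<in> carrier R" using \<pi>(1) by simp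
    have "x \<ominus> y = z \<otimes> \<pi> [^] n" unfolding y(3) using yc y(2) pc by algebra
    then have "x \<ominus> y \<in> J" using J_iff y(2) by blast
    then show "c \<in> (+>) J ` F" using J.coset_eq_iff[OF x(1) yc] x(2) y(1) by blast
  qed
  then show "finite (carrier S)" using F(1) finite_surj by blast
  fix c assume "c \<in> carrier S"
  then obtain x where x: "x \<in> carrier R" "c = J +> x" using J.carrier_quotient by auto
  show "c \<in> Units S \<or> (\<exists>y\<in>carrier S. c = (J +> \<pi>) \<otimes>\<^bsub>S\<^esub> y)"
  proof (cases "x \<in> \<pp>")
    case True
    then obtain y where y: "y \<in> carrier R" "x = y \<otimes> \<pi>" using p_iff by blast
    then have "c = (J +> \<pi>) \<otimes>\<^bsub>S\<^esub> (J +> y)" using x(2) \<pi>(1) m_comm h.hom_mult by metis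
    then show ?thesis using y(1) h.hom_closed by blast
  next
    case False
    interpret K: field "R Quot \<pp>" using quotient_is_field[OF is_cring] .
    interpret k: ring_hom_cring R "R Quot \<pp>" "(+>) \<pp>" using rcos_ring_hom_cring[OF is_cring] .
    have "\<pp> +> x \<noteq> \<zero>\<^bsub>R Quot \<pp>\<^esub>"
    proof
      assume "\<pp> +> x = \<zero>\<^bsub>R Quot \<pp>\<^esub>"
      then have "\<pp> +> x = \<pp> +> \<zero>" using k.hom_zero by simp
      then have "x \<ominus> \<zero> \<in> \<pp>" using coset_eq_iff x(1) by blast
      then show False using False x(1) by (simp add: minus_eq)
    qed
    then have "\<pp> +> x \<in> Units (R Quot \<pp>)" using K.field_Units x(1) by simp
    then obtain c' where c': "c' \<in> carrier (R Quot \<pp>)" "(\<pp> +> x) \<otimes>\<^bsub>R Quot \<pp>\<^esub> c' = \<one>\<^bsub>R Quot \<pp>\<^esub>"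
      using K.Units_r_inv K.Units_inv_closed by blast
    obtain y where y: "y \<in> carrier R" "c' = \<pp> +> y" using c'(1) carrier_quotient by auto
    have "\<pp> +> (x \<otimes> y) = \<pp> +> \<one>" using c'(2) y x(1) by simp
    then have "\<pp> +> \<one> = \<pp> +> (x \<otimes> y)" by simp
    then have m: "\<one> \<ominus> x \<otimes> y \<in> \<pp>" using coset_eq_iff x(1) y(1) by blast
    \<comment> \<open>Lifting the inverse from the residue field: \<open>x y = 1 - m\<close> with
      \<open>m \<in> \<pp>\<close>. Every power of \<open>m\<close> has the form
      \<open>1 - x k\<close>, and \<open>m^n\<close> lies in \<open>J\<close>, so \<open>k\<close>
      inverts \<open>x\<close> modulo \<open>J\<close>.\<close>
    define m where "m = \<one> \<ominus> x \<otimes> y"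
    have mc: "m \<in> carrier R" using x(1) y(1) by (simp add: m_def)
    have "\<exists>k\<in>carrier R. m [^] (j::nat) = \<one> \<ominus> x \<otimes> k" for j
    proof (induction j)
      case 0
      have "\<one> = \<one> \<ominus> x \<otimes> \<zero>" using x(1) by (simp add: minus_eq)
      then show ?case using x(1) by (intro bexI[of _ \<zero>]) auto
    next
      case (Suc j)
      then obtain k where k: "k \<in> carrier R" "m [^] j = \<one> \<ominus> x \<otimes> k" by blast
      have "m [^] Suc j = (\<one> \<ominus> x \<otimes> k) \<otimes> (\<one> \<ominus> x \<otimes> y)" using k(2) by (simp add: m_def)
      also have "\<dots> = \<one> \<ominus> x \<otimes> (k \<oplus> y \<ominus> k \<otimes> x \<otimes> y)" using k(1) x(1) y(1) by algebra
      finally show ?case using k(1) x(1) y(1) by blast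
    qed
    then obtain k where k: "k \<in> carrier R" "m [^] n = \<one> \<ominus> x \<otimes> k" by blast
    obtain w where w: "w \<in> carrier R" "m = w \<otimes> \<pi>" using m p_iff unfolding m_def by blast
    have "m [^] n = w [^] n \<otimes> \<pi> [^] n" unfolding w(2) using w(1) \<pi>(1) by (simp add: nat_pow_distrib)
    then have "\<one> \<ominus> x \<otimes> k \<in> J" using J_iff k(2) w(1) by auto
    then have "J +> \<one> = J +> (x \<otimes> k)" using J.coset_eq_iff k(1) x(1) by blast
    then have "c \<otimes>\<^bsub>S\<^esub> (J +> k) = \<one>\<^bsub>S\<^esub>" using x k(1) by simp
    then have "c \<in> Units S" unfolding Units_def using x k(1) h.S.m_comm[of c "J +> k"] by auto
    then show ?thesis ..
  qed
qed

interpretation S: chain_ring S "J +> \<pi>" n by (rule quotient_chain_ring)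

text \<open>Multiplication by \<open>\<pi>^(n-1)\<close> maps \<open>R\<close> onto the socle of the
  quotient, with kernel \<open>\<pp>\<close>.\<close>

lemma quotient_q: "S.q = card (carrier (R Quot \<pp>))"
proof -
  have "S.pw (n - 1) = (\<lambda>x. J +> (\<pi> [^] (n - 1) \<otimes> x)) ` carrier R"
    unfolding S.pw_def hom_pow J.carrier_quotient using \<pi>(1) by (auto simp: image_image)
  moreover have "card ((\<lambda>x. J +> (\<pi> [^] (n - 1) \<otimes> x)) ` carrier R) = card ((\<lambda>x. \<pp> +> x) ` carrier R)"
  proof (rule card_image_eq_card_image)
    fix x y assume x: "x \<in> carrier R" and y: "y \<in> carrier R"
    let ?p = "\<pi> [^] (n - 1)"
    have pc: "?p \<in> carrier R" using \<pi>(1) by simp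
    have "?p \<otimes> x \<ominus> ?p \<otimes> y = ?p \<otimes> (x \<ominus> y)" using pc x y by (simp add: minus_eq r_distr r_minus)
    then show "J +> (?p \<otimes> x) = J +> (?p \<otimes> y) \<longleftrightarrow> \<pp> +> x = \<pp> +> y"
      unfolding J.coset_eq_iff[OF m_closed[OF pc x] m_closed[OF pc y]] coset_eq_iff[OF x y]
      using pi_pow_mult_in_J_iff[of "x \<ominus> y"] x y by simp
  qed
  ultimately show ?thesis by (simp add: S.q_def carrier_quotient)
qed

lemma quotient_two_in_pw:
  assumes "\<one> \<oplus> \<one> \<in> \<pp>"
  shows "\<one>\<^bsub>S\<^esub> \<oplus>\<^bsub>S\<^esub> \<one>\<^bsub>S\<^esub> \<in> S.pw 1"
proof -
  obtain y where y: "y \<in> carrier R" "\<one> \<oplus> \<one> = y \<otimes> \<pi>" using assms p_iff by blast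
  have "\<one>\<^bsub>S\<^esub> \<oplus>\<^bsub>S\<^esub> \<one>\<^bsub>S\<^esub> = J +> (\<pi> \<otimes> y)" using y \<pi>(1) by (simp add: m_comm flip: h.hom_add h.hom_one)
  also have "\<dots> = (J +> \<pi>) [^]\<^bsub>S\<^esub> (1::nat) \<otimes>\<^bsub>S\<^esub> (J +> y)" using y(1) \<pi>(1) by simp
  finally show ?thesis using S.pwI[of "J +> y" 1] y(1) by simp
qed

end

end

lemma (in cring) two_eq_add_pow: "add_pow R (2::nat) \<one> = \<one> \<oplus> \<one>"
  by (simp add: numeral_2_eq_2 add_pow_def)

lemma (in discrete_valuation_ring) two_in_maximalideal:
  assumes "ring_char (R Quot \<pp>) = 2"
  shows "\<one> \<oplus> \<one> \<in> \<pp>"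
proof -
  interpret k: ring_hom_cring R "R Quot \<pp>" "(+>) \<pp>" using rcos_ring_hom_cring[OF is_cring] .
  have "add_pow (R Quot \<pp>) (2::nat) \<one>\<^bsub>R Quot \<pp>\<^esub> = \<zero>\<^bsub>R Quot \<pp>\<^esub>"
    using k.S.ring_char_dvd_iff[of 2] assms by simp
  then have "\<pp> +> (\<one> \<oplus> \<one>) = \<pp> +> \<zero>"
    using k.S.two_eq_add_pow k.hom_zero by simp
  moreover have "\<one> \<oplus> \<one> \<in> carrier R" "\<zero> \<in> carrier R" by simp_all
  ultimately have "(\<one> \<oplus> \<one>) \<ominus> \<zero> \<in> \<pp>" using coset_eq_iff by blast
  then show ?thesis by (simp add: minus_eq)
qed

text \<open>Two nonzero generators of the same principal ideal of a domain differ by a unit.\<close>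

lemma (in discrete_valuation_ring) two_eq_uniformizer_pow:
  assumes \<pi>: "\<pi> \<in> carrier R" "\<pp> = PIdl \<pi>" "\<pi> \<noteq> \<zero>"
    and e: "PIdl (\<one> \<oplus> \<one>) = ideal_power R \<pp> e"
  obtains \<epsilon> where "\<epsilon> \<in> Units R" "\<one> \<oplus> \<one> = \<pi> [^] e \<otimes> \<epsilon>"
proof -
  have c: "\<one> \<oplus> \<one> \<in> carrier R" "\<pi> [^] e \<in> carrier R" using \<pi>(1) by simp_all
  have nz: "\<pi> [^] e \<noteq> \<zero>"
    by (induction e) (use \<pi>(1,3) integral in auto)
  have "PIdl (\<one> \<oplus> \<one>) = PIdl (\<pi> [^] e)"
    using e ideal_power_principal[OF \<pi>(1)] \<pi>(2) by simp
  then have "\<one> \<oplus> \<one> \<in> PIdl (\<pi> [^] e)" "\<pi> [^] e \<in> PIdl (\<one> \<oplus> \<one>)"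
    using cgenideal_self[OF c(1)] cgenideal_self[OF c(2)] by simp_all
  then obtain x y where x: "x \<in> carrier R" "\<one> \<oplus> \<one> = x \<otimes> \<pi> [^] e"
    and y: "y \<in> carrier R" "\<pi> [^] e = y \<otimes> (\<one> \<oplus> \<one>)"
    unfolding cgenideal_def by blast
  have "\<pi> [^] e \<otimes> (y \<otimes> x) = y \<otimes> (x \<otimes> \<pi> [^] e)" using x(1) y(1) c by (simp only: m_ac m_closed)
  also have "\<dots> = \<pi> [^] e \<otimes> \<one>" using x(2) y(2) c(2) by simp
  finally have "y \<otimes> x = \<one>" using m_lcancel[OF nz c(2), of "y \<otimes> x" \<one>] x(1) y(1) by simp
  then have "x \<in> Units R" using x(1) y(1) m_comm[OF x(1) y(1)] unfolding Units_def by auto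
  moreover have "\<one> \<oplus> \<one> = \<pi> [^] e \<otimes> x" using x m_comm[OF x(1) c(2)] by simp
  ultimately show thesis by (rule that)
qed

theorem theorem1p2:
  fixes R :: "('a, 'm) ring_scheme" and \<pp> :: "'a set"
    and R' :: "('b, 'n) ring_scheme" and \<pp>' :: "'b set"
    and e r :: nat
  assumes "compact_discrete_valuation_ring R \<pp>"
    and "ring_char R = 0"
    and "finite (carrier (R Quot \<pp>))"
    and "ring_char (R Quot \<pp>) = 2"
    and "PIdl\<^bsub>R\<^esub> (\<one>\<^bsub>R\<^esub> \<oplus>\<^bsub>R\<^esub> \<one>\<^bsub>R\<^esub>) = ideal_power R \<pp> e"
    and "compact_discrete_valuation_ring R' \<pp>'"
    and "ring_char R' = 2"
    and "finite (carrier (R' Quot \<pp>'))"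
    and "(R Quot \<pp>) \<simeq> (R' Quot \<pp>')"
    and "r > e"
  shows "\<not> complex_algebras_isomorphic
      (group_algebra (SL2 (R Quot ideal_power R \<pp> (2 * r))))
      (group_algebra (SL2 (R' Quot ideal_power R' \<pp>' (2 * r))))"
proof -
  interpret R: compact_discrete_valuation_ring R \<pp> by fact
  interpret R': compact_discrete_valuation_ring R' \<pp>' by fact
  obtain \<pi> where \<pi>: "\<pi> \<in> carrier R" "\<pp> = PIdl\<^bsub>R\<^esub> \<pi>" "\<pi> \<noteq> \<zero>\<^bsub>R\<^esub>" "\<pi> \<notin> Units R"
    by (rule R.uniformizer)
  obtain \<pi>' where \<pi>': "\<pi>' \<in> carrier R'" "\<pp>' = PIdl\<^bsub>R'\<^esub> \<pi>'" "\<pi>' \<noteq> \<zero>\<^bsub>R'\<^esub>" "\<pi>' \<notin> Units R'"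
    by (rule R'.uniformizer)
  have two_p: "\<one>\<^bsub>R\<^esub> \<oplus>\<^bsub>R\<^esub> \<one>\<^bsub>R\<^esub> \<in> \<pp>" using R.two_in_maximalideal[OF assms(4)] .
  obtain \<epsilon> where \<epsilon>: "\<epsilon> \<in> Units R" "\<one>\<^bsub>R\<^esub> \<oplus>\<^bsub>R\<^esub> \<one>\<^bsub>R\<^esub> = \<pi> [^]\<^bsub>R\<^esub> e \<otimes>\<^bsub>R\<^esub> \<epsilon>"
    using R.two_eq_uniformizer_pow[OF \<pi>(1-3) assms(5)] .
  have \<epsilon>c: "\<epsilon> \<in> carrier R" using \<epsilon>(1) by (rule R.Units_closed)
  \<comment> \<open>For \<open>e = 0\<close> the element 2 would be a unit, although it lies in
    \<open>\<pp>\<close>. With \<open>r > e\<close> this gives \<open>r \<ge> 2\<close>, which the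
    argument in characteristic 2 requires.\<close>
  have "e \<noteq> 0"
  proof
    assume "e = 0"
    then have "\<epsilon> \<in> \<pp>" using two_p \<epsilon> \<epsilon>c by simp
    then have "\<one>\<^bsub>R\<^esub> \<in> \<pp>"
      using R.I_l_closed[of \<epsilon> "inv\<^bsub>R\<^esub> \<epsilon>"] R.Units_l_inv[OF \<epsilon>(1)] R.Units_inv_closed[OF \<epsilon>(1)] by simp
    then show False using R.one_imp_carrier R.I_notcarr by simp
  qed
  then have r: "2 \<le> r" "0 < 2 * r" using assms(10) by simp_all
  let ?J = "ideal_power R \<pp> (2 * r)" and ?J' = "ideal_power R' \<pp>' (2 * r)"
  let ?S = "R Quot ?J" and ?S' = "R' Quot ?J'"
  interpret h: ring_hom_cring R ?S "(+>\<^bsub>R\<^esub>) ?J"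
    using R.quotient_hom[OF \<pi> r(2) assms(3)] .
  interpret h': ring_hom_cring R' ?S' "(+>\<^bsub>R'\<^esub>) ?J'"
    using R'.quotient_hom[OF \<pi>' r(2) assms(8)] .
  show ?thesis
  proof (rule SL2_algebras_not_isomorphic[OF R.quotient_chain_ring[OF \<pi> r(2) assms(3)]
        R'.quotient_chain_ring[OF \<pi>' r(2) assms(8)] refl r(1)])
    obtain f where "f \<in> ring_iso (R Quot \<pp>) (R' Quot \<pp>')" using assms(9) unfolding is_ring_iso_def by blast
    then have "card (carrier (R Quot \<pp>)) = card (carrier (R' Quot \<pp>'))"
      using ring_iso_memE(5) bij_betw_same_card by metis
    then show "chain_ring.q ?S (?J +>\<^bsub>R\<^esub> \<pi>) (2 * r) = chain_ring.q ?S' (?J' +>\<^bsub>R'\<^esub> \<pi>') (2 * r)"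
      using R.quotient_q[OF \<pi> r(2) assms(3)] R'.quotient_q[OF \<pi>' r(2) assms(8)] by simp
    show "\<one>\<^bsub>?S\<^esub> \<oplus>\<^bsub>?S\<^esub> \<one>\<^bsub>?S\<^esub> \<in> chain_ring.pw ?S (?J +>\<^bsub>R\<^esub> \<pi>) 1"
      using R.quotient_two_in_pw[OF \<pi> r(2) assms(3) two_p] .
    show "?J +>\<^bsub>R\<^esub> \<epsilon> \<in> Units ?S"
    proof -
      let ?u = "?J +>\<^bsub>R\<^esub> \<epsilon>" and ?v = "?J +>\<^bsub>R\<^esub> inv\<^bsub>R\<^esub> \<epsilon>"
      have u: "?u \<in> carrier ?S" and v: "?v \<in> carrier ?S"
        using h.hom_closed \<epsilon>c R.Units_inv_closed[OF \<epsilon>(1)] by blast+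
      have uv: "?u \<otimes>\<^bsub>?S\<^esub> ?v = \<one>\<^bsub>?S\<^esub>"
        using h.hom_mult[OF \<epsilon>c R.Units_inv_closed[OF \<epsilon>(1)]] R.Units_r_inv[OF \<epsilon>(1)] h.hom_one
        by (simp only:)
      then have "?v \<otimes>\<^bsub>?S\<^esub> ?u = \<one>\<^bsub>?S\<^esub>" using h.S.m_comm[OF v u] by (simp only:)
      then show ?thesis unfolding Units_def using u v uv by blast
    qed
    have "\<one>\<^bsub>?S\<^esub> \<oplus>\<^bsub>?S\<^esub> \<one>\<^bsub>?S\<^esub> = ?J +>\<^bsub>R\<^esub> (\<one>\<^bsub>R\<^esub> \<oplus>\<^bsub>R\<^esub> \<one>\<^bsub>R\<^esub>)" by simp
    also have "\<dots> = (?J +>\<^bsub>R\<^esub> \<pi>) [^]\<^bsub>?S\<^esub> e \<otimes>\<^bsub>?S\<^esub> (?J +>\<^bsub>R\<^esub> \<epsilon>)"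
      unfolding \<epsilon>(2) R.hom_pow[OF \<pi> r(2) assms(3)] using \<pi>(1) \<epsilon>c by simp
    finally show "\<one>\<^bsub>?S\<^esub> \<oplus>\<^bsub>?S\<^esub> \<one>\<^bsub>?S\<^esub> = (?J +>\<^bsub>R\<^esub> \<pi>) [^]\<^bsub>?S\<^esub> e \<otimes>\<^bsub>?S\<^esub> (?J +>\<^bsub>R\<^esub> \<epsilon>)" .
    show "e < r" by fact
    have "\<one>\<^bsub>R'\<^esub> \<oplus>\<^bsub>R'\<^esub> \<one>\<^bsub>R'\<^esub> = \<zero>\<^bsub>R'\<^esub>"
      using R'.ring_char_dvd_iff[of 2] R'.two_eq_add_pow assms(7) by simp
    then have "?J' +>\<^bsub>R'\<^esub> (\<one>\<^bsub>R'\<^esub> \<oplus>\<^bsub>R'\<^esub> \<one>\<^bsub>R'\<^esub>) = \<zero>\<^bsub>?S'\<^esub>" by simp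
    then show "\<one>\<^bsub>?S'\<^esub> \<oplus>\<^bsub>?S'\<^esub> \<one>\<^bsub>?S'\<^esub> = \<zero>\<^bsub>?S'\<^esub>" by simp
  qed
qed

end
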